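(* Let $c_0\in\mathbb{C}^*$ and suppose that $P_{c_0}$ has an indifferent periodic orbit other than the fixed point at the origin. Then $c_0\in\partial\mathcal{M}_3(\theta)$.
   Context: Fix an irrational number $0<\theta<1$ of Brjuno type, i.e. $\sum_{n\ge1}(\log q_{n+1})/q_n<\infty$, where $p_n/q_n$ are the continued fraction convergents of $\theta$; let $\lambda=e^{2\pi i\theta}$. For $c\in\mathbb{C}^*=\mathbb{C}\smallsetminus\{0\}$ let $$P_c(z)=\lambda z\left(1-\tfrac12\left(1+\tfrac1c\right)z+\tfrac{1}{3c}z^2\right),$$ a cubic polynomial with critical points $c$ and $1$ and with a Siegel disk of rotation number $\theta$ centered at the fixed point $0$. The cubic connectedness locus is $\mathcal{M}_3(\theta)=\{c\in\mathbb{C}^*: J(P_c)\text{ is connected}\}$, where $J(P_c)$ is the Julia set; its boundary is taken in $\mathbb{C}^*$. A periodic orbit is indifferent if its multiplier has absolute value $1$. *)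

theory Defs
  imports "HOL-Complex_Analysis.Complex_Analysis"
begin

text \<open>
  Continued fraction expansion \<open>x = [a\<^sub>0; a\<^sub>1, a\<^sub>2, \<dots>]\<close>, meant for irrational \<open>x\<close>:
  \<open>cf_rem x n\<close> is the \<open>n\<close>-th complete quotient and \<open>cf_coeff x n\<close> is \<open>a\<^sub>n\<close>.
\<close>

fun cf_rem :: "real \<Rightarrow> nat \<Rightarrow> real" where
  "cf_rem x 0 = x"
| "cf_rem x (Suc n) = 1 / frac (cf_rem x n)"

definition cf_coeff :: "real \<Rightarrow> nat \<Rightarrow> int" where
  "cf_coeff x n = \<lfloor>cf_rem x n\<rfloor>"

text \<open>
  Denominator \<open>q\<^sub>n\<close> of the \<open>n\<close>-th convergent \<open>p\<^sub>n/q\<^sub>n = [a\<^sub>0; a\<^sub>1, \<dots>, a\<^sub>n]\<close> in lowest terms.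
\<close>

fun cf_denom :: "real \<Rightarrow> nat \<Rightarrow> int" where
  "cf_denom x 0 = 1"
| "cf_denom x (Suc 0) = cf_coeff x 1"
| "cf_denom x (Suc (Suc n)) =
     cf_coeff x (Suc (Suc n)) * cf_denom x (Suc n) + cf_denom x n"

text \<open>
  The index shift makes the series start at \<open>n = 1\<close>. All its terms are nonnegative,
  so \<open>summable\<close> says that the sum is finite.
\<close>

definition brjuno :: "real \<Rightarrow> bool" where
  "brjuno \<theta> \<longleftrightarrow> \<theta> \<notin> \<rat> \<and>
     summable (\<lambda>n. ln (real_of_int (cf_denom \<theta> (n + 2))) / real_of_int (cf_denom \<theta> (n + 1)))"

definition siegel_cubic :: "real \<Rightarrow> complex \<Rightarrow> complex \<Rightarrow> complex" where
  "siegel_cubic \<theta> c z =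
     exp (2 * complex_of_real pi * \<i> * complex_of_real \<theta>) * z *
       (1 - 1/2 * (1 + 1/c) * z + 1/(3*c) * z^2)"

text \<open>
  For a polynomial of degree at least 2 the Julia set is the boundary of the filled Julia set,
  the set of points with bounded forward orbit.
\<close>

definition filled_julia :: "(complex \<Rightarrow> complex) \<Rightarrow> complex set" where
  "filled_julia f = {z. bounded (range (\<lambda>n. (f ^^ n) z))}"

definition julia :: "(complex \<Rightarrow> complex) \<Rightarrow> complex set" where
  "julia f = frontier (filled_julia f)"

definition M3 :: "real \<Rightarrow> complex set" where
  "M3 \<theta> = {c. c \<noteq> 0 \<and> connected (julia (siegel_cubic \<theta> c))}"

definition periodic_point :: "(complex \<Rightarrow> complex) \<Rightarrow> complex \<Rightarrow> bool" where
  "periodic_point f z \<longleftrightarrow> (\<exists>n>0. (f ^^ n) z = z)"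

definition period :: "(complex \<Rightarrow> complex) \<Rightarrow> complex \<Rightarrow> nat" where
  "period f z = (LEAST n. n > 0 \<and> (f ^^ n) z = z)"

definition multiplier :: "(complex \<Rightarrow> complex) \<Rightarrow> complex \<Rightarrow> complex" where
  "multiplier f z = deriv (f ^^ period f z) z"

text \<open>
  By the chain rule the multiplier is the same at every point of the orbit, so it does not
  matter which point \<open>z\<close> represents the orbit \<open>X\<close>.
\<close>

definition indifferent_periodic_orbit :: "(complex \<Rightarrow> complex) \<Rightarrow> complex set \<Rightarrow> bool" where
  "indifferent_periodic_orbit f X \<longleftrightarrow>
     (\<exists>z. periodic_point f z \<and> X = range (\<lambda>n. (f ^^ n) z) \<and> norm (multiplier f z) = 1)"

end

theory Submission
  imports Defs "Subresultants.Subresultant_Gcd" "HOL-Computational_Algebra.Field_as_Ring"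
    "HOL-Computational_Algebra.Fundamental_Theorem_Algebra"
begin

text \<open>
  The boundary point is located by two facts: the Julia set of \<open>P\<^bsub>c\<^sub>0\<^esub>\<close> is connected, and no
  neighbourhood of \<open>c\<^sub>0\<close> consists of parameters with connected Julia set. Write \<open>\<lambda>\<close> for the
  multiplier of the fixed point \<open>0\<close>; it has modulus 1 and is not a root of unity.

  \<^emph>\<open>Connectedness is boundedness of the critical orbits.\<close> A proper holomorphic map between bounded
  simply connected domains with a totally ramified point is a power map \<open>z\<^sup>d\<close> in Riemann coordinates
  (\<open>proper_holomorphic_totally_ramified\<close>). Near infinity, an iterate of the polynomial is such a map
  on the exterior of a connected sublevel set, so no critical point can escape when the Julia set
  is connected. Conversely, if a sublevel set \<open>{|f\<^sup>n| < R}\<close> that contains both critical points of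
  the cubic were disconnected, a component would map to the previous sublevel set as \<open>z\<^sup>2\<close>, and
  counting preimages of the other critical value gives a contradiction.

  \<^emph>\<open>A second indifferent cycle binds both critical points.\<close> Suppose one critical point escapes. Add
  to the polynomial a small multiple of an interpolating function which vanishes on both indifferent
  cycles and shrinks their multipliers. On a sublevel set that avoids the escaping critical point the
  perturbed map is still proper and has at most one critical point, but it has two attracting
  cycles, and each of them must attract a critical point
  (\<open>attracting_cycle_attracts_critical_point\<close>): otherwise all inverse branches along the cycle would
  exist on a fixed disc, with derivatives that grow without bound. Hence
  \<open>indifferent_cycle_unique_if_critical_escapes\<close>, and \<open>c\<^sub>0\<close> belongs to the connectedness locus.

  \<^emph>\<open>Interior parameters.\<close> On a disc of parameters with connected Julia set the orbits of the
  two critical points are uniformly bounded, so they form normal families of functions of the parameter.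
  An attracting cycle at one parameter is the limit of a critical orbit; by normality this limit is a
  holomorphic function on the whole disc, and it stays attracting: if it became repelling, the critical
  point would have to land on it for an open set of parameters, hence for all parameters, although
  each critical point escapes for some of them. Therefore no attracting cycle can occur close to the
  indifferent one. Counting the nearby cycles with the weight \<open>1 - \<mu>\<^sub>0/\<mu>\<close>, where \<open>\<mu>\<close> is the multiplier
  of the cycle and \<open>\<mu>\<^sub>0\<close> that of the indifferent one, gives a holomorphic function of the parameter
  with nonnegative real part and a zero; so it vanishes and the multiplier is constant. Having a cycle
  with a prescribed multiplier is an algebraic condition on the parameter (a resultant), so every
  parameter would have such an indifferent cycle, also one for which a critical point escapes.
\<close>


section \<open>Proper holomorphic maps with a totally ramified point\<close>

text \<open>
  Properness is stated for the restriction of \<open>f\<close> to \<open>U\<close>: the function itself is total.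
\<close>

definition proper_holomorphic :: "(complex \<Rightarrow> complex) \<Rightarrow> complex set \<Rightarrow> complex set \<Rightarrow> bool" where
  "proper_holomorphic f U V \<longleftrightarrow> open U \<and> open V \<and> f holomorphic_on U \<and> f ` U \<subseteq> V \<and>
     (\<forall>K. compact K \<and> K \<subseteq> V \<longrightarrow> compact (U \<inter> f -` K))"

lemma proper_disc_map_norm_near_1:
  assumes F: "proper_holomorphic F (ball 0 1) (ball 0 1)" and "e > 0"
  obtains r where "0 < r" "r < 1" "\<And>z. r \<le> norm z \<Longrightarrow> norm z < 1 \<Longrightarrow> 1 - e < norm (F z)"
proof -
  let ?C = "ball 0 1 \<inter> F -` cball 0 (1 - e)"
  have "compact ?C"
  proof -
    have "cball (0::complex) (1 - e) \<subseteq> ball 0 1" using \<open>e > 0\<close> by auto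
    then show ?thesis using F unfolding proper_holomorphic_def by (metis compact_cball)
  qed
  then obtain s where s: "s < 1" "\<And>z. z \<in> ?C \<Longrightarrow> norm z \<le> s"
  proof (cases "?C = {}")
    case False
    obtain x where "x \<in> ?C" "\<forall>y\<in>?C. norm y \<le> norm x"
      using continuous_attains_sup[OF \<open>compact ?C\<close> False, of norm]
      by (metis continuous_on_norm_id)
    then show ?thesis using that[of "norm x"] by auto
  qed (use that[of 0] in auto)
  show ?thesis
  proof (rule that[of "max (1/2) ((s+1)/2)"])
    fix z :: complex
    assume z: "max (1/2) ((s+1)/2) \<le> norm z" "norm z < 1"
    then have "z \<notin> ?C" using s(2)[of z] s(1) by force
    with z show "1 - e < norm (F z)" by auto
  qed (use s in auto)
qed

text \<open>
  Division by \<open>z\<^sup>d\<close>, where \<open>d\<close> is the order of the zero, leaves a function \<open>G\<close> without zeros whose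
  modulus tends to 1 at the unit circle. The maximum principle for \<open>G\<close> and for \<open>1/G\<close> makes it a
  constant of modulus 1.
\<close>

lemma proper_disc_map_totally_ramified:
  assumes F: "proper_holomorphic F (ball 0 1) (ball 0 1)"
    and F0: "\<And>z. z \<in> ball 0 1 \<Longrightarrow> F z = 0 \<longleftrightarrow> z = 0"
  obtains u d where "norm u = 1" "d > 0" "\<And>z. z \<in> ball 0 1 \<Longrightarrow> F z = u * z ^ d"
proof -
  have holF: "F holomorphic_on ball 0 1"
    using F by (simp add: proper_holomorphic_def)
  have "\<not> F constant_on ball 0 1"
    using F0[of 0] F0[of "1/2"] by (force simp: constant_on_def)
  then obtain g r d where d: "0 < d" "0 < r" "ball (0::complex) r \<subseteq> ball 0 1" "g holomorphic_on ball 0 r"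
      and g: "\<And>w. w \<in> ball 0 r \<Longrightarrow> F w = (w - 0) ^ d * g w" "\<And>w. w \<in> ball 0 r \<Longrightarrow> g w \<noteq> 0"
  proof -
    have "0 \<in> ball (0::complex) 1" "F 0 = 0" using F0[of 0] by simp_all
    from holomorphic_factor_zero_nonconstant[OF holF open_ball connected_ball this \<open>\<not> F constant_on ball 0 1\<close>] that
    show thesis .
  qed
  define G where "G = (\<lambda>z. if z \<in> ball 0 r then g z else F z / z ^ d)"
  have "G holomorphic_on ball 0 r \<union> (ball 0 1 - {0})"
    unfolding G_def
  proof (rule holomorphic_on_If_Un)
    show "(\<lambda>z. F z / z ^ d) holomorphic_on ball 0 1 - {0}"
      by (intro holomorphic_intros holomorphic_on_subset[OF holF]) auto
  qed (use d g in auto)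
  moreover have "ball 0 r \<union> (ball 0 1 - {0}) = ball (0::complex) 1"
  proof (intro equalityI subsetI)
    fix x :: complex assume "x \<in> ball 0 r \<union> (ball 0 1 - {0})"
    then show "x \<in> ball 0 1" using subsetD[OF d(3), of x] by blast
  qed (use d(2) in auto)
  ultimately have holG: "G holomorphic_on ball 0 1" by simp
  have FG: "F z = z ^ d * G z" if "z \<in> ball 0 1" for z
    using g that d unfolding G_def by auto
  have G0: "G z \<noteq> 0" if "z \<in> ball 0 1" for z
    using FG[OF that] F0[OF that] g(2)[of 0] d by (cases "z = 0") (auto simp: G_def)
  have ge: "norm (G z) \<ge> 1" if z: "z \<in> ball 0 1" for z
  proof (rule field_le_epsilon)
    fix e :: real assume "e > 0"
    define e' where "e' = min e (1/2)"
    have e': "e' > 0" "e' \<le> e" "e' < 1" using \<open>e > 0\<close> by (auto simp: e'_def)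
    obtain s where s: "0 < s" "s < 1" "\<And>z. s \<le> norm z \<Longrightarrow> norm z < 1 \<Longrightarrow> 1 - e' < norm (F z)"
      using proper_disc_map_norm_near_1[OF F e'(1)] by metis
    define t where "t = (max s (norm z) + 1) / 2"
    have t: "s < t" "norm z < t" "t < 1" using s z by (auto simp: t_def max_def)
    have sub: "cball 0 t \<subseteq> ball (0::complex) 1" using t by auto
    have "norm (inverse (G z)) \<le> 1 / (1 - e')"
    proof (rule maximum_modulus_frontier[of "\<lambda>z. inverse (G z)" "cball 0 t"])
      show "(\<lambda>z. inverse (G z)) holomorphic_on interior (cball 0 t)"
        by (intro holomorphic_intros holomorphic_on_subset[OF holG])
           (use sub G0 interior_subset in blast)+
      show "continuous_on (closure (cball 0 t)) (\<lambda>z. inverse (G z))"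
        using sub G0 by (intro continuous_intros holomorphic_on_imp_continuous_on
            holomorphic_on_subset[OF holG]) auto
      fix w :: complex assume "w \<in> frontier (cball 0 t)"
      then have w: "norm w = t" using t s by (simp add: frontier_cball)
      have "1 - e' < norm (F w)" using s(3)[of w] w t by auto
      also have "norm (F w) = t ^ d * norm (G w)"
        using FG[of w] w t by (simp add: norm_mult norm_power)
      also have "\<dots> \<le> norm (G w)"
        using t s by (intro mult_left_le_one_le) (auto simp: power_le_one)
      finally show "norm (inverse (G w)) \<le> 1 / (1 - e')"
        using e' unfolding norm_inverse inverse_eq_divide[of "norm _"] by (intro divide_left_mono mult_pos_pos) auto
    qed (use t in auto)
    then have "1 - e' \<le> norm (G z)"
      using e' G0[OF z] unfolding norm_inverse inverse_eq_divide[of "norm _"]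
      by (simp add: field_simps)
    then show "1 \<le> norm (G z) + e" using e' by linarith
  qed
  have le: "norm (G z) \<le> 1" if z: "z \<in> ball 0 1" for z
  proof -
    have *: "norm (G z) * t ^ d \<le> 1" if t: "norm z < t" "t < 1" for t
    proof -
      have t0: "t > 0" using t norm_ge_zero[of z] by linarith
      have sub: "cball 0 t \<subseteq> ball (0::complex) 1" using t by auto
      have "norm (G z) \<le> 1 / t ^ d"
      proof (rule maximum_modulus_frontier[of G "cball 0 t"])
        show "G holomorphic_on interior (cball 0 t)"
          by (rule holomorphic_on_subset[OF holG]) (use sub interior_subset in blast)
        show "continuous_on (closure (cball 0 t)) G"
          using sub by (intro holomorphic_on_imp_continuous_on holomorphic_on_subset[OF holG]) auto
        fix w :: complex assume "w \<in> frontier (cball 0 t)"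
        then have w: "norm w = t" using t t0 by (simp add: frontier_cball)
        have "w \<in> ball 0 1" using w t by simp
        then have "F w \<in> ball 0 1" using F unfolding proper_holomorphic_def by blast
        then have "t ^ d * norm (G w) < 1"
          using FG[of w] w t by (simp add: norm_mult norm_power)
        then show "norm (G w) \<le> 1 / t ^ d" using t0 by (simp add: field_simps)
      qed (use t in auto)
      then show ?thesis using t0 by (simp add: field_simps)
    qed
    have "((\<lambda>t. norm (G z) * t ^ d) \<longlongrightarrow> norm (G z) * 1 ^ d) (at_left (1::real))"
      by (intro tendsto_intros)
    moreover have "eventually (\<lambda>t. norm (G z) * t ^ d \<le> 1) (at_left (1::real))"
      by (rule eventually_at_leftI[of "norm z"]) (use * z in auto)
    ultimately have "norm (G z) * 1 ^ d \<le> 1" by (rule tendsto_upperbound) simp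
    then show ?thesis by simp
  qed
  have "G constant_on ball 0 1"
    using order_trans[OF le ge[of 0]] by (intro maximum_modulus_principle[OF holG, of "ball 0 1" 0]) auto
  then obtain u where u: "\<And>z. z \<in> ball 0 1 \<Longrightarrow> G z = u"
    by (auto simp: constant_on_def)
  show ?thesis
  proof (rule that[of u d])
    show "norm u = 1" using u[of 0] ge[of 0] le[of 0] by simp
  qed (use FG u d in auto)
qed

lemma Riemann_map_centered:
  assumes "open S" "simply_connected S" "bounded S" "a \<in> S"
  obtains f g where "f holomorphic_on S" "g holomorphic_on ball 0 1"
    "\<And>z. z \<in> S \<Longrightarrow> f z \<in> ball 0 1" "\<And>z. z \<in> S \<Longrightarrow> g (f z) = z"
    "\<And>z. z \<in> ball 0 1 \<Longrightarrow> g z \<in> S" "\<And>z. z \<in> ball 0 1 \<Longrightarrow> f (g z) = z" "f a = 0" "g 0 = a"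
proof -
  have "S \<noteq> {}" "S \<noteq> UNIV" using assms not_bounded_UNIV by auto
  then obtain f g where fg': "f holomorphic_on S" "g holomorphic_on ball 0 1"
      "\<forall>z\<in>S. f z \<in> ball 0 1 \<and> g (f z) = z" "\<forall>z\<in>ball 0 1. g z \<in> S \<and> f (g z) = z"
    using iffD1[OF Riemann_mapping_theorem[of S] conjI[OF assms(1,2)]] by blast
  then have fg: "f holomorphic_on S" "g holomorphic_on ball 0 1"
     "\<And>z. z \<in> S \<Longrightarrow> f z \<in> ball 0 1" "\<And>z. z \<in> S \<Longrightarrow> g (f z) = z"
     "\<And>z. z \<in> ball 0 1 \<Longrightarrow> g z \<in> S" "\<And>z. z \<in> ball 0 1 \<Longrightarrow> f (g z) = z"
    by blast+
  obtain h k where hk: "h (f a) = 0"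
     "h holomorphic_on ball 0 1" "h ` ball 0 1 \<subseteq> ball 0 1"
     "k holomorphic_on ball 0 1" "k ` ball 0 1 \<subseteq> ball 0 1"
     "\<And>z. z \<in> ball 0 1 \<Longrightarrow> h (k z) = z" "\<And>z. z \<in> ball 0 1 \<Longrightarrow> k (h z) = z"
    using ball_biholomorphism_exists[OF fg(3)[OF \<open>a \<in> S\<close>]] by metis
  show ?thesis
  proof (rule that[of "h \<circ> f" "g \<circ> k"])
    show "h \<circ> f holomorphic_on S"
      using fg hk by (intro holomorphic_on_compose_gen[of f S h "ball 0 1"]) auto
    show "g \<circ> k holomorphic_on ball 0 1"
      using fg hk by (intro holomorphic_on_compose_gen[of k _ g "ball 0 1"]) auto
    show "(g \<circ> k) 0 = a"
      using hk(1) hk(7)[OF fg(3)[OF \<open>a \<in> S\<close>]] fg(4)[OF \<open>a \<in> S\<close>] by simp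
    show "(h \<circ> f) z \<in> ball 0 1" "(g \<circ> k) ((h \<circ> f) z) = z" if "z \<in> S" for z
      using fg(3,4)[OF that] hk(7)[of "f z"] subsetD[OF hk(3) imageI, of "f z"] by simp_all
    show "(g \<circ> k) z \<in> S" "(h \<circ> f) ((g \<circ> k) z) = z" if "z \<in> ball 0 1" for z
      using fg(5,6)[of "k z"] subsetD[OF hk(5) imageI[OF that]] hk(6)[OF that] by simp_all
  qed (use hk in simp)
qed

text \<open>
  The disc case, read in Riemann coordinates \<open>f\<close> of \<open>W\<close> centred at \<open>a\<close> and \<open>g\<close> of \<open>V\<close> centred at \<open>q a\<close>.
  The unimodular constant is absorbed into \<open>g\<close>.
\<close>

lemma proper_holomorphic_totally_ramified:
  assumes q: "proper_holomorphic q W V"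
    and W: "simply_connected W" "bounded W" and V: "simply_connected V" "bounded V"
    and a: "a \<in> W" and fibre: "\<And>z. z \<in> W \<Longrightarrow> q z = q a \<Longrightarrow> z = a"
  obtains d :: nat and f g f' where "d > 0" 
    "f holomorphic_on W" "g holomorphic_on V" "f' holomorphic_on ball 0 1"
    "f ` W \<subseteq> ball 0 1" "f a = 0" "f' ` ball 0 1 \<subseteq> W" "g (q a) = 0" "inj_on f W" "inj_on g V"
    "g ` V \<subseteq> ball 0 1"
    "\<And>z. z \<in> W \<Longrightarrow> f' (f z) = z"  "\<And>z. z \<in> ball 0 1 \<Longrightarrow> f (f' z) = z"
    "\<And>z. z \<in> W \<Longrightarrow> g (q z) = f z ^ d"
proof -
  have q': "open W" "open V" "q holomorphic_on W" "q ` W \<subseteq> V"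
     "\<And>K. compact K \<Longrightarrow> K \<subseteq> V \<Longrightarrow> compact (W \<inter> q -` K)"
    using q by (auto simp: proper_holomorphic_def)
  obtain f f' where f: "f holomorphic_on W" "f' holomorphic_on ball 0 1"
    "\<And>z. z \<in> W \<Longrightarrow> f z \<in> ball 0 1" "\<And>z. z \<in> W \<Longrightarrow> f' (f z) = z"
    "\<And>z. z \<in> ball 0 1 \<Longrightarrow> f' z \<in> W" "\<And>z. z \<in> ball 0 1 \<Longrightarrow> f (f' z) = z" "f a = 0" "f' 0 = a"
    using Riemann_map_centered[OF q'(1) W a] by metis
  have qa: "q a \<in> V" using q' a by auto
  obtain g g' where g: "g holomorphic_on V" "g' holomorphic_on ball 0 1"
    "\<And>z. z \<in> V \<Longrightarrow> g z \<in> ball 0 1" "\<And>z. z \<in> V \<Longrightarrow> g' (g z) = z"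
    "\<And>z. z \<in> ball 0 1 \<Longrightarrow> g' z \<in> V" "\<And>z. z \<in> ball 0 1 \<Longrightarrow> g (g' z) = z" "g (q a) = 0" "g' 0 = q a"
    using Riemann_map_centered[OF q'(2) V qa] by metis
  define F where "F = (\<lambda>z. g (q (f' z)))"
  have qf: "q (f' z) \<in> V" if "z \<in> ball 0 1" for z using f(5)[OF that] q'(4) by auto
  have "proper_holomorphic F (ball 0 1) (ball 0 1)"
    unfolding proper_holomorphic_def
  proof (intro conjI allI impI)
    have "q \<circ> f' holomorphic_on ball 0 1"
      using f q' by (intro holomorphic_on_compose_gen[OF f(2) q'(3)]) auto
    then have "g \<circ> (q \<circ> f') holomorphic_on ball 0 1"
      using qf by (intro holomorphic_on_compose_gen[OF _ g(1)]) auto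
    then show "F holomorphic_on ball 0 1" by (simp add: F_def o_def)
    show "F ` ball 0 1 \<subseteq> ball 0 1" using qf g(3) by (auto simp: F_def)
    fix K :: "complex set" assume K: "compact K \<and> K \<subseteq> ball 0 1"
    then have "compact (g' ` K)" "g' ` K \<subseteq> V"
      using g(5) by (auto intro!: compact_continuous_image holomorphic_on_imp_continuous_on
          holomorphic_on_subset[OF g(2)])
    then have "compact (f ` (W \<inter> q -` (g' ` K)))"
      using q'(5) by (intro compact_continuous_image holomorphic_on_imp_continuous_on
         holomorphic_on_subset[OF f(1)]) auto
    also have "f ` (W \<inter> q -` (g' ` K)) = ball 0 1 \<inter> F -` K"
    proof safe
      fix z k assume "z \<in> W" "k \<in> K" "q z = g' k"
      then show "f z \<in> ball 0 1" "f z \<in> F -` K"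
        using f g K by (auto simp: F_def)
    next
      fix z assume z: "z \<in> ball 0 1" "F z \<in> K"
      have "f' z \<in> W \<inter> q -` g' ` K"
        using z f(5) g(4)[OF qf[OF z(1)]] unfolding F_def by (metis IntI imageI vimageI)
      then show "z \<in> f ` (W \<inter> q -` g' ` K)" using f(6)[OF z(1)] by (metis imageI)
    qed
    finally show "compact (ball 0 1 \<inter> F -` K)" .
  qed auto
  moreover have "F z = 0 \<longleftrightarrow> z = 0" if "z \<in> ball 0 1" for z
  proof
    assume "F z = 0"
    then have "q (f' z) = q a" using g(4)[OF qf[OF that]] g(8) by (simp add: F_def)
    then show "z = 0" using fibre[OF f(5)[OF that]] f(6)[OF that] f(7) by simp
  qed (use f g in \<open>auto simp: F_def\<close>)
  ultimately obtain u d where u: "norm u = 1" "d > 0" "\<And>z. z \<in> ball 0 1 \<Longrightarrow> F z = u * z ^ d"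
    using proper_disc_map_totally_ramified by metis
  show ?thesis
  proof (rule that[of d f "\<lambda>z. g z / u" f'])
    show "inj_on f W" using f(4) by (metis inj_on_inverseI)
    show "inj_on (\<lambda>z. g z / u) V" 
      using g(4) u(1) by (intro inj_on_inverseI[of _ "\<lambda>z. g' (z * u)"]) auto
    show "g (q z) / u = f z ^ d" if "z \<in> W" for z
      using u(3)[OF f(3)[OF that]] f(4)[OF that] u(1) by (auto simp: F_def)
    show "(\<lambda>z. g z / u) holomorphic_on V" using g(1) u(1) by (intro holomorphic_intros) auto
    show "(\<lambda>z. g z / u) ` V \<subseteq> ball 0 1"
      using g(3) u(1) by (auto simp: norm_divide)
    show "f ` W \<subseteq> ball 0 1" "f' ` ball 0 1 \<subseteq> W" using f(3,5) by blast+
    show "g (q a) / u = 0" using g(7) by simp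
  qed (fact u(2) f(1,2,4,6,7))+
qed

lemma totally_ramified_no_other_critical:
  assumes q: "proper_holomorphic q W V"
    and W: "simply_connected W" "bounded W" and V: "simply_connected V" "bounded V"
    and a: "a \<in> W" and fibre: "\<And>z. z \<in> W \<Longrightarrow> q z = q a \<Longrightarrow> z = a"
    and z: "z \<in> W" "z \<noteq> a"
  shows "deriv q z \<noteq> 0"
proof
  assume q0: "deriv q z = 0"
  have q': "open W" "open V" "q holomorphic_on W" "q ` W \<subseteq> V"
    using q by (auto simp: proper_holomorphic_def)
  obtain d :: nat and f g f' where d: "d > 0" 
    "f holomorphic_on W" "g holomorphic_on V" "f a = 0" "inj_on f W" 
    "\<And>z. z \<in> W \<Longrightarrow> g (q z) = f z ^ d"
    using proper_holomorphic_totally_ramified[OF q W V a fibre] by metis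
  have "(q has_field_derivative 0) (at z)"
    using q0 holomorphic_derivI[OF q'(3,1) z(1)] by simp
  moreover have "(g has_field_derivative deriv g (q z)) (at (q z))"
    using q'(4) z by (intro holomorphic_derivI[OF d(3) q'(2)]) auto
  ultimately have 1: "((\<lambda>z. g (q z)) has_field_derivative deriv g (q z) * 0) (at z)"
    using DERIV_chain2 by blast
  have f: "(f has_field_derivative deriv f z) (at z)"
    using z by (intro holomorphic_derivI[OF d(2) q'(1)]) auto
  then have "((\<lambda>z. f z ^ d) has_field_derivative (of_nat d * (deriv f z * f z ^ (d - 1)))) (at z)"
    using DERIV_power[OF f, of d] by (simp add: mult.assoc)
  then have "((\<lambda>z. g (q z)) has_field_derivative (of_nat d * (deriv f z * f z ^ (d - 1)))) (at z)"
    by (rule has_field_derivative_transform_within_open[OF _ q'(1) z(1)]) (use d in auto)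
  from DERIV_unique[OF 1 this] have "deriv f z = 0 \<or> f z = 0"
    using d(1) by (auto split: if_splits)
  moreover have "deriv f z \<noteq> 0"
    using holomorphic_injective_imp_regular[OF d(2) q'(1) d(5) z(1)] .
  moreover have "f z \<noteq> 0" using d(4,5) z a by (metis inj_onD)
  ultimately show False by blast
qed

text \<open>
  The critical point \<open>a\<close> forces the exponent of the power map to be at least 2, and \<open>z\<^sup>d\<close> takes every
  nonzero value of the disc at \<open>d\<close> distinct points of the disc.
\<close>

lemma totally_ramified_two_preimages:
  assumes q: "proper_holomorphic q W V"
    and W: "simply_connected W" "bounded W" and V: "simply_connected V" "bounded V"
    and a: "a \<in> W" and fibre: "\<And>z. z \<in> W \<Longrightarrow> q z = q a \<Longrightarrow> z = a"
    and crit: "deriv q a = 0" and v: "v \<in> V" "v \<noteq> q a"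
  obtains x y where "x \<in> W" "y \<in> W" "x \<noteq> y" "q x = v" "q y = v"
proof -
  have q': "open W" "open V" "q holomorphic_on W" "q ` W \<subseteq> V"
    using q by (auto simp: proper_holomorphic_def)
  obtain d :: nat and f g f' where d: "d > 0" 
    "f holomorphic_on W" "g holomorphic_on V" "f' holomorphic_on ball 0 1"
    "f ` W \<subseteq> ball 0 1" "f a = 0" "f' ` ball 0 1 \<subseteq> W" "g (q a) = 0" "inj_on f W" "inj_on g V"
    "g ` V \<subseteq> ball 0 1"
    "\<And>z. z \<in> W \<Longrightarrow> f' (f z) = z"  "\<And>z. z \<in> ball 0 1 \<Longrightarrow> f (f' z) = z"
    "\<And>z. z \<in> W \<Longrightarrow> g (q z) = f z ^ d"
  proof -
    show thesis
      by (rule proper_holomorphic_totally_ramified[OF q W V a fibre]) (assumption | rule that)+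
  qed
  have "d \<noteq> 1"
  proof
    assume "d = 1"
    then have "g (q z) = f z" if "z \<in> W" for z using d(14) that by simp
    then have "inj_on q W" by (metis d(9) inj_onD inj_onI)
    then show False 
      using holomorphic_injective_imp_regular[OF q'(3) q'(1) _ a] crit by blast
  qed
  then have d2: "d > 1" using d(1) by linarith
  have gv: "g v \<noteq> 0" using d(8,10) v q'(4) a by (metis image_subset_iff inj_onD)
  have gv1: "norm (g v) < 1" using d(11) v by auto
  have root_ball: "\<zeta> \<in> ball 0 1" if "\<zeta> ^ d = g v" for \<zeta>
  proof (rule ccontr)
    assume "\<zeta> \<notin> ball 0 1"
    then have "norm (\<zeta> ^ d) \<ge> 1" by (simp add: norm_power one_le_power)
    then show False using that gv1 by simp
  qed
  have *: "f' \<zeta> \<in> W \<and> q (f' \<zeta>) = v" if "\<zeta> ^ d = g v" for \<zeta>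
  proof -
    note \<zeta> = root_ball[OF that]
    then have W: "f' \<zeta> \<in> W" using d(7) by auto
    then have "g (q (f' \<zeta>)) = g v" using d(13,14) \<zeta> that by simp
    then show ?thesis using d(10) W q'(4) v by (metis image_subset_iff inj_onD)
  qed
  have "card {\<zeta>. \<zeta> ^ d = g v} = d" using gv d(1) by (rule card_nth_roots)
  then obtain \<zeta> \<xi> where "\<zeta> ^ d = g v" "\<xi> ^ d = g v" "\<zeta> \<noteq> \<xi>"
    using d2 card_le_Suc0_iff_eq[OF card_ge_0_finite, of "{\<zeta>. \<zeta> ^ d = g v}"] by auto
  moreover have "f' \<zeta> \<noteq> f' \<xi>"
    using calculation d(13) root_ball by metis
  ultimately show ?thesis using *[of \<zeta>] *[of \<xi>] that[of "f' \<zeta>" "f' \<xi>"] by blast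
qed

section \<open>Entire maps that expand near infinity\<close>

text \<open>
  A point with \<open>|g z| = r\<close> is a limit of points on either side, because \<open>g\<close> is open. This transfers
  connectedness between the strict and the weak sublevel (superlevel) sets.
\<close>

lemma closure_sublevel_superlevel:
  assumes "g holomorphic_on UNIV" "\<not> g constant_on UNIV" and r: "r > 0"
  shows "{z. norm (g z) \<le> r} \<subseteq> closure {z. norm (g z) < r}"
    and "{z. r \<le> norm (g z)} \<subseteq> closure {z. r < norm (g z)}"
proof -
  have *: "\<exists>y\<in>ball z e. norm (g y) < r" "\<exists>y\<in>ball z e. r < norm (g y)"
    if e: "e > 0" and "norm (g z) = r" "r > 0" for z e r
  proof -
    have "open (g ` ball z e)"
      using assms by (intro open_mapping_thm[of g UNIV]) auto
    then obtain d where d: "d > 0" "ball (g z) d \<subseteq> g ` ball z e"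
      using e by (meson centre_in_ball imageI open_contains_ball)
    have ex: "\<exists>y\<in>ball z e. g y = of_real t * g z" if "\<bar>t - 1\<bar> * r < d" for t
    proof -
      have "norm ((of_real t - 1) * g z) = \<bar>t - 1\<bar> * r" 
        using \<open>norm (g z) = r\<close> by (metis norm_mult norm_of_real of_real_1 of_real_diff)
      then have "of_real t * g z \<in> ball (g z) d"
        using that by (simp add: dist_norm norm_minus_commute algebra_simps)
      then show ?thesis using d(2) by (metis imageE subsetD)
    qed
    define \<delta> where "\<delta> = min (1/2) (d / (2 * r))"
    have \<delta>: "\<delta> > 0" "\<delta> < 1" "\<delta> * r < d"
    proof -
      have "\<delta> * r \<le> d / (2 * r) * r" using \<open>r > 0\<close> by (intro mult_right_mono) (auto simp: \<delta>_def)
      also have "\<dots> < d" using \<open>r > 0\<close> d(1) by simp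
      finally show "\<delta> * r < d" .
    qed (use d \<open>r > 0\<close> in \<open>auto simp: \<delta>_def\<close>)
    obtain y1 y2 where y: "y1 \<in> ball z e" "g y1 = of_real (1 - \<delta>) * g z"
        "y2 \<in> ball z e" "g y2 = of_real (1 + \<delta>) * g z"
      using ex[of "1 - \<delta>"] ex[of "1 + \<delta>"] \<delta> by auto
    have "norm (g y1) = (1 - \<delta>) * r" "norm (g y2) = (1 + \<delta>) * r"
      using \<delta> \<open>norm (g z) = r\<close> unfolding y(2,4) norm_mult norm_of_real by auto
    moreover have "(1 - \<delta>) * r < 1 * r" "1 * r < (1 + \<delta>) * r"
      using \<delta> \<open>r > 0\<close> by (intro mult_strict_right_mono; simp)+
    ultimately show "\<exists>y\<in>ball z e. norm (g y) < r" "\<exists>y\<in>ball z e. r < norm (g y)"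
      using y(1,3) by (intro bexI[of _ y1] bexI[of _ y2]; simp)+
  qed
  have approx: "z \<in> closure A" if close: "\<And>e. e > 0 \<Longrightarrow> \<exists>y\<in>ball z e. y \<in> A" for z :: complex and A
    unfolding closure_approachable
  proof (intro allI impI)
    fix e :: real assume "e > 0"
    then obtain y where "y \<in> ball z e" "y \<in> A" using close by blast
    then show "\<exists>y\<in>A. dist y z < e" by (auto simp: dist_commute)
  qed
  show "{z. norm (g z) \<le> r} \<subseteq> closure {z. norm (g z) < r}"
  proof
    fix z assume "z \<in> {z. norm (g z) \<le> r}"
    then have "norm (g z) < r \<or> norm (g z) = r" by (simp add: le_less)
    have "\<exists>y\<in>ball z e. norm (g y) < r" if "e > 0" for e
    proof (cases "norm (g z) = r")
      case True then show ?thesis using *(1)[OF that _ r] by blast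
    next
      case False then show ?thesis using \<open>norm (g z) < r \<or> norm (g z) = r\<close> that by (intro bexI[of _ z]) auto
    qed
    then show "z \<in> closure {z. norm (g z) < r}" by (intro approx) simp
  qed
  show "{z. r \<le> norm (g z)} \<subseteq> closure {z. r < norm (g z)}"
  proof
    fix z assume "z \<in> {z. r \<le> norm (g z)}"
    then have "r < norm (g z) \<or> norm (g z) = r" by (auto simp: le_less)
    have "\<exists>y\<in>ball z e. r < norm (g y)" if "e > 0" for e
    proof (cases "norm (g z) = r")
      case True then show ?thesis using *(2)[OF that _ r] by blast
    next
      case False then show ?thesis using \<open>r < norm (g z) \<or> norm (g z) = r\<close> that by (intro bexI[of _ z]) auto
    qed
    then show "z \<in> closure {z. r < norm (g z)}" by (intro approx) simp
  qed
qed

text \<open>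
  A bounded component would contradict the maximum modulus principle, and a set with bounded
  complement has only one unbounded component.
\<close>

lemma connected_superlevel:
  assumes g: "g holomorphic_on UNIV" and bdd: "bounded {z. norm (g z) \<le> r}"
  shows "connected {z. r < norm (g z)}"
proof -
  let ?S = "{z. r < norm (g z)}"
  have cont: "continuous_on UNIV g" using g holomorphic_on_imp_continuous_on by blast
  have op: "open ?S" using cont by (intro open_Collect_less continuous_intros) auto
  have compl: "- ?S = {z. norm (g z) \<le> r}" by auto
  have unb: "\<not> bounded C" if C: "C \<in> components ?S" for C
  proof
    assume bC: "bounded C"
    have oC: "open C" using C op open_components by blast
    have fr: "norm (g z) \<le> r" if z: "z \<in> frontier C" for z
    proof -
      have "z \<in> frontier ?S" using frontier_of_components_subset[OF C] z by blast
      then show ?thesis using op by (simp add: frontier_def interior_open)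
    qed
    obtain c where c: "c \<in> C" using C in_components_nonempty by blast
    have "norm (g c) \<le> r"
      by (rule maximum_modulus_frontier[of g C r])
         (use bC fr c in \<open>auto intro: holomorphic_on_subset[OF g] continuous_on_subset[OF cont]\<close>)
    moreover have "c \<in> ?S" using c C in_components_subset by blast
    ultimately show False by simp
  qed
  have "bounded (- ?S)" using bdd compl by simp
  then show ?thesis
    unfolding connected_eq_connected_components_eq
    using unb cobounded_unique_unbounded_components[of ?S] by simp
qed

lemma entire_funpow_holomorphic:
  assumes "f holomorphic_on UNIV"
  shows "(f ^^ n) holomorphic_on A"
proof -
  have "(f ^^ n) holomorphic_on UNIV"
  proof (induction n)
    case 0 then show ?case by (simp add: id_def)
  next
    case (Suc n)
    have "f \<circ> (f ^^ n) holomorphic_on UNIV"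
      by (rule holomorphic_on_compose_gen[OF Suc assms]) auto
    then show ?case by (simp only: funpow.simps(2))
  qed
  then show ?thesis by (rule holomorphic_on_subset) auto
qed

lemma deriv_funpow_prod:
  assumes f: "f holomorphic_on UNIV"
  shows "deriv (f ^^ n) x = (\<Prod>i<n. deriv f ((f ^^ i) x))"
proof (induction n)
  case (Suc n)
  have "deriv (f \<circ> (f ^^ n)) x = deriv f ((f ^^ n) x) * deriv (f ^^ n) x"
    by (rule deriv_chain)
       (auto intro: holomorphic_on_imp_differentiable_at[OF f] holomorphic_on_imp_differentiable_at[OF entire_funpow_holomorphic[OF f, of n UNIV]])
  then show ?case by (simp only: funpow.simps(2) prod.lessThan_Suc Suc mult.commute)
qed simp

text \<open>
  Outside the disc of radius \<open>R\<close> orbits at least double their modulus with each step, so \<open>R\<close> is an escape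
  radius. The normalization \<open>f 0 = 0\<close> provides a point of the filled Julia set at which all
  iterates have the same known value.
\<close>

locale expanding_at_infinity =
  fixes f :: "complex \<Rightarrow> complex" and R :: real
  assumes entire: "f holomorphic_on UNIV" and R_pos: "R > 0"
    and expand: "\<And>z. R \<le> norm z \<Longrightarrow> 2 * norm z \<le> norm (f z)"
    and fix0: "f 0 = 0"
begin

abbreviation sublevel :: "nat \<Rightarrow> complex set" where
  "sublevel n \<equiv> {z. norm ((f ^^ n) z) < R}"

abbreviation closed_sublevel :: "nat \<Rightarrow> complex set" where
  "closed_sublevel n \<equiv> {z. norm ((f ^^ n) z) \<le> R}"

abbreviation exterior :: "nat \<Rightarrow> complex set" where
  "exterior n \<equiv> {z. R < norm ((f ^^ n) z)}"

lemma entire_funpow: "(f ^^ n) holomorphic_on A"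
  by (rule entire_funpow_holomorphic[OF entire])

lemma continuous_funpow: "continuous_on A (f ^^ n)"
  by (rule holomorphic_on_imp_continuous_on[OF entire_funpow])

lemma funpow_fix0: "(f ^^ n) 0 = 0"
  by (induction n) (auto simp: fix0)

lemma expand_funpow: "R \<le> norm z \<Longrightarrow> 2 ^ n * norm z \<le> norm ((f ^^ n) z)"
proof (induction n)
  case (Suc n)
  have "1 * norm z \<le> 2 ^ n * norm z" by (intro mult_right_mono) auto
  then have "R \<le> norm ((f ^^ n) z)" using Suc by linarith
  from expand[OF this] show ?case using Suc by simp
qed simp

lemma expand_funpow_le: "R \<le> norm z \<Longrightarrow> norm z \<le> norm ((f ^^ n) z)"
proof -
  assume z: "R \<le> norm z"
  have "1 * norm z \<le> 2 ^ n * norm z" by (intro mult_right_mono) auto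
  then show ?thesis using expand_funpow[OF z, of n] by linarith
qed

lemma funpow_nonconst: "\<not> (f ^^ n) constant_on UNIV"
proof
  assume "(f ^^ n) constant_on UNIV"
  then have "(f ^^ n) (of_real R) = (f ^^ n) 0" by (auto simp: constant_on_def)
  then show False using expand_funpow_le[of "of_real R" n] R_pos funpow_fix0 by simp
qed

lemma escape_bounded: "norm ((f ^^ n) z) \<le> R \<Longrightarrow> norm z \<le> R"
  using expand_funpow_le[of z n] by linarith

lemma escape_mono: "norm ((f ^^ n) z) < R" if "norm ((f ^^ m) z) \<le> R" "n < m"
proof (rule ccontr)
  assume a: "\<not> norm ((f ^^ n) z) < R"
  define k where "k = m - n"
  have k: "m = k + n" "k > 0" using that by (auto simp: k_def)
  have "2 ^ k * norm ((f ^^ n) z) \<le> norm ((f ^^ m) z)"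
    using expand_funpow[of "(f ^^ n) z" k] a k by (simp add: funpow_add)
  moreover have "(2::real) \<le> 2 ^ k" using k(2) power_increasing[of 1 k "2::real"] by simp
  then have "2 * norm ((f ^^ n) z) \<le> 2 ^ k * norm ((f ^^ n) z)" by (intro mult_right_mono) auto
  ultimately show False using a R_pos that(1) by linarith
qed

lemma filled_julia_eq: "filled_julia f = {z. \<forall>n. norm ((f ^^ n) z) \<le> R}"
proof (intro equalityI subsetI CollectI allI)
  fix z n assume z: "z \<in> filled_julia f"
  show "norm ((f ^^ n) z) \<le> R"
  proof (rule ccontr)
    assume n: "\<not> norm ((f ^^ n) z) \<le> R"
    obtain B where B: "\<And>k. norm ((f ^^ k) z) \<le> B"
      using z by (auto simp: filled_julia_def bounded_iff)
    obtain k where "B / R < 2 ^ k" using real_arch_pow[of 2 "B/R"] by auto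
    then have "B < 2 ^ k * R" using R_pos by (simp add: field_simps)
    also have "\<dots> \<le> 2 ^ k * norm ((f ^^ n) z)" using n by (intro mult_left_mono) auto
    also have "\<dots> \<le> norm ((f ^^ (k + n)) z)"
      using expand_funpow[of "(f ^^ n) z" k] n by (simp add: funpow_add)
    finally show False using B[of "k+n"] by simp
  qed
next
  fix z assume "z \<in> {z. \<forall>n. norm ((f ^^ n) z) \<le> R}"
  then show "z \<in> filled_julia f"
    by (auto simp: filled_julia_def bounded_iff)
qed

lemma filled_julia_Inter: "filled_julia f = (\<Inter>n. closed_sublevel n)"
  unfolding filled_julia_eq by auto

lemma compact_sublevel: "compact (closed_sublevel n)"
proof -
  have "closed_sublevel n \<subseteq> cball 0 R" using escape_bounded by auto
  moreover have "closed (closed_sublevel n)"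
    using continuous_funpow by (intro closed_Collect_le continuous_intros) auto
  ultimately show ?thesis using compact_eq_bounded_closed bounded_subset bounded_cball by metis
qed

lemma bounded_sublevel: "bounded (sublevel n)"
  by (rule bounded_subset[OF compact_imp_bounded[OF compact_sublevel[of n]]]) auto

lemma open_sublevel: "open (sublevel n)"
  using continuous_funpow by (intro open_Collect_less continuous_intros) auto

lemma compact_filled_julia: "compact (filled_julia f)"
proof -
  have "closed (filled_julia f)" unfolding filled_julia_Inter
    using compact_sublevel compact_imp_closed by blast
  moreover have "filled_julia f \<subseteq> closed_sublevel 0"
    unfolding filled_julia_eq by blast
  ultimately show ?thesis using compact_sublevel[of 0]
    by (metis bounded_subset compact_eq_bounded_closed)
qed

lemma filled_julia_sublevel: "filled_julia f \<subseteq> sublevel n"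
proof
  fix z assume "z \<in> filled_julia f"
  then have "norm ((f ^^ Suc n) z) \<le> R" unfolding filled_julia_eq by blast
  then show "z \<in> sublevel n" using escape_mono[of "Suc n" z n] by simp
qed

lemma deriv_funpow_critical: "deriv f z = 0 \<Longrightarrow> n > 0 \<Longrightarrow> deriv (f ^^ n) z = 0"
  unfolding deriv_funpow_prod[OF entire] by (intro prod_zero bexI[of _ 0]) auto

text \<open>
  A relatively clopen part of the filled Julia set \<open>K\<close> that misses the frontier of \<open>K\<close> is open in the
  plane and compact, hence empty.
\<close>

lemma connected_julia_imp_filled:
  assumes "connected (julia f)"
  shows "connected (filled_julia f)"
proof (rule ccontr)
  let ?K = "filled_julia f"
  assume "\<not> connected ?K"
  then obtain A B where AB: "closed A" "closed B" "A \<inter> B \<inter> ?K = {}" "?K \<subseteq> A \<union> B" "A \<inter> ?K \<noteq> {}" "B \<inter> ?K \<noteq> {}"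
    unfolding connected_closed by blast
  have *: False if AB: "closed A" "closed B" "A \<inter> B \<inter> ?K = {}" "?K \<subseteq> A \<union> B" "B \<inter> ?K \<noteq> {}"
    and J: "julia f \<inter> B = {}" for A B
  proof -
    have "?K \<inter> B = interior ?K \<inter> - A"
    proof
      show "?K \<inter> B \<subseteq> interior ?K \<inter> - A"
        using J AB(3) closure_subset[of ?K] by (auto simp: julia_def frontier_def)
      show "interior ?K \<inter> - A \<subseteq> ?K \<inter> B" using AB(4) interior_subset by blast
    qed
    moreover have "open (interior ?K \<inter> - A)" using AB by (intro open_Int) auto
    ultimately have "open (?K \<inter> B)" by simp
    moreover have "compact (?K \<inter> B)" using compact_filled_julia AB by (simp add: compact_Int_closed)
    ultimately show False using AB(5) compact_open by (metis inf_commute)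
  qed
  have "julia f \<subseteq> ?K"
    using compact_imp_closed[OF compact_filled_julia] frontier_subset_closed by (auto simp: julia_def)
  then have "A \<inter> B \<inter> julia f = {}" "julia f \<subseteq> A \<union> B" using AB by auto
  then have "julia f \<inter> A = {} \<or> julia f \<inter> B = {}"
    using assms AB(1,2) unfolding connected_closed by blast
  then show False using *[of A B] *[of B A] AB by blast
qed

text \<open>
  Every component contains a zero of \<open>f\<^sup>n\<close>, by the maximum principle for \<open>1/f\<^sup>n\<close>; such a zero lies in the
  filled Julia set, which is contained in one component.
\<close>

lemma connected_sublevel:
  assumes K: "connected (filled_julia f)"
  shows "connected (sublevel n)"
proof -
  let ?U = "sublevel n"
  have meet: "C \<inter> filled_julia f \<noteq> {}" if C: "C \<in> components ?U" for C
  proof (rule ccontr)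
    assume e: "\<not> C \<inter> filled_julia f \<noteq> {}"
    have nz: "(f ^^ n) z \<noteq> 0" if "z \<in> C" for z
    proof
      assume z0: "(f ^^ n) z = 0"
      have "norm ((f ^^ m) z) \<le> R" for m
      proof (cases "m < n")
        case True then show ?thesis using escape_mono[of n z m] z0 R_pos by simp
      next
        case False
        then have "(f ^^ m) z = (f ^^ (m - n)) ((f ^^ n) z)" using funpow_add[of "m - n" n f] by simp
        then show ?thesis using z0 funpow_fix0 R_pos by simp
      qed
      then show False using that e by (auto simp: filled_julia_eq)
    qed
    have oC: "open C" by (rule open_components[OF open_sublevel C])
    have CU: "C \<subseteq> ?U" using C in_components_subset by blast
    have fr: "norm ((f ^^ n) z) = R" if z: "z \<in> frontier C" for z
    proof -
      have "z \<in> frontier ?U" using frontier_of_components_subset[OF C] z by blast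
      then have "z \<notin> ?U" using interior_open[OF open_sublevel[of n]] unfolding frontier_def by blast
      moreover have "z \<in> closed_sublevel n"
      proof -
        have "closure C \<subseteq> closed_sublevel n"
          using CU by (intro closure_minimal compact_imp_closed[OF compact_sublevel]) auto
        then show ?thesis using z by (auto simp: frontier_def)
      qed
      ultimately show ?thesis by simp
    qed
    obtain c where c: "c \<in> C" using C in_components_nonempty by blast
    have nzc: "(f ^^ n) z \<noteq> 0" if "z \<in> closure C" for z
      using nz fr[of z] that R_pos oC by (cases "z \<in> C") (auto simp: frontier_def interior_open)
    have "norm (inverse ((f ^^ n) c)) \<le> inverse R"
    proof (rule maximum_modulus_frontier[of "\<lambda>z. inverse ((f ^^ n) z)" C])
      show "(\<lambda>z. inverse ((f ^^ n) z)) holomorphic_on interior C"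
        using nz interior_subset by (intro holomorphic_intros entire_funpow) auto
      show "continuous_on (closure C) (\<lambda>z. inverse ((f ^^ n) z))"
        using nzc by (intro continuous_intros continuous_funpow) auto
      show "bounded C" using CU bounded_sublevel bounded_subset by blast
    qed (use fr c in \<open>auto simp: norm_inverse\<close>)
    then have "R \<le> norm ((f ^^ n) c)"
      using R_pos nz[OF c] by (simp add: norm_inverse)
    then show False using c CU by auto
  qed
  have "0 \<in> ?U" using funpow_fix0 R_pos by simp
  then obtain D where D: "D \<in> components ?U" "filled_julia f \<subseteq> D"
    using exists_component_superset[OF filled_julia_sublevel[of n] _ K] by blast
  have "C = D" if C: "C \<in> components ?U" for C
    using meet[OF C] C D components_nonoverlap[OF C D(1)] by blast
  then show ?thesis
    unfolding connected_eq_connected_components_eq by blast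
qed

end

section \<open>Critical orbits and connectedness of the Julia set\<close>

lemma norm_inverse_iff:
  fixes z :: complex
  assumes "z \<noteq> 0"
  shows "r < norm (inverse z) \<longleftrightarrow> r * norm z < 1" "r \<le> norm (inverse z) \<longleftrightarrow> r * norm z \<le> 1"
  unfolding norm_inverse using assms by (simp_all add: field_simps)

context expanding_at_infinity
begin

lemma bounded_level: "bounded {z. norm ((f ^^ n) z) \<le> r}"
proof -
  have "{z. norm ((f ^^ n) z) \<le> r} \<subseteq> cball 0 (max R r)"
  proof
    fix z assume "z \<in> {z. norm ((f ^^ n) z) \<le> r}"
    then show "z \<in> cball 0 (max R r)"
      using expand_funpow_le[of z n] by (cases "R \<le> norm z") auto
  qed
  then show ?thesis by (rule bounded_subset[OF bounded_cball])
qed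

lemma connected_exterior: "connected (exterior n)"
  by (rule connected_superlevel[OF entire_funpow bounded_level])

lemma connected_closed_exterior: "connected {z. R \<le> norm ((f ^^ n) z)}"
  by (rule connected_intermediate_closure[OF connected_exterior[of n]])
     (use closure_sublevel_superlevel(2)[OF entire_funpow funpow_nonconst R_pos] in auto)

text \<open>
  In the coordinate \<open>1/z\<close> the exterior of the sublevel set \<open>{|f\<^sup>n| \<le> R}\<close> is a bounded simply connected domain
  \<open>W\<close>, and \<open>q(z) = 1/f\<^sup>n(1/z)\<close> maps it properly to the disc \<open>V\<close> of radius \<open>1/R\<close>, totally ramified over 0. The
  convention \<open>inverse 0 = 0\<close> gives \<open>q\<close> the right value at the point that represents infinity.
\<close>

lemma no_critical_point_outside:
  assumes K: "connected (filled_julia f)" and w: "R < norm ((f ^^ n) w)"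
  shows "deriv (f ^^ n) w \<noteq> 0"
proof
  let ?F = "f ^^ n"
  assume d0: "deriv ?F w = 0"
  define q where "q = (\<lambda>z. inverse (?F (inverse z)))"
  define W where "W = insert 0 (inverse ` {z. R < norm (?F z)})"
  define V where "V = ball (0::complex) (inverse R)"
  have F0: "?F 0 = 0" by (rule funpow_fix0)
  have W_iff: "z \<in> W \<longleftrightarrow> z = 0 \<or> R < norm (?F (inverse z))" for z
    unfolding W_def by (auto simp: image_iff intro!: exI[of _ "inverse z"])
  have holF: "?F holomorphic_on A" for A by (rule entire_funpow)
  have inv: "continuous_on (-{0}) (\<lambda>z. ?F (inverse z))"
    by (rule continuous_on_compose2[OF continuous_funpow[of UNIV n]]) (auto intro: continuous_intros)
  have ball_W: "V \<subseteq> W"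
  proof
    fix z assume z: "z \<in> V"
    show "z \<in> W"
    proof (cases "z = 0")
      case False
      then have "R < norm (inverse z)" using z R_pos
        unfolding norm_inverse_iff(1)[OF False] by (simp add: V_def field_simps)
      then show ?thesis using expand_funpow_le[of "inverse z" n] by (simp add: W_iff)
    qed (simp add: W_iff)
  qed
  have opW: "open W"
  proof -
    have "open ((-{0}) \<inter> (\<lambda>z. ?F (inverse z)) -` {z. R < norm z})"
      by (rule continuous_open_preimage[OF inv]) (auto intro!: open_Collect_less continuous_intros)
    moreover have "W = V \<union> ((-{0}) \<inter> (\<lambda>z. ?F (inverse z)) -` {z. R < norm z})"
      using ball_W by (auto simp: W_iff V_def R_pos)
    moreover have "open V" by (simp add: V_def)
    ultimately show ?thesis by (simp add: open_Un)
  qed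
  have bW: "bounded W"
  proof -
    have "open (?F -` ball 0 R)"
      using continuous_open_preimage[OF continuous_funpow[of UNIV n]] by simp
    moreover have "0 \<in> ?F -` ball 0 R" using R_pos F0 by simp
    ultimately obtain e where e: "e > 0" "ball 0 e \<subseteq> ?F -` ball 0 R"
      using open_contains_ball by blast
    have "W \<subseteq> cball 0 (inverse e)"
    proof
      fix z assume z: "z \<in> W"
      show "z \<in> cball 0 (inverse e)"
      proof (cases "z = 0")
        case False
        have "inverse z \<notin> ball 0 e" using e(2) z False by (auto simp: W_iff)
        then have "e \<le> norm (inverse z)" by simp
        then show ?thesis using e(1) unfolding norm_inverse_iff(2)[OF False] by (simp add: field_simps)
      qed (use e in simp)
    qed
    then show ?thesis by (rule bounded_subset[OF bounded_cball])
  qed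
  have conn1: "connected W"
  proof (rule connected_intermediate_closure)
    show "connected (inverse ` {z. R < norm (?F z)})"
      using F0 R_pos by (intro connected_continuous_image connected_exterior continuous_intros) auto
    have "inverse ` {z. R < norm (?F z)} = W - {0}"
      using F0 R_pos unfolding W_def by auto
    then show "W \<subseteq> closure (inverse ` {z. R < norm (?F z)})"
      using closure_open_Int_superset[of W "- {0}"] opW closure_subset[of W]
      by (simp add: Diff_eq closure_complement interior_singleton)
  qed (auto simp: W_def)
  have conn2: "connected (- W)"
  proof -
    have c0: "connected ({z. norm (?F z) < R} - {0})"
      by (intro connected_open_delete open_sublevel connected_sublevel[OF K]) auto
    have "connected ({z. norm (?F z) \<le> R} - {0})"
    proof (rule connected_intermediate_closure[OF c0])
      have "closure ({z. norm (?F z) < R} \<inter> - {0}) = closure {z. norm (?F z) < R}"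
        using closure_open_Int_superset[OF open_sublevel, of n "-{0}"]
        by (simp add: closure_complement interior_singleton)
      then show "{z. norm (?F z) \<le> R} - {0} \<subseteq> closure ({z. norm (?F z) < R} - {0})"
        using closure_sublevel_superlevel(1)[OF entire_funpow[of n] funpow_nonconst R_pos]
        by (auto simp: Diff_eq)
    qed auto
    then have "connected (inverse ` ({z. norm (?F z) \<le> R} - {0}))"
      by (intro connected_continuous_image continuous_intros) auto
    moreover have "inverse ` ({z. norm (?F z) \<le> R} - {0}) = - W"
    proof safe
      fix z assume "z \<notin> W"
      then show "z \<in> inverse ` ({z. norm (?F z) \<le> R} - {0})"
        by (intro image_eqI[of _ _ "inverse z"]) (auto simp: W_iff)
    qed (auto simp: W_iff)
    ultimately show ?thesis by simp
  qed
  have scW: "simply_connected W"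
    using simply_connected_iff_simple[OF opW bW] conn1 conn2 by simp
  have q_le: "norm (q z) \<le> norm z" if "z \<in> V" for z
  proof (cases "z = 0")
    case False
    then have "R < norm (inverse z)" using that R_pos
      unfolding norm_inverse_iff(1)[OF False] by (simp add: V_def field_simps)
    then have *: "norm (inverse z) \<le> norm (?F (inverse z))" using expand_funpow_le[of "inverse z" n] by simp
    have "inverse (norm (?F (inverse z))) \<le> inverse (norm (inverse z))"
      by (rule le_imp_inverse_le[OF *]) (use False in simp)
    then show ?thesis by (simp add: q_def norm_inverse)
  qed (simp add: q_def F0)
  have F_nz: "?F (inverse z) \<noteq> 0" if "z \<in> W" "z \<noteq> 0" for z
    using that R_pos by (auto simp: W_iff)
  have holq: "q holomorphic_on W"
  proof (rule no_isolated_singularity'[of "{0}"])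
    have "(\<lambda>z. ?F (inverse z)) holomorphic_on W - {0}"
      by (rule holomorphic_on_compose_gen[of inverse "W - {0}" ?F UNIV, unfolded o_def])
         (auto intro: holomorphic_intros holF)
    then show "q holomorphic_on W - {0}"
      unfolding q_def using F_nz by (intro holomorphic_intros) auto
    fix z :: complex assume "z \<in> {0}"
    then have [simp]: "z = 0" by simp
    have "\<forall>\<^sub>F z in at 0 within W. z \<in> V"
      using R_pos by (auto simp: V_def eventually_at intro!: exI[of _ "inverse R"])
    then have "eventually (\<lambda>z. norm (q z) \<le> norm z) (at 0 within W)"
      by eventually_elim (rule q_le)
    moreover have "((\<lambda>z. norm z) \<longlongrightarrow> 0) (at (0::complex) within W)"
      by (intro tendsto_norm_zero tendsto_ident_at)
    ultimately have "(q \<longlongrightarrow> 0) (at 0 within W)"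
      by (rule Lim_null_comparison)
    then show "(q \<longlongrightarrow> q z) (at z within W)" by (simp add: q_def F0)
  qed (use opW in auto)
  have properq: "proper_holomorphic q W V"
    unfolding proper_holomorphic_def
  proof (intro conjI allI impI)
    show "open W" by (fact opW)
    show "q holomorphic_on W" by (fact holq)
    show "open V" by (simp add: V_def)
    show "q ` W \<subseteq> V"
    proof (intro subsetI, elim imageE)
      fix v z assume z: "z \<in> W" "v = q z"
      show "v \<in> V"
      proof (cases "z = 0")
        case False
        then show ?thesis using z R_pos by (auto simp: V_def q_def W_iff norm_inverse intro!: less_imp_inverse_less)
      qed (use z R_pos in \<open>simp add: V_def q_def F0\<close>)
    qed
    fix C :: "complex set" assume C: "compact C \<and> C \<subseteq> V"
    obtain s where s: "s > 0" "s < inverse R" "C \<subseteq> cball 0 s"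
    proof (cases "C = {}")
      case True then show ?thesis using that[of "inverse R / 2"] R_pos by simp
    next
      case False
      then obtain x where x: "x \<in> C" "\<forall>y\<in>C. norm y \<le> norm x"
        using continuous_attains_sup[of C norm] C by (metis continuous_on_norm_id)
      show ?thesis
        by (rule that[of "(norm x + inverse R) / 2"])
           (use x C R_pos in \<open>fastforce simp: V_def add_nonneg_pos intro!: divide_pos_pos\<close>)+
    qed
    define E where "E = - ((-{0}) \<inter> (\<lambda>z. ?F (inverse z)) -` {z. norm z < inverse s})"
    have E_iff: "z \<in> E \<longleftrightarrow> z = 0 \<or> inverse s \<le> norm (?F (inverse z))" for z
      by (auto simp: E_def)
    have "open ((-{0}) \<inter> (\<lambda>z. ?F (inverse z)) -` {z. norm z < inverse s})"
      by (rule continuous_open_preimage[OF inv]) (auto intro!: open_Collect_less continuous_intros)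
    then have "closed E" unfolding E_def by (rule closed_Compl)
    have "R < inverse s" using s by (metis inverse_inverse_eq less_imp_inverse_less)
    then have EW: "E \<subseteq> W" by (auto simp: E_iff W_iff)
    have "W \<inter> q -` C = E \<inter> q -` C"
    proof
      show "E \<inter> q -` C \<subseteq> W \<inter> q -` C" using EW by auto
      show "W \<inter> q -` C \<subseteq> E \<inter> q -` C"
      proof
        fix z assume z: "z \<in> W \<inter> q -` C"
        show "z \<in> E \<inter> q -` C"
        proof (cases "z = 0")
          case False
          have "norm (q z) \<le> s" using z s by auto
          moreover have "?F (inverse z) \<noteq> 0" using F_nz z False by auto
          ultimately have "inverse s \<le> norm (?F (inverse z))"
            using s(1) unfolding q_def norm_inverse by (simp add: field_simps)
          then show ?thesis using z by (auto simp: E_iff)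
        qed (use z in \<open>auto simp: E_iff\<close>)
      qed
    qed
    moreover have "closed (E \<inter> q -` C)"
      by (intro continuous_closed_preimage holomorphic_on_imp_continuous_on
          holomorphic_on_subset[OF holq EW] \<open>closed E\<close> compact_imp_closed) (use C in auto)
    moreover have "bounded (W \<inter> q -` C)" using bW by (rule bounded_subset) auto
    ultimately show "compact (W \<inter> q -` C)" by (simp add: compact_eq_bounded_closed)
  qed
  have wnz: "w \<noteq> 0" using w R_pos F0 by auto
  have iw: "inverse w \<in> W" "inverse w \<noteq> 0" using w wnz by (auto simp: W_iff)
  have "deriv q (inverse w) \<noteq> 0"
  proof (rule totally_ramified_no_other_critical[OF properq scW bW _ _ _ _ iw])
    show "simply_connected V" "bounded V" by (auto simp: V_def convex_imp_simply_connected)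
    show "0 \<in> W" by (simp add: W_iff)
    show "z = 0" if "z \<in> W" "q z = q 0" for z
      using that F_nz[of z] by (auto simp: q_def F0)
  qed
  moreover have "(q has_field_derivative 0) (at (inverse w))"
  proof -
    have "(?F has_field_derivative 0) (at w)"
      using d0 holomorphic_derivI[OF holF[of UNIV], of w] by simp
    then have "(?F has_field_derivative 0) (at (inverse (inverse w)))" by simp
    from DERIV_chain2[OF this DERIV_inverse[OF iw(2)]]
    have "((\<lambda>z. ?F (inverse z)) has_field_derivative 0) (at (inverse w))" by simp
    from DERIV_inverse_fun[OF this] F_nz[OF iw] show ?thesis by (simp add: q_def)
  qed
  ultimately show False using DERIV_imp_deriv by blast
qed

text \<open>
  The step from \<open>n\<close> to \<open>n + 1\<close> secures a positive exponent, for which a critical point of \<open>f\<close> is also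
  one of the iterate.
\<close>

lemma connected_julia_imp_critical_bounded:
  assumes J: "connected (julia f)" and w: "deriv f w = 0"
  shows "w \<in> filled_julia f"
proof (rule ccontr)
  assume "w \<notin> filled_julia f"
  then obtain n where n: "R < norm ((f ^^ n) w)" by (auto simp: filled_julia_eq not_le)
  have "R < norm ((f ^^ Suc n) w)"
  proof (rule ccontr)
    assume "\<not> R < norm ((f ^^ Suc n) w)"
    then show False using escape_mono[of "Suc n" w n] n by simp
  qed
  from no_critical_point_outside[OF connected_julia_imp_filled[OF J] this]
  show False using deriv_funpow_critical[OF w, of "Suc n"] by blast
qed

end

lemma proper_holomorphic_component:
  assumes f: "proper_holomorphic f U V" and C: "C \<in> components U"
  shows "proper_holomorphic f C V"
  unfolding proper_holomorphic_def
proof (intro conjI allI impI)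
  have U: "open U" "open V" "f holomorphic_on U" "f ` U \<subseteq> V"
    using f by (auto simp: proper_holomorphic_def)
  have CU: "C \<subseteq> U" using C in_components_subset by blast
  show "open C" "open V" using open_components[OF U(1) C] U by auto
  show "f holomorphic_on C" "f ` C \<subseteq> V" using U CU holomorphic_on_subset by blast+
  fix K assume K: "compact K \<and> K \<subseteq> V"
  then have cK: "compact (U \<inter> f -` K)" using f by (auto simp: proper_holomorphic_def)
  have "U - C = \<Union>(components U - {C})"
  proof (intro equalityI subsetI)
    fix x assume x: "x \<in> U - C"
    then obtain C' where "C' \<in> components U" "x \<in> C'" by (metis DiffD1 Union_components UnionE)
    then show "x \<in> \<Union>(components U - {C})" using x by blast
  next
    fix x assume "x \<in> \<Union>(components U - {C})"
    then obtain C' where C': "C' \<in> components U" "C' \<noteq> C" "x \<in> C'" by blast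
    then show "x \<in> U - C"
      using components_nonoverlap[OF C C'(1)] in_components_subset[OF C'(1)] by blast
  qed
  moreover have "open (\<Union>(components U - {C}))"
    using open_components[OF U(1)] by blast
  ultimately have "open (U - C)" by simp
  then have "compact ((U \<inter> f -` K) - (U - C))" using cK by (rule compact_diff[rotated])
  moreover have "(U \<inter> f -` K) - (U - C) = C \<inter> f -` K" using CU by auto
  ultimately show "compact (C \<inter> f -` K)" by simp
qed

text \<open>
  The image is open by the open mapping theorem and relatively closed by properness.
\<close>

lemma proper_holomorphic_surj:
  assumes f: "proper_holomorphic f W V" and W: "connected W" "W \<noteq> {}" and V: "connected V"
    and nc: "\<not> f constant_on W"
  shows "f ` W = V"
proof -
  have U: "open W" "open V" "f holomorphic_on W" "f ` W \<subseteq> V"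
    using f by (auto simp: proper_holomorphic_def)
  have op: "open (f ` W)"
    using open_mapping_thm[OF U(3) U(1) W(1) U(1) _ nc] by simp
  have "closedin (top_of_set V) (f ` W)"
    unfolding closedin_limpt
  proof (intro conjI allI impI U(4))
    fix x assume x: "x islimpt f ` W \<and> x \<in> V"
    obtain e where e: "e > 0" "cball x e \<subseteq> V" using U(2) x open_contains_cball by blast
    have "compact (W \<inter> f -` cball x e)" using f e(2) by (auto simp: proper_holomorphic_def)
    then have "compact (f ` (W \<inter> f -` cball x e))"
      by (intro compact_continuous_image holomorphic_on_imp_continuous_on holomorphic_on_subset[OF U(3)]) auto
    moreover have "f ` (W \<inter> f -` cball x e) = f ` W \<inter> cball x e" by auto
    ultimately have cl: "closed (f ` W \<inter> cball x e)" by (simp add: compact_imp_closed)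
    have "x islimpt (f ` W \<inter> ball x e)"
      unfolding islimpt_def
    proof (intro allI impI)
      fix T assume "x \<in> T" "open T"
      then have "x \<in> T \<inter> ball x e" "open (T \<inter> ball x e)" using e(1) by auto
      then obtain y where "y \<in> f ` W" "y \<in> T \<inter> ball x e" "y \<noteq> x"
        using x unfolding islimpt_def by blast
      then show "\<exists>y\<in>f ` W \<inter> ball x e. y \<in> T \<and> y \<noteq> x" by blast
    qed
    then have "x islimpt (f ` W \<inter> cball x e)" by (rule islimpt_subset) auto
    then show "x \<in> f ` W" using cl closed_limpt by blast
  qed
  moreover have "openin (top_of_set V) (f ` W)" by (rule open_subset[OF U(4) op])
  ultimately show ?thesis using V W(2) unfolding connected_clopen by blast
qed


context expanding_at_infinity
begin

lemma proper_sublevel: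
  "proper_holomorphic f (sublevel (Suc n)) (sublevel n)"
  unfolding proper_holomorphic_def
proof (intro conjI allI impI open_sublevel)
  have eq: "(f ^^ Suc n) z = (f ^^ n) (f z)" for z by (simp add: funpow_swap1)
  show "f holomorphic_on sublevel (Suc n)"
    using entire by (rule holomorphic_on_subset) auto
  show "f ` (sublevel (Suc n)) \<subseteq> sublevel n"
    unfolding eq by auto
  fix K assume K: "compact K \<and> K \<subseteq> sublevel n"
  have "closed (f -` K)"
    using continuous_closed_vimage[of K f] K compact_imp_closed
      holomorphic_on_imp_continuous_on[OF entire] by (auto simp: continuous_on_eq_continuous_at)
  moreover have "sublevel (Suc n) \<inter> f -` K = f -` K"
    using K unfolding eq by auto
  moreover have "f -` K \<subseteq> closed_sublevel (Suc n)"
    using K unfolding eq by (auto intro: less_imp_le)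
  ultimately show "compact (sublevel (Suc n) \<inter> f -` K)"
    using compact_sublevel[of "Suc n"] by (metis bounded_subset compact_eq_bounded_closed)
qed

text \<open>
  The points \<open>a'\<close> and \<open>b'\<close> are the remaining preimages of the two critical values; for a cubic there is
  one of each. Let \<open>W\<close> be the component of the preimage that contains \<open>a\<close>. Every component maps onto the
  previous sublevel set and so contains \<open>a\<close> or \<open>a'\<close>; if there is more than one, then \<open>a' \<notin> W\<close> and \<open>a\<close> is
  totally ramified in \<open>W\<close>. Then \<open>W\<close> does not contain the critical point \<open>b\<close>, but it contains two preimages of
  \<open>f b\<close>, whereas only \<open>b'\<close> is left.
\<close>

lemma critical_bounded_imp_connected_sublevel:
  assumes K: "a \<in> filled_julia f" "b \<in> filled_julia f"
    and crit: "deriv f a = 0" "deriv f b = 0"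
    and fibre_a: "\<And>z. f z = f a \<Longrightarrow> z = a \<or> z = a'" "f a' = f a"
    and fibre_b: "\<And>z. f z = f b \<Longrightarrow> z = b \<or> z = b'"
    and coincide: "a = b \<Longrightarrow> a' = a" and distinct: "a \<noteq> b \<Longrightarrow> f a \<noteq> f b"
  shows "connected (sublevel n)"
proof (induction n)
  case 0
  have "sublevel 0 = ball 0 R" by auto
  then show ?case by simp
next
  case (Suc n)
  let ?U = "sublevel (Suc n)" and ?V = "sublevel n"
  have simp_conn: "simply_connected ?V"
  proof -
    have "- ?V = {z. R \<le> norm ((f ^^ n) z)}" by auto
    then show ?thesis
      using simply_connected_iff_simple[OF open_sublevel bounded_sublevel] Suc connected_closed_exterior by simp
  qed
  have aU: "a \<in> ?U" and bU: "b \<in> ?U" using K filled_julia_sublevel by blast+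
  define W where "W = connected_component_set ?U a"
  have W: "W \<in> components ?U" "a \<in> W"
    using aU by (auto simp: W_def componentsI)
  have opW: "open W" using open_components[OF open_sublevel W(1)] .
  have bW: "bounded W"
    using bounded_subset[OF bounded_sublevel in_components_subset[OF W(1)]] .
  have W_sc: "simply_connected W"
  proof -
    have "- ?U = {z. R \<le> norm ((f ^^ Suc n) z)}" by auto
    then have "connected (- ?U)" using connected_closed_exterior[of "Suc n"] by simp
    then have "connected (- W)"
      by (rule component_complement_connected) (use W(1) in simp)
    moreover have "connected W" using W(1) in_components_connected by blast
    ultimately show ?thesis using simply_connected_iff_simple[OF opW bW] by simp
  qed
  have surj: "f ` C = ?V" if C: "C \<in> components ?U" for C
  proof (rule proper_holomorphic_surj[OF proper_holomorphic_component[OF proper_sublevel C]])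
    show "\<not> f constant_on C"
    proof
      assume "f constant_on C"
      then obtain c where c: "\<And>z. z \<in> C \<Longrightarrow> f z = c" by (auto simp: constant_on_def)
      have oC: "open C" using open_components[OF open_sublevel C] .
      obtain z0 where z0: "z0 \<in> C" using in_components_nonempty[OF C] by blast
      have "f z = c" for z
      proof (rule analytic_continuation_open[of C UNIV f "\<lambda>_. c" z])
        show "f holomorphic_on UNIV" by (rule entire)
      qed (use oC z0 c in auto)
      then show False using funpow_nonconst[of 1] by (auto simp: constant_on_def)
    qed
  qed (use C Suc in_components_connected in_components_nonempty in auto)
  have "C = W" if C: "C \<in> components ?U" for C
  proof (cases "a' \<in> W")
    case True
    have "f a \<in> f ` C" using surj[OF C] surj[OF W(1)] W(2) by blast
    then obtain z where "z \<in> C" "f z = f a" by (metis imageE)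
    then have "C \<inter> W \<noteq> {}" using fibre_a(1)[of z] True W(2) by blast
    then show ?thesis using components_nonoverlap[OF C W(1)] by blast
  next
    case False
    have ab: "a \<noteq> b" using coincide False W(2) by auto
    have fib: "z = a" if "z \<in> W" "f z = f a" for z using fibre_a(1)[OF that(2)] that(1) False by auto
    note pW = proper_holomorphic_component[OF proper_sublevel W(1)]
    have "b \<notin> W"
      using totally_ramified_no_other_critical[OF pW W_sc bW simp_conn bounded_sublevel W(2) fib] ab crit(2)
      by blast
    have "f b \<in> ?V" using K(2) filled_julia_sublevel[of "Suc n"] by (auto simp: funpow_swap1)
    then obtain x y where xy: "x \<in> W" "y \<in> W" "x \<noteq> y" "f x = f b" "f y = f b"
      using totally_ramified_two_preimages[OF pW W_sc bW simp_conn bounded_sublevel W(2) fib crit(1)] distinct[OF ab]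
      by metis
    then show ?thesis using fibre_b[OF xy(4)] fibre_b[OF xy(5)] \<open>b \<notin> W\<close> by metis
  qed
  then show ?case unfolding connected_eq_connected_components_eq by blast
qed

lemma connected_julia_if_connected_sublevels:
  assumes "\<And>n. connected (sublevel n)"
  shows "connected (julia f)"
proof -
  have "connected (filled_julia f)"
    unfolding filled_julia_Inter
  proof (rule connected_nest[OF compact_sublevel])
    show "connected (closed_sublevel n)" for n
      by (rule connected_intermediate_closure[OF assms[of n]])
         (use closure_sublevel_superlevel(1)[OF entire_funpow funpow_nonconst R_pos] in auto)
    show "closed_sublevel n \<subseteq> closed_sublevel m" if "m \<le> n" for m n
      using escape_mono[of n _ m] that by (cases "m = n") (auto intro: less_imp_le)
  qed
  moreover have "connected (- filled_julia f)"
  proof -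
    have eq: "- filled_julia f = (\<Union>n. exterior n)"
      unfolding filled_julia_Inter by auto
    have "complex_of_real (2 * R) \<in> exterior n" for n
      using expand_funpow_le[of "complex_of_real (2 * R)" n] R_pos by simp
    then have "(\<Inter>n. exterior n) \<noteq> {}" by blast
    then show ?thesis unfolding eq
      by (intro connected_Union) (auto intro: connected_exterior)
  qed
  ultimately show ?thesis unfolding julia_def by (rule connected_frontier_simple)
qed

end

section \<open>Attracting cycles attract critical points\<close>

text \<open>
  Local inverses exist at the finitely many points of a fibre. By properness, the points of \<open>C\<close> outside
  the corresponding small discs have images that stay away from the centre \<open>x\<close>, so over a small disc around
  \<open>x\<close> nothing else occurs.
\<close>

lemma proper_regular_covering:
  assumes f: "proper_holomorphic f C T" and T: "connected T" "C \<noteq> {}"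
    and reg: "\<And>z. z \<in> C \<Longrightarrow> deriv f z \<noteq> 0"
  shows "covering_space C f T"
proof
  have U: "open C" "open T" "f holomorphic_on C" "f ` C \<subseteq> T"
    and cpt: "\<And>K. compact K \<Longrightarrow> K \<subseteq> T \<Longrightarrow> compact (C \<inter> f -` K)"
    using f by (auto simp: proper_holomorphic_def)
  show cont: "continuous_on C f" using U(3) holomorphic_on_imp_continuous_on by blast
  show "f ` C = T"
  proof -
    obtain c where c: "c \<in> C" using T(2) by blast
    let ?W = "connected_component_set C c"
    have W: "?W \<in> components C" using c by (simp add: componentsI)
    have cW: "c \<in> ?W" using c by simp
    have WC: "?W \<subseteq> C" by (rule connected_component_subset)
    have "\<not> f constant_on ?W"
    proof
      assume "f constant_on ?W"
      then obtain v where v: "\<And>z. z \<in> ?W \<Longrightarrow> f z = v" by (auto simp: constant_on_def)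
      have "((\<lambda>_. v) has_field_derivative 0) (at c)" by simp
      then have "(f has_field_derivative 0) (at c)"
        by (rule has_field_derivative_transform_within_open[OF _ open_components[OF U(1) W] cW])
           (simp add: v)
      then show False using reg[OF c] DERIV_imp_deriv by blast
    qed
    then have "f ` ?W = T"
      using cW by (intro proper_holomorphic_surj[OF proper_holomorphic_component[OF f W] _ _ T(1)])
        (blast intro: connected_connected_component)+
    then show ?thesis using U(4) WC by blast
  qed
  fix x assume x: "x \<in> T"
  define F where "F = C \<inter> f -` {x}"
  have "compact F" unfolding F_def using x by (intro cpt) auto
  have inj: "\<exists>r>0. ball y r \<subseteq> C \<and> inj_on f (ball y r)" if "y \<in> C" for y
    using has_complex_derivative_locally_injective[OF U(3) that U(1) reg[OF that]] by metis
  have "finite F"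
  proof (rule finite_not_islimpt_in_compact[OF \<open>compact F\<close>, of F, simplified])
    fix y assume y: "y \<in> F"
    then obtain r where r: "r > 0" "inj_on f (ball y r)" using inj[of y] by (auto simp: F_def)
    show "\<not> y islimpt F"
    proof
      assume "y islimpt F"
      then obtain z where z: "z \<in> F" "z \<in> ball y r" "z \<noteq> y" 
        unfolding islimpt_def using r(1) open_ball centre_in_ball by metis
      then have "f z = f y" using y by (auto simp: F_def)
      then show False using r z by (metis centre_in_ball inj_onD)
    qed
  qed
  have "\<exists>r>0. \<forall>y\<in>F. ball y r \<subseteq> C \<and> inj_on f (ball y r)"
  proof -
    have "\<forall>y\<in>F. \<exists>r>0. ball y r \<subseteq> C \<and> inj_on f (ball y r)"
      using inj by (auto simp: F_def)
    then obtain r where r: "\<And>y. y \<in> F \<Longrightarrow> r y > 0 \<and> ball y (r y) \<subseteq> C \<and> inj_on f (ball y (r y))"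
      by metis
    define r0 where "r0 = Min (insert 1 (r ` F))"
    have "r0 > 0" using r \<open>finite F\<close> by (auto simp: r0_def)
    moreover have "ball y r0 \<subseteq> ball y (r y)" if "y \<in> F" for y
      using that \<open>finite F\<close> by (intro subset_ball) (auto simp: r0_def)
    ultimately show ?thesis using r by (metis inj_on_subset subset_trans)
  qed
  then obtain r1 where r1: "r1 > 0" "\<And>y. y \<in> F \<Longrightarrow> ball y r1 \<subseteq> C \<and> inj_on f (ball y r1)" by blast
  obtain d where d: "d > 0" "\<And>y z. y \<in> F \<Longrightarrow> z \<in> F \<Longrightarrow> y \<noteq> z \<Longrightarrow> d \<le> dist y z"
  proof -
    have "\<exists>d>0. \<forall>z\<in>F. z \<noteq> y \<longrightarrow> d \<le> dist y z" for y
      using finite_set_avoid[OF \<open>finite F\<close>, of y] by blast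
    then obtain d where d: "\<And>y. d y > 0" "\<And>y z. z \<in> F \<Longrightarrow> z \<noteq> y \<Longrightarrow> d y \<le> dist y z" by metis
    show ?thesis
    proof (rule that[of "Min (insert 1 (d ` F))"])
      show "Min (insert 1 (d ` F)) > 0" using d(1) \<open>finite F\<close> by simp
      fix y z assume yz: "y \<in> F" "z \<in> F" "y \<noteq> z"
      have "Min (insert 1 (d ` F)) \<le> d y" using yz \<open>finite F\<close> by simp
      also have "\<dots> \<le> dist y z" using d(2) yz by metis
      finally show "Min (insert 1 (d ` F)) \<le> dist y z" .
    qed
  qed
  define r where "r = min r1 (d / 2)"
  have r: "r > 0" "\<And>y. y \<in> F \<Longrightarrow> ball y r \<subseteq> C" "\<And>y. y \<in> F \<Longrightarrow> inj_on f (ball y r)"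
  proof -
    have "r \<le> r1" by (simp add: r_def)
    then have sub: "ball y r \<subseteq> ball y r1" for y by (rule subset_ball)
    show "r > 0" using r1(1) d(1) by (simp add: r_def)
    show "ball y r \<subseteq> C" "inj_on f (ball y r)" if "y \<in> F" for y
      using r1(2)[OF that] sub inj_on_subset[of f "ball y r1" "ball y r"] by blast+
  qed
  have disj: "ball y r \<inter> ball z r = {}" if "y \<in> F" "z \<in> F" "y \<noteq> z" for y z
  proof (rule ccontr)
    assume "ball y r \<inter> ball z r \<noteq> {}"
    then obtain u where "dist y u < r" "dist z u < r" by auto
    then have "dist y z < r + r" using dist_triangle2[of y z u] by linarith
    then show False using d(2)[OF that] by (simp add: r_def)
  qed
  have "open (\<Inter>y\<in>F. f ` ball y r)"
  proof (intro open_INT \<open>finite F\<close> ballI)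
    fix y assume y: "y \<in> F"
    show "open (f ` ball y r)"
      using r(2,3)[OF y] by (intro open_mapping_thm3 holomorphic_on_subset[OF U(3)]) auto
  qed
  moreover have "x \<in> (\<Inter>y\<in>F. f ` ball y r)"
    using r(1) by (force simp: F_def)
  ultimately obtain e0 where e0: "e0 > 0" "cball x e0 \<subseteq> (\<Inter>y\<in>F. f ` ball y r) \<inter> T"
    using U(2) x open_contains_cball by (metis IntI open_Int)
  define Z where "Z = (C \<inter> f -` cball x e0) - (\<Union>y\<in>F. ball y r)"
  have "compact Z" unfolding Z_def using e0(2) by (intro compact_diff cpt open_UN) auto
  then have "closed (f ` Z)"
    by (intro compact_imp_closed compact_continuous_image continuous_on_subset[OF cont]) (auto simp: Z_def)
  moreover have "x \<notin> f ` Z" using r(1) by (auto simp: Z_def F_def)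
  ultimately obtain e1 where e1: "e1 > 0" "ball x e1 \<subseteq> - f ` Z"
    by (meson ComplI open_Compl open_contains_ball)
  define e where "e = min e0 e1"
  have e: "e > 0" "ball x e \<subseteq> T" "\<And>y. y \<in> F \<Longrightarrow> ball x e \<subseteq> f ` ball y r"
  proof -
    have "ball x e \<subseteq> cball x e0" by (auto simp: e_def)
    then show "ball x e \<subseteq> T" "\<And>y. y \<in> F \<Longrightarrow> ball x e \<subseteq> f ` ball y r" using e0(2) by blast+
  qed (use e0 e1 in \<open>simp add: e_def\<close>)
  have cover: "z \<in> (\<Union>y\<in>F. ball y r)" if "z \<in> C" "f z \<in> ball x e" for z
  proof (rule ccontr)
    assume "z \<notin> (\<Union>y\<in>F. ball y r)"
    then have "z \<in> Z" using that by (auto simp: Z_def e_def)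
    then show False using e1(2) that(2) by (auto simp: e_def)
  qed
  define v where "v = (\<lambda>y. ball y r \<inter> f -` ball x e) ` F"
  have op: "open (ball y r \<inter> f -` ball x e)" if "y \<in> F" for y
    using r(2)[OF that] by (intro continuous_open_preimage continuous_on_subset[OF cont]) auto
  show "\<exists>T'. x \<in> T' \<and> openin (top_of_set T) T' \<and>
           (\<exists>v. \<Union>v = C \<inter> f -` T' \<and> (\<forall>u\<in>v. openin (top_of_set C) u) \<and> pairwise disjnt v \<and>
                (\<forall>u\<in>v. \<exists>q. homeomorphism u T' f q))"
  proof (intro exI[of _ "ball x e"] exI[of _ v] conjI ballI)
    show "x \<in> ball x e" using e by simp
    show "openin (top_of_set T) (ball x e)" using e(2) by (intro open_subset) auto
    show "\<Union>v = C \<inter> f -` ball x e" using cover r(2) by (fastforce simp: v_def)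
    show "pairwise disjnt v"
      using disj unfolding v_def pairwise_def disjnt_def by blast
    fix u assume "u \<in> v"
    then obtain y where y: "y \<in> F" "u = ball y r \<inter> f -` ball x e" by (auto simp: v_def)
    show "openin (top_of_set C) u" using op[OF y(1)] r(2)[OF y(1)] unfolding y(2)
      by (intro open_subset) auto
    have "f ` u = ball x e" using e(3)[OF y(1)] unfolding y(2) by blast
    moreover obtain q where "homeomorphism u (f ` u) f q"
    proof (rule invariance_of_domain_homeomorphism)
      show "open u" using op[OF y(1)] y(2) by simp
      show "continuous_on u f" using r(2)[OF y(1)] y(2) by (intro continuous_on_subset[OF cont]) auto
      show "inj_on f u" using r(3)[OF y(1)] y(2) by (auto intro: inj_on_subset)
    qed auto
    ultimately show "\<exists>q. homeomorphism u (ball x e) f q" by metis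
  qed
qed

lemma attracting_contraction:
  fixes F :: "complex \<Rightarrow> complex"
  assumes "(F has_field_derivative \<mu>) (at x)" "F x = x" "norm \<mu> < \<kappa>"
  obtains r where "r > 0" "\<And>z. z \<in> ball x r \<Longrightarrow> norm (F z - x) \<le> \<kappa> * norm (z - x)"
proof -
  have "((\<lambda>z. (F z - F x) / (z - x)) \<longlongrightarrow> \<mu>) (at x)"
    using assms(1) by (simp add: has_field_derivative_iff)
  then have "((\<lambda>z. norm ((F z - F x) / (z - x))) \<longlongrightarrow> norm \<mu>) (at x)"
    by (rule tendsto_norm)
  then have "\<forall>\<^sub>F z in at x. norm ((F z - F x) / (z - x)) < \<kappa>"
    using assms(3) order_tendstoD(2) by blast
  then obtain r where r: "r > 0" "\<And>z. z \<noteq> x \<Longrightarrow> dist z x < r \<Longrightarrow> norm ((F z - F x) / (z - x)) < \<kappa>"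
    unfolding eventually_at by auto
  show ?thesis
  proof (rule that[OF r(1)])
    fix z assume z: "z \<in> ball x r"
    show "norm (F z - x) \<le> \<kappa> * norm (z - x)"
    proof (cases "z = x")
      case False
      then have "norm ((F z - F x) / (z - x)) < \<kappa>" using r(2) z by (simp add: dist_commute)
      then show ?thesis using False assms(2) by (simp add: norm_divide divide_simps split: if_splits)
    qed (use assms in auto)
  qed
qed

lemma contraction_iterates_tendsto:
  fixes F :: "complex \<Rightarrow> complex"
  assumes F: "\<And>z. z \<in> ball x r \<Longrightarrow> norm (F z - x) \<le> \<kappa> * norm (z - x)"
    and \<kappa>: "0 \<le> \<kappa>" "\<kappa> < 1" and z: "z \<in> ball x r"
  shows "(\<lambda>n. (F ^^ n) z) \<longlonglongrightarrow> x"
proof -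
  have *: "(F ^^ n) z \<in> ball x r \<and> norm ((F ^^ n) z - x) \<le> \<kappa> ^ n * norm (z - x)" for n
  proof (induction n)
    case (Suc n)
    then have "norm ((F ^^ Suc n) z - x) \<le> \<kappa> * norm ((F ^^ n) z - x)" using F by simp
    also have "\<dots> \<le> \<kappa> * (\<kappa> ^ n * norm (z - x))" using Suc \<kappa> by (intro mult_left_mono) auto
    finally have 1: "norm ((F ^^ Suc n) z - x) \<le> \<kappa> ^ Suc n * norm (z - x)" by (simp add: mult.assoc)
    also have "\<dots> \<le> 1 * norm (z - x)" using \<kappa> by (intro mult_right_mono power_le_one) auto
    finally show ?case using 1 z by (simp add: dist_norm norm_minus_commute)
  qed (use z in auto)
  have "(\<lambda>n. \<kappa> ^ n * norm (z - x)) \<longlonglongrightarrow> 0"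
    using LIMSEQ_power_zero[of \<kappa>] \<kappa> tendsto_mult_left_zero by (simp add: tendsto_mult_left_zero)
  then have "(\<lambda>n. (F ^^ n) z - x) \<longlonglongrightarrow> 0"
    by (rule Lim_null_comparison[rotated]) (use * in auto)
  then show ?thesis by (simp add: LIM_zero_iff)
qed

lemma deriv_funpow_fixpoint:
  assumes "f holomorphic_on UNIV" and "f x = x"
  shows "deriv (f ^^ n) x = deriv f x ^ n"
proof -
  have "(f ^^ i) x = x" for i using assms(2) by (induction i) auto
  then show ?thesis by (simp add: deriv_funpow_prod[OF assms(1)])
qed

lemma funpow_period:
  assumes "(f ^^ k) x = x"
  shows "(f ^^ (k * n)) x = x" "(f ^^ (k * n + j)) x = (f ^^ j) x"
proof -
  show *: "(f ^^ (k * n)) x = x"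
    by (induction n) (auto simp: funpow_add assms)
  show "(f ^^ (k * n + j)) x = (f ^^ j) x"
    using * by (metis add.commute comp_apply funpow_add)
qed

text \<open>
  If no critical orbit enters a small disc \<open>D\<close> around \<open>x\<close> that is attracted to \<open>x\<close>, the inverse branches of
  all iterates along the cycle lift to \<open>D\<close>, since \<open>f\<close> is a covering over the image of the branch found so
  far. They take values in the bounded set \<open>U\<close>, so Cauchy's inequality bounds their derivatives at \<open>x\<close>; but
  these are the reciprocals of the powers of the multiplier.
\<close>

lemma attracting_cycle_attracts_critical_point:
  assumes f: "f holomorphic_on UNIV" "proper_holomorphic f U V" and U: "U \<subseteq> V" "bounded U"
    and orbit: "\<And>i. (f ^^ i) x \<in> U" and k: "k > 0" "(f ^^ k) x = x" 
    and attr: "norm (deriv (f ^^ k) x) < 1"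
  obtains w j where "w \<in> U" "deriv f w = 0" "(\<lambda>n. (f ^^ (k * n + j)) w) \<longlonglongrightarrow> x"
proof (rule ccontr)
  assume neg: "\<not> thesis"
  note found = that
  define F where "F = f ^^ k"
  define \<mu> where "\<mu> = deriv F x"
  have opU: "open U" and cpt: "\<And>K. compact K \<Longrightarrow> K \<subseteq> V \<Longrightarrow> compact (U \<inter> f -` K)"
    using f(2) by (auto simp: proper_holomorphic_def)
  have holn: "(f ^^ n) holomorphic_on A" for n A by (rule entire_funpow_holomorphic[OF f(1)])
  have cont: "continuous_on A f" for A using holomorphic_on_imp_continuous_on[OF holn[of 1]] by simp
  have F: "(F has_field_derivative \<mu>) (at x)" "F x = x" "norm \<mu> < (norm \<mu> + 1) / 2"
    using holomorphic_derivI[OF holn[of k UNIV]] k attr by (auto simp: F_def \<mu>_def)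
  obtain r0 where r0: "r0 > 0" "\<And>z. z \<in> ball x r0 \<Longrightarrow> norm (F z - x) \<le> (norm \<mu> + 1) / 2 * norm (z - x)"
    using attracting_contraction[OF F] by metis
  obtain r1 where r1: "r1 > 0" "ball x r1 \<subseteq> U"
    using openE[OF opU orbit[of 0]] by auto
  define r where "r = min r0 r1"
  have r: "r > 0" "ball x r \<subseteq> U" using r0 r1 by (auto simp: r_def)
  have to_x: "(\<lambda>n. (F ^^ n) z) \<longlonglongrightarrow> x" if "z \<in> ball x r" for z
    by (rule contraction_iterates_tendsto[OF r0(2)])
       (use that attr in \<open>auto simp: r_def \<mu>_def F_def\<close>)
  have reg: "deriv f w \<noteq> 0" if w: "w \<in> U" "(f ^^ m) w \<in> ball x r" for w m
  proof
    assume "deriv f w = 0"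
    moreover have "(f ^^ (k * n + m)) w = (F ^^ n) ((f ^^ m) w)" for n
      by (simp add: F_def funpow_mult funpow_add)
    then have "(\<lambda>n. (f ^^ (k * n + m)) w) \<longlonglongrightarrow> x" using to_x[OF w(2)] by simp
    ultimately show False using neg found w(1) by blast
  qed
  let ?D = "ball x r"
  have branch: "\<exists>\<sigma>. \<sigma> holomorphic_on ?D \<and> \<sigma> ` ?D \<subseteq> U \<and> (\<forall>z\<in>?D. (f ^^ n) (\<sigma> z) = z) \<and>
      \<sigma> x = (f ^^ (k * n - n)) x" for n
  proof (induction n)
    case 0
    show ?case using r(2) by (intro exI[of _ "\<lambda>z. z"]) (auto intro: holomorphic_intros)
  next
    case (Suc n)
    then obtain \<sigma> where \<sigma>: "\<sigma> holomorphic_on ?D" "\<sigma> ` ?D \<subseteq> U" "\<And>z. z \<in> ?D \<Longrightarrow> (f ^^ n) (\<sigma> z) = z"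
        "\<sigma> x = (f ^^ (k * n - n)) x" by blast
    have inj: "inj_on \<sigma> ?D" using \<sigma>(3) by (rule inj_on_inverseI)
    define T where "T = \<sigma> ` ?D"
    define C where "C = U \<inter> f -` T"
    have opT: "open T" unfolding T_def by (rule open_mapping_thm3[OF \<sigma>(1) _ inj]) simp
    have conT: "connected T" unfolding T_def
      by (intro connected_continuous_image holomorphic_on_imp_continuous_on[OF \<sigma>(1)]) simp
    have TV: "T \<subseteq> V" using \<sigma>(2) U(1) by (auto simp: T_def)
    define p where "p = (f ^^ (k * Suc n - Suc n)) x"
    have "n \<le> k * n" using k(1) by simp
    then have e: "Suc (k * Suc n - Suc n) = (k * n - n) + k" unfolding mult_Suc_right using k(1) by arith
    have fp: "f p = \<sigma> x"
    proof -
      have "f p = (f ^^ Suc (k * Suc n - Suc n)) x" by (simp add: p_def)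
      also have "\<dots> = (f ^^ (k * n - n)) ((f ^^ k) x)" unfolding e by (simp add: funpow_add)
      finally show ?thesis using k \<sigma>(4) by simp
    qed
    have pC: "p \<in> C" using orbit fp r(1) by (auto simp: C_def T_def p_def)
    have opC: "open C" unfolding C_def by (rule continuous_open_preimage[OF cont opU opT])
    have cov: "covering_space C f T"
    proof (rule proper_regular_covering)
      show "proper_holomorphic f C T"
        unfolding proper_holomorphic_def
      proof (intro conjI allI impI)
        show "f holomorphic_on C" using holn[of 1] by simp
        fix K assume K: "compact K \<and> K \<subseteq> T"
        then have "compact (U \<inter> f -` K)" using TV by (intro cpt) auto
        moreover have "U \<inter> f -` K = C \<inter> f -` K" using K by (auto simp: C_def)
        ultimately show "compact (C \<inter> f -` K)" by simp
      qed (use opC opT in \<open>auto simp: C_def\<close>)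
      show "C \<noteq> {}" using pC by blast
      fix z assume z: "z \<in> C"
      then obtain u where u: "u \<in> ?D" "f z = \<sigma> u" by (auto simp: C_def T_def)
      then have "(f ^^ Suc n) z \<in> ?D" using \<sigma>(3)[OF u(1)] by (simp add: funpow_swap1)
      then show "deriv f z \<noteq> 0" using reg[of z "Suc n"] z unfolding C_def by blast
    qed (rule conT)
    obtain g where g: "continuous_on ?D g" "g \<in> ?D \<rightarrow> C" "\<And>y. y \<in> ?D \<Longrightarrow> f (g y) = \<sigma> y" "g x = p"
    proof (rule covering_space_lift_strong[OF cov pC])
      show "x \<in> ?D" using r by simp
      show "simply_connected ?D" by (simp add: convex_imp_simply_connected)
      show "locally path_connected ?D" by (simp add: convex_imp_locally_path_connected)
      show "continuous_on ?D \<sigma>" using \<sigma>(1) holomorphic_on_imp_continuous_on by blast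
      show "\<sigma> \<in> ?D \<rightarrow> T" by (auto simp: T_def)
      show "\<sigma> x = f p" using fp by simp
    qed auto
    have "g holomorphic_on ?D"
      by (rule covering_space_lift_is_holomorphic[OF cov opC _ \<sigma>(1) _ g(2,1,3)])
         (use holn[of 1] in \<open>auto simp: T_def\<close>)
    moreover have "(f ^^ Suc n) (g z) = z" if "z \<in> ?D" for z
      using g(3)[OF that] \<sigma>(3)[OF that] by (simp add: funpow_swap1)
    ultimately show ?case using g(2,4) by (intro exI[of _ g]) (auto simp: C_def p_def)
  qed
  obtain B where B: "\<And>z. z \<in> U \<Longrightarrow> norm z \<le> B" using U(2) by (auto simp: bounded_iff)
  have "1 \<le> norm \<mu> ^ m * (B / (r/2))" for m
  proof -
    obtain \<sigma> where \<sigma>: "\<sigma> holomorphic_on ?D" "\<sigma> ` ?D \<subseteq> U" "\<And>z. z \<in> ?D \<Longrightarrow> (f ^^ (k * m)) (\<sigma> z) = z"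
        "\<sigma> x = (f ^^ (k * (k * m) - k * m)) x" using branch[of "k * m"] by blast
    have "k * (k * m) - k * m = k * (k * m - m)" by (simp add: diff_mult_distrib2)
    then have \<sigma>x: "\<sigma> x = x" using \<sigma>(4) funpow_period(1)[OF k(2)] by simp
    have "norm ((deriv ^^ 1) \<sigma> x) \<le> fact 1 * B / (r/2) ^ 1"
    proof (rule Cauchy_inequality)
      show "\<sigma> holomorphic_on ball x (r/2)" using r by (intro holomorphic_on_subset[OF \<sigma>(1)] subset_ball) auto
      have "cball x (r/2) \<subseteq> ?D" using r by auto
      then show "continuous_on (cball x (r/2)) \<sigma>"
        using holomorphic_on_imp_continuous_on[OF \<sigma>(1)] continuous_on_subset by blast
      fix z assume "norm (x - z) = r/2"
      then have "z \<in> ?D" using r by (simp add: dist_norm)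
      then show "norm (\<sigma> z) \<le> B" using \<sigma>(2) B by blast
    qed (use r in simp)
    then have d: "norm (deriv \<sigma> x) \<le> B / (r/2)" by simp
    have fm: "f ^^ (k * m) = F ^^ m" by (simp add: F_def funpow_mult)
    have "(\<sigma> has_field_derivative deriv \<sigma> x) (at x)"
      using r by (intro holomorphic_derivI[OF \<sigma>(1)]) auto
    moreover have "((f ^^ (k * m)) has_field_derivative \<mu> ^ m) (at (\<sigma> x))"
      using holomorphic_derivI[OF holn[of "k*m" UNIV], of x] deriv_funpow_fixpoint[of F x m] holn[of k] F(2)
      unfolding \<sigma>x fm \<mu>_def by (simp add: F_def)
    ultimately have "((\<lambda>z. (f ^^ (k * m)) (\<sigma> z)) has_field_derivative \<mu> ^ m * deriv \<sigma> x) (at x)"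
      by (rule DERIV_chain2[rotated])
    moreover have "((\<lambda>z. (f ^^ (k * m)) (\<sigma> z)) has_field_derivative 1) (at x)"
      by (rule has_field_derivative_transform_within_open[OF DERIV_ident, of ?D]) (use r \<sigma>(3) in auto)
    ultimately have "\<mu> ^ m * deriv \<sigma> x = 1" by (rule DERIV_unique)
    then have "1 = norm \<mu> ^ m * norm (deriv \<sigma> x)" by (metis norm_mult norm_one norm_power)
    also have "\<dots> \<le> norm \<mu> ^ m * (B / (r/2))" using d by (intro mult_left_mono) auto
    finally show ?thesis .
  qed
  moreover have "(\<lambda>m. norm \<mu> ^ m * (B / (r/2))) \<longlonglongrightarrow> 0"
    using attr by (intro tendsto_mult_left_zero LIMSEQ_power_zero) (simp add: \<mu>_def F_def)
  ultimately have "(1::real) \<le> 0" by (intro LIMSEQ_le_const) auto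
  then show False by simp
qed

section \<open>An escaping critical point leaves room for only one nonrepelling cycle\<close>

text \<open>
  The square of the Lagrange basis function at \<open>y\<close>, multiplied by \<open>z - y\<close>, has a double zero at every other node
  and a simple zero with derivative 1 at \<open>y\<close>.
\<close>

lemma Hermite_interpolation_zero:
  fixes g :: "complex \<Rightarrow> complex"
  assumes Y: "finite Y"
  obtains h where "h holomorphic_on UNIV" "\<And>y. y \<in> Y \<Longrightarrow> h y = 0"
    "\<And>y. y \<in> Y \<Longrightarrow> deriv h y = g y"
proof -
  define p where "p = (\<lambda>y z. \<Prod>x\<in>Y - {y}. (z - x) / (y - x))"
  define h where "h = (\<lambda>z. \<Sum>y\<in>Y. g y * ((z - y) * (p y z)\<^sup>2))"
  have holp: "p y holomorphic_on A" for y A unfolding p_def by (intro holomorphic_intros) auto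
  have p1: "p y y = 1" for y unfolding p_def by (rule prod.neutral) auto
  have p0: "p y z = 0" if "z \<in> Y" "z \<noteq> y" for y z
    unfolding p_def using that Y by (intro prod_zero) auto
  show ?thesis
  proof (rule that)
    show "h holomorphic_on UNIV" unfolding h_def by (intro holomorphic_intros holp)
    show "h y = 0" if "y \<in> Y" for y
      unfolding h_def
    proof (rule sum.neutral, rule ballI)
      fix x assume "x \<in> Y"
      show "g x * ((y - x) * (p x y)\<^sup>2) = 0" using p0[OF that, of x] by (cases "x = y") auto
    qed
    show "deriv h y = g y" if y: "y \<in> Y" for y
    proof -
      have "((\<lambda>z. g x * ((z - x) * (p x z)\<^sup>2)) has_field_derivative g x * (if x = y then 1 else 0)) (at y)" for x
      proof -
        have "(p x has_field_derivative deriv (p x) y) (at y)"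
          by (rule holomorphic_derivI[OF holp[of x UNIV]]) auto
        then show ?thesis using p0[OF y, of x] p1[of x]
          by (cases "x = y") (auto intro!: derivative_eq_intros)
      qed
      then have "(h has_field_derivative (\<Sum>x\<in>Y. g x * (if x = y then 1 else 0))) (at y)"
        unfolding h_def by (intro DERIV_sum) 
      moreover have "(\<Sum>x\<in>Y. g x * (if x = y then 1 else 0)) = g y"
        using Y y by (simp add: if_distrib sum.delta cong: if_cong)
      ultimately show ?thesis using DERIV_imp_deriv by metis
    qed
  qed
qed

context expanding_at_infinity
begin

text \<open>
  The perturbation \<open>F = f + \<epsilon> h\<close> with \<open>h = 0\<close> and \<open>h' = - f'\<close> on both cycles keeps the cycles and multiplies
  the derivative of \<open>f\<close> along them by \<open>1 - \<epsilon>\<close>. The set \<open>V = {|f\<^sup>N| < R}\<close> is chosen such that the escaping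
  critical point \<open>w\<close> has positive distance \<open>\<delta>\<close> from it. For small \<open>\<epsilon>\<close> the map \<open>F\<close> restricts to a proper
  map into \<open>V\<close> with at most one critical point, so it cannot have the two attracting cycles \<open>0\<close> and \<open>y\<close>.
\<close>

lemma indifferent_cycle_unique_if_critical_escapes:
  assumes crit: "\<And>z. deriv f z = \<kappa> * (z - a) * (z - w)" "\<kappa> \<noteq> 0"
    and w: "w \<notin> filled_julia f" and indiff0: "norm (deriv f 0) = 1"
    and k: "k > 0" "(f ^^ k) y = y" "norm (deriv (f ^^ k) y) = 1"
  shows "y = 0"
proof (rule ccontr)
  assume y0: "y \<noteq> 0"
  define Y where "Y = insert 0 ((\<lambda>i. (f ^^ i) y) ` {..<k})"
  have "finite Y" by (simp add: Y_def)
  then obtain h where h: "h holomorphic_on UNIV" "\<And>u. u \<in> Y \<Longrightarrow> h u = 0"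
      "\<And>u. u \<in> Y \<Longrightarrow> deriv h u = - deriv f u"
    using Hermite_interpolation_zero[of Y "\<lambda>u. - deriv f u"] by metis
  have orbY: "(f ^^ i) y \<in> Y" for i
  proof -
    have "(f ^^ i) y = (f ^^ (k * (i div k) + i mod k)) y" by simp
    also have "\<dots> = (f ^^ (i mod k)) y" by (rule funpow_period(2)[OF k(2)])
    also have "\<dots> \<in> Y" using k(1) by (auto simp: Y_def)
    finally show ?thesis .
  qed
  have YK: "Y \<subseteq> filled_julia f"
  proof
    fix u assume "u \<in> Y"
    then obtain i where "u = 0 \<or> u = (f ^^ i) y" by (auto simp: Y_def)
    moreover have "0 \<in> filled_julia f" by (simp add: filled_julia_def funpow_fix0)
    moreover have "(f ^^ i) y \<in> filled_julia f"
    proof -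
      have "(\<lambda>n. (f ^^ n) ((f ^^ i) y)) n \<in> Y" for n
        using orbY[of "n + i"] by (simp add: funpow_add)
      then have "range (\<lambda>n. (f ^^ n) ((f ^^ i) y)) \<subseteq> Y" by blast
      then show ?thesis unfolding filled_julia_def
        using finite_imp_bounded[OF \<open>finite Y\<close>] bounded_subset by auto
    qed
    ultimately show "u \<in> filled_julia f" by auto
  qed
  obtain N where N: "R < norm ((f ^^ N) w)" using w by (auto simp: filled_julia_eq not_le)
  define D where "D = closed_sublevel N"
  define V where "V = sublevel N"
  define S where "S = {z. norm ((f ^^ N) z) = R}"
  have cD: "compact D" unfolding D_def by (rule compact_sublevel)
  have VD: "V \<subseteq> D" "S \<subseteq> D" "D = V \<union> S" by (auto simp: D_def V_def S_def)
  have YV: "Y \<subseteq> V" using YK filled_julia_sublevel[of N] by (auto simp: V_def)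
  have Dball: "D \<subseteq> cball 0 R" using escape_bounded by (auto simp: D_def)
  have opV: "open V" unfolding V_def by (rule open_sublevel)
  have cS: "compact S"
  proof -
    have "closed S" unfolding S_def using continuous_funpow
      by (intro closed_Collect_eq continuous_intros) auto
    then show ?thesis using VD(2) cD by (metis compact_Int_closed inf.absorb2)
  qed
  have contf: "continuous_on A f" for A
    by (rule holomorphic_on_imp_continuous_on[OF holomorphic_on_subset[OF entire]]) simp
  have conth: "continuous_on A h" for A
    by (rule holomorphic_on_imp_continuous_on[OF holomorphic_on_subset[OF h(1)]]) simp
  have holdh: "deriv h holomorphic_on A" for A
    by (rule holomorphic_on_subset[of _ UNIV], rule holomorphic_deriv[OF h(1)]) auto
  have contdh: "continuous_on A (deriv h)" for A by (rule holomorphic_on_imp_continuous_on[OF holdh])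
  have holddh: "deriv (deriv h) holomorphic_on A" for A
    by (rule holomorphic_on_subset[of _ UNIV], rule holomorphic_deriv[OF holdh]) auto
  have bound: "\<exists>H>0. \<forall>z\<in>C. norm (g z) \<le> H" if "compact C" "continuous_on C g" for C and g :: "complex \<Rightarrow> complex"
    using compact_imp_bounded[OF compact_continuous_image[OF that(2,1)]] unfolding bounded_pos by auto
  obtain H0 where H0: "H0 > 0" "\<And>z. z \<in> D \<Longrightarrow> norm (h z) \<le> H0" using bound[OF cD conth] by blast
  obtain H1 where H1: "H1 > 0" "\<And>z. z \<in> D \<Longrightarrow> norm (deriv h z) \<le> H1" using bound[OF cD contdh] by blast
  obtain H2 where H2: "H2 > 0" "\<And>z. z \<in> cball 0 R \<Longrightarrow> norm (deriv (deriv h) z) \<le> H2"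
    using bound[OF compact_cball holomorphic_on_imp_continuous_on[OF holddh], of 0 R] by blast
  have lip: "norm (deriv h z1 - deriv h z2) \<le> H2 * norm (z1 - z2)" if "z1 \<in> D" "z2 \<in> D" for z1 z2
    by (rule field_differentiable_bound[OF convex_cball[of 0 R] _ H2(2)])
       (use that Dball in \<open>auto intro: holomorphic_derivI[OF holdh[of UNIV]] has_field_derivative_at_within\<close>)
  obtain \<delta> where \<delta>: "\<delta> > 0" "\<And>z. z \<in> D \<Longrightarrow> \<delta> \<le> norm (z - w)"
  proof -
    have "w \<notin> D" using N by (simp add: D_def)
    then have "open (- D)" "w \<in> - D" using compact_imp_closed[OF cD] by auto
    then obtain e where "e > 0" "ball w e \<subseteq> - D" using openE by blast
    then show ?thesis using that[of e] by (force simp: dist_norm norm_minus_commute not_less)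
  qed
  obtain d where d: "d > 0" "\<And>x v. x \<in> f ` S \<Longrightarrow> v \<in> D \<Longrightarrow> d \<le> dist x v"
  proof -
    have "f ` S \<inter> D = {}"
    proof (rule ccontr)
      assume "f ` S \<inter> D \<noteq> {}"
      then obtain z where z: "norm ((f ^^ N) z) = R" "norm ((f ^^ Suc N) z) \<le> R"
        by (auto simp: S_def D_def funpow_swap1)
      then show False using escape_mono[of "Suc N" z N] by simp
    qed
    then show ?thesis
      using separate_compact_closed[OF compact_continuous_image[OF contf cS] compact_imp_closed[OF cD]] that
      by metis
  qed
  \<comment> \<open>The bound \<open>\<epsilon> H\<^sub>0 < d\<close> keeps \<open>F\<close> proper; \<open>\<epsilon> M < \<delta>\<close> rules out two critical points in \<open>V\<close>.\<close>
  define M where "M = H1 / (norm \<kappa> * \<delta>) + H2 / norm \<kappa>"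
  have M: "M > 0" using H1 H2 crit(2) \<delta> by (simp add: M_def add_pos_pos)
  define \<epsilon> where "\<epsilon> = min (1/2) (min (d / (2 * H0)) (\<delta> / (2 * M)))"
  have \<epsilon>: "0 < \<epsilon>" "\<epsilon> < 1" "\<epsilon> * H0 < d" "\<epsilon> * M < \<delta>"
  proof -
    show "0 < \<epsilon>" "\<epsilon> < 1" using d H0 \<delta> M by (auto simp: \<epsilon>_def)
    have "\<epsilon> * H0 \<le> d / (2 * H0) * H0" using H0 by (intro mult_right_mono) (auto simp: \<epsilon>_def)
    then show "\<epsilon> * H0 < d" using d H0 by simp
    have "\<epsilon> * M \<le> \<delta> / (2 * M) * M" using M by (intro mult_right_mono) (auto simp: \<epsilon>_def)
    then show "\<epsilon> * M < \<delta>" using \<delta> M by simp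
  qed
  define F where "F = (\<lambda>z. f z + of_real \<epsilon> * h z)"
  have holF: "F holomorphic_on UNIV" unfolding F_def by (intro holomorphic_intros entire h)
  have derF: "deriv F z = deriv f z + of_real \<epsilon> * deriv h z" for z
    unfolding F_def
    by (rule DERIV_imp_deriv[OF DERIV_add[OF holomorphic_derivI[OF entire open_UNIV UNIV_I]
         DERIV_cmult[OF holomorphic_derivI[OF h(1) open_UNIV UNIV_I]]]])
  define U where "U = V \<inter> F -` V"
  have contF: "continuous_on A F" for A
    by (rule holomorphic_on_imp_continuous_on[OF holomorphic_on_subset[OF holF]]) simp
  have opU: "open U" unfolding U_def by (rule continuous_open_preimage[OF contF opV opV])
  have properF: "proper_holomorphic F U V"
    unfolding proper_holomorphic_def
  proof (intro conjI allI impI opU opV)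
    show "F holomorphic_on U" by (rule holomorphic_on_subset[OF holF]) auto
    show "F ` U \<subseteq> V" by (auto simp: U_def)
    fix C assume C: "compact C \<and> C \<subseteq> V"
    have "z \<in> V" if z: "z \<in> D" "F z \<in> C" for z
    proof (rule ccontr)
      assume "z \<notin> V"
      then have "z \<in> S" using z VD by blast
      then have "d \<le> dist (f z) (F z)" using d(2)[of "f z" "F z"] z C VD by blast
      also have "\<dots> = \<epsilon> * norm (h z)" using \<epsilon>(1) by (simp add: F_def dist_norm norm_mult)
      also have "\<dots> \<le> \<epsilon> * H0" using H0 z(1) \<epsilon>(1) by (intro mult_left_mono) auto
      finally show False using \<epsilon>(3) by simp
    qed
    then have "U \<inter> F -` C = D \<inter> F -` C" using VD C unfolding U_def by blast
    moreover have "closed (D \<inter> F -` C)"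
      using C cD by (intro continuous_closed_preimage contF compact_imp_closed) auto
    moreover have "bounded (D \<inter> F -` C)" by (rule bounded_subset[OF compact_imp_bounded[OF cD]]) auto
    ultimately show "compact (U \<inter> F -` C)" by (simp add: compact_eq_bounded_closed)
  qed
  \<comment> \<open>Subtract the two equations \<open>F' = 0\<close>: as \<open>f'\<close> is quadratic, \<open>(z\<^sub>1 - w) + (z\<^sub>2 - a)\<close> is of order \<open>\<epsilon>\<close>,
    and so is \<open>z\<^sub>2 - a\<close>; hence \<open>z\<^sub>1\<close> is too close to \<open>w\<close>.\<close>
  have one_crit: "z1 = z2" if z: "z1 \<in> U" "z2 \<in> U" "deriv F z1 = 0" "deriv F z2 = 0" for z1 z2
  proof (rule ccontr)
    assume ne: "z1 \<noteq> z2"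
    have zD: "z1 \<in> D" "z2 \<in> D" using z VD by (auto simp: U_def)
    have e1: "\<kappa> * (z1 - a) * (z1 - w) = - (of_real \<epsilon> * deriv h z1)"
     and e2: "\<kappa> * (z2 - a) * (z2 - w) = - (of_real \<epsilon> * deriv h z2)"
      using z(3,4) unfolding derF crit by (simp_all add: eq_neg_iff_add_eq_0)
    have n2: "norm (z2 - a) \<le> \<epsilon> * (H1 / (norm \<kappa> * \<delta>))"
    proof -
      have "norm \<kappa> * norm (z2 - a) * \<delta> \<le> norm \<kappa> * norm (z2 - a) * norm (z2 - w)"
        using \<delta> zD by (intro mult_left_mono) auto
      also have "\<dots> = \<epsilon> * norm (deriv h z2)" using arg_cong[OF e2, of norm] \<epsilon>(1) by (simp add: norm_mult)
      also have "\<dots> \<le> \<epsilon> * H1" using H1 zD \<epsilon>(1) by (intro mult_left_mono) auto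
      finally show ?thesis using crit(2) \<delta>(1) by (simp add: field_simps)
    qed
    have "(z1 - z2) * (\<kappa> * ((z1 - w) + (z2 - a))) = - (of_real \<epsilon> * (deriv h z1 - deriv h z2))"
    proof -
      have "(z1 - z2) * (\<kappa> * ((z1 - w) + (z2 - a))) = \<kappa> * (z1 - a) * (z1 - w) - \<kappa> * (z2 - a) * (z2 - w)"
        by (simp add: algebra_simps)
      then show ?thesis unfolding e1 e2 by (simp add: algebra_simps)
    qed
    then have "norm (z1 - z2) * (norm \<kappa> * norm ((z1 - w) + (z2 - a))) = \<epsilon> * norm (deriv h z1 - deriv h z2)"
      using \<epsilon>(1) by (metis norm_mult norm_minus_cancel norm_of_real abs_of_pos)
    also have "\<dots> \<le> \<epsilon> * (H2 * norm (z1 - z2))" using lip[OF zD] \<epsilon>(1) by (intro mult_left_mono) auto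
    finally have "norm (z1 - z2) * (norm \<kappa> * norm ((z1 - w) + (z2 - a))) \<le> norm (z1 - z2) * (\<epsilon> * H2)"
      by (simp add: ac_simps)
    then have "norm \<kappa> * norm ((z1 - w) + (z2 - a)) \<le> \<epsilon> * H2" using ne by simp
    then have n1: "norm ((z1 - w) + (z2 - a)) \<le> \<epsilon> * (H2 / norm \<kappa>)" using crit(2) by (simp add: field_simps)
    have "\<delta> \<le> norm (z1 - w)" using \<delta> zD by blast
    also have "\<dots> = norm (((z1 - w) + (z2 - a)) - (z2 - a))" by simp
    also have "\<dots> \<le> norm ((z1 - w) + (z2 - a)) + norm (z2 - a)" by (rule norm_triangle_ineq4)
    also have "\<dots> \<le> \<epsilon> * (H2 / norm \<kappa>) + \<epsilon> * (H1 / (norm \<kappa> * \<delta>))" by (rule add_mono[OF n1 n2])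
    also have "\<dots> = \<epsilon> * M" by (simp add: M_def algebra_simps)
    finally show False using \<epsilon>(4) by simp
  qed
  have FY: "F u = f u" "deriv F u = (1 - of_real \<epsilon>) * deriv f u" if "u \<in> Y" for u
  proof -
    show "F u = f u" using h(2)[OF that] by (simp add: F_def)
    show "deriv F u = (1 - of_real \<epsilon>) * deriv f u"
      unfolding derF h(3)[OF that] by (simp add: algebra_simps)
  qed
  have Fi: "(F ^^ i) y = (f ^^ i) y" for i
    by (induction i) (use FY orbY in auto)
  have F0: "F 0 = 0" using FY(1)[of 0] fix0 by (simp add: Y_def)
  have Y_U: "Y \<subseteq> U"
  proof
    fix u assume u: "u \<in> Y"
    have "f u \<in> Y"
      using u orbY[of "Suc i" for i] fix0 by (auto simp: Y_def)
    then show "u \<in> U" using YV u FY(1)[OF u] by (auto simp: U_def)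
  qed
  have small: "norm ((1 - complex_of_real \<epsilon>) ^ m) < 1" if "m > 0" for m
  proof -
    have "norm (1 - complex_of_real \<epsilon>) = 1 - \<epsilon>"
      using \<epsilon> by (metis abs_of_pos diff_gt_0_iff_gt norm_of_real of_real_1 of_real_diff)
    then show ?thesis using \<epsilon> that by (simp add: norm_power power_less_one_iff)
  qed
  have bU: "bounded U" using VD(1) by (intro bounded_subset[OF compact_imp_bounded[OF cD]]) (auto simp: U_def)
  have UV: "U \<subseteq> V" by (auto simp: U_def)
  obtain v1 j1 where v1: "v1 \<in> U" "deriv F v1 = 0" "(\<lambda>n. (F ^^ (1 * n + j1)) v1) \<longlonglongrightarrow> 0"
  proof (rule attracting_cycle_attracts_critical_point[OF holF properF UV bU, of 0 1])
    have "(F ^^ i) 0 = 0" for i by (induction i) (auto simp: F0)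
    moreover have "0 \<in> Y" by (simp add: Y_def)
    ultimately show "(F ^^ i) 0 \<in> U" for i using Y_U by auto
    show "norm (deriv (F ^^ 1) 0) < 1"
      using FY(2)[of 0] indiff0 small[of 1] by (simp add: Y_def norm_mult)
  qed (use F0 in auto)
  obtain v2 j2 where v2: "v2 \<in> U" "deriv F v2 = 0" "(\<lambda>n. (F ^^ (k * n + j2)) v2) \<longlonglongrightarrow> y"
  proof (rule attracting_cycle_attracts_critical_point[OF holF properF UV bU, of y k])
    show "(F ^^ i) y \<in> U" for i using Fi orbY Y_U by auto
    have "deriv (F ^^ k) y = (\<Prod>i<k. (1 - of_real \<epsilon>) * deriv f ((f ^^ i) y))"
      unfolding deriv_funpow_prod[OF holF] Fi using FY(2) orbY by (intro prod.cong) auto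
    also have "\<dots> = (1 - of_real \<epsilon>) ^ k * deriv (f ^^ k) y"
      unfolding deriv_funpow_prod[OF entire] by (simp add: prod.distrib)
    finally show "norm (deriv (F ^^ k) y) < 1" using small[OF k(1)] k(3) by (simp add: norm_mult)
  qed (use k Fi in auto)
  have "v1 = v2" using one_crit v1 v2 by blast
  have "(\<lambda>n. (F ^^ (k * n + j2)) v2) \<longlonglongrightarrow> 0"
  proof -
    have "(\<lambda>m. (F ^^ m) v1) \<longlonglongrightarrow> 0"
      using v1(3) by (simp add: LIMSEQ_ignore_initial_segment[where k=j1] LIMSEQ_offset)
    moreover have "filterlim (\<lambda>n. k * n + j2) at_top sequentially"
      using k(1) by (intro filterlim_at_top_mono[OF filterlim_ident]) (auto intro!: always_eventually simp: trans_le_add1)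
    ultimately show ?thesis unfolding \<open>v1 = v2\<close> by (rule filterlim_compose)
  qed
  with v2(3) y0 show False using LIMSEQ_unique by blast
qed

end

section \<open>Families of polynomials depending polynomially on a parameter\<close>

text \<open>
  A polynomial in \<open>z\<close> whose coefficients are polynomials in the parameter \<open>s\<close>; the inner polynomial
  type carries the parameter.
\<close>

definition eval2 :: "complex poly poly \<Rightarrow> complex \<Rightarrow> complex \<Rightarrow> complex" where
  "eval2 A s z = poly (poly A [:z:]) s"

lemma eval2_simps [simp]:
  "eval2 0 s z = 0" "eval2 1 s z = 1" "eval2 (pCons a A) s z = poly a s + z * eval2 A s z"
  "eval2 (A + B) s z = eval2 A s z + eval2 B s z" "eval2 (A - B) s z = eval2 A s z - eval2 B s z"
  "eval2 (A * B) s z = eval2 A s z * eval2 B s z" "eval2 (Polynomial.smult p A) s z = poly p s * eval2 A s z"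
  by (simp_all add: eval2_def)

lemma eval2_map_poly: "eval2 A s z = poly (map_poly (\<lambda>a. poly a s) A) z"
  by (induction A) (simp_all add: Polynomial.map_poly_pCons)

lemma eval2_pcompose: "eval2 (pcompose A B) s z = eval2 A s (eval2 B s z)"
  by (induction A) (simp_all add: pcompose_pCons)

lemma continuous_on_eval2 [continuous_intros]:
  assumes "continuous_on S f" "continuous_on S g"
  shows "continuous_on S (\<lambda>x. eval2 A (f x) (g x))"
  by (induction A) (auto intro!: continuous_intros assms)

lemma has_field_derivative_eval2:
  "((\<lambda>z. eval2 A s z) has_field_derivative eval2 (pderiv A) s z) (at z within S)"
  by (induction A) (auto intro!: derivative_eq_intros simp: pderiv_pCons)

lemma has_field_derivative_eval2_param:
  "((\<lambda>s. eval2 A s z) has_field_derivative eval2 (map_poly pderiv A) s z) (at s within S)"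
proof (induction A)
  case (pCons a A)
  have "((\<lambda>s. poly a s + z * eval2 A s z) has_field_derivative
      poly (pderiv a) s + z * eval2 (map_poly pderiv A) s z) (at s within S)"
    by (intro DERIV_add DERIV_cmult pCons(2) has_field_derivative_at_within[OF poly_DERIV])
  then show ?case by (simp add: Polynomial.map_poly_pCons)
qed simp

lemma holomorphic_eval2: "eval2 A s holomorphic_on S"
  using has_field_derivative_eval2 by (metis holomorphic_onI field_differentiable_def)

lemma deriv_eval2: "deriv (eval2 A s) z = eval2 (pderiv A) s z"
  by (rule DERIV_imp_deriv[OF has_field_derivative_eval2])

text \<open>
  Differentiation under the integral sign; the form of a quotient of polynomials makes the derivative in the
  parameter explicit and jointly continuous.
\<close>

lemma holomorphic_contour_integral_eval2:
  assumes nz: "\<And>s z. s \<in> ball s0 \<delta> \<Longrightarrow> z \<in> sphere z0 r \<Longrightarrow> eval2 B s z \<noteq> 0" and r: "r > 0"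
  shows "(\<lambda>s. contour_integral (circlepath z0 r) (\<lambda>z. eval2 A s z / eval2 B s z)) holomorphic_on ball s0 \<delta>"
proof -
  let ?\<gamma> = "circlepath z0 r"
  define v where "v = (\<lambda>t::real. of_real (2 * pi) * \<i> * of_real r * exp (2 * of_real pi * \<i> * of_real t))"
  have \<gamma>: "?\<gamma> t \<in> sphere z0 r" for t
    using r by (simp add: circlepath dist_norm norm_mult)
  have contg: "continuous_on X (\<lambda>x. ?\<gamma> (h x))" if "continuous_on X h" for X and h :: "(complex \<times> real) \<Rightarrow> real"
    unfolding circlepath by (intro continuous_intros that)
  let ?D = "\<lambda>s t. (eval2 (map_poly pderiv A) s (?\<gamma> t) * eval2 B s (?\<gamma> t) -
     eval2 A s (?\<gamma> t) * eval2 (map_poly pderiv B) s (?\<gamma> t)) / (eval2 B s (?\<gamma> t) * eval2 B s (?\<gamma> t)) * v t"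
  have "(\<lambda>s. integral (cbox 0 1) (\<lambda>t. eval2 A s (?\<gamma> t) / eval2 B s (?\<gamma> t) * v t)) holomorphic_on ball s0 \<delta>"
  proof (rule leibniz_rule_holomorphic[where fx = ?D])
    fix s t assume "s \<in> ball s0 \<delta>"
    then have "eval2 B s (?\<gamma> t) \<noteq> 0" using nz \<gamma> by blast
    then show "((\<lambda>s. eval2 A s (?\<gamma> t) / eval2 B s (?\<gamma> t) * v t) has_field_derivative ?D s t) (at s within ball s0 \<delta>)"
      by (intro DERIV_cmult_right DERIV_divide has_field_derivative_eval2_param)
  next
    fix s assume s: "s \<in> ball s0 \<delta>"
    have "continuous_on (cbox 0 1) (\<lambda>t. eval2 A s (?\<gamma> t) / eval2 B s (?\<gamma> t) * v t)"
      unfolding v_def using nz[OF s \<gamma>]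
      by (intro continuous_intros) (auto simp: circlepath intro!: continuous_intros)
    then show "(\<lambda>t. eval2 A s (?\<gamma> t) / eval2 B s (?\<gamma> t) * v t) integrable_on cbox 0 1"
      by (rule integrable_continuous)
  next
    show "continuous_on (ball s0 \<delta> \<times> cbox 0 1) (\<lambda>(s, t). ?D s t)"
      unfolding v_def case_prod_unfold using nz[OF _ \<gamma>]
      by (intro continuous_intros contg) auto
  qed simp
  then show ?thesis
    unfolding contour_integral_integral vector_derivative_circlepath v_def cbox_interval .
qed

lemma near_parameter:
  assumes C: "compact C" and N: "open N" and sub: "\<And>z. z \<in> C \<Longrightarrow> (s0 :: complex, z :: complex) \<in> N"
  obtains \<delta> where "\<delta> > 0" "\<And>s z. s \<in> ball s0 \<delta> \<Longrightarrow> z \<in> C \<Longrightarrow> (s, z) \<in> N"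
proof -
  have "{s0} \<times> C \<subseteq> N" using sub by auto
  from Elementary_Topology.tube_lemma[OF C N this] obtain X where "s0 \<in> X" "open X" "X \<times> C \<subseteq> N" by blast
  then show ?thesis using that openE by (metis SigmaI subsetD)
qed

text \<open>
  By the argument principle, \<open>H s = \<Sum> (1 - \<mu>\<^sub>0/\<mu>)\<close>, summed with multiplicity over the fixed points near \<open>z\<^sub>0\<close> for
  the parameter \<open>s\<close>, where \<open>\<mu>\<close> is the multiplier of the respective fixed point, is a contour integral and so
  holomorphic in \<open>s\<close>. Since \<open>|\<mu>| \<ge> 1 = |\<mu>\<^sub>0|\<close>, each term has nonnegative real part, and \<open>H s\<^sub>0 = 0\<close>. By the open
  mapping theorem \<open>H\<close> vanishes identically, so each term has real part 0, which means \<open>\<mu> = \<mu>\<^sub>0\<close>. This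
  covers a multiple fixed point as well, where the fixed points need not depend holomorphically on \<open>s\<close>.
\<close>

lemma nonrepelling_or_persistent:
  assumes fp: "eval2 A s0 z0 = z0" and \<mu>0: "eval2 (pderiv A) s0 z0 = \<mu>0" "norm \<mu>0 = 1"
    and nonid: "\<And>s. \<exists>z. eval2 A s z \<noteq> z"
    and \<eta>: "\<eta> > 0" and nonattr: "\<And>s z. s \<in> ball s0 \<eta> \<Longrightarrow> z \<in> ball z0 \<eta> \<Longrightarrow> eval2 A s z = z \<Longrightarrow>
         1 \<le> norm (eval2 (pderiv A) s z)"
    and \<rho>: "\<rho> > 0"
  obtains \<delta> where "\<delta> > 0" "\<And>s. s \<in> ball s0 \<delta> \<Longrightarrow> \<exists>z\<in>ball z0 \<rho>. eval2 A s z = z \<and> eval2 (pderiv A) s z = \<mu>0"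
proof -
  define P where "P = A - [:0, 1:]"
  define M where "M = pderiv A"
  have P: "eval2 P s z = eval2 A s z - z" for s z by (simp add: P_def)
  have finP: "finite {z. eval2 P s z = 0}" for s
  proof -
    obtain z where "eval2 P s z \<noteq> 0" using nonid[of s] P by auto
    then have "map_poly (\<lambda>a. poly a s) P \<noteq> 0" unfolding eval2_map_poly by auto
    then show ?thesis unfolding eval2_map_poly by (rule poly_roots_finite)
  qed
  have "\<mu>0 \<noteq> 0" using \<mu>0 by auto
  have contM: "continuous_on UNIV (\<lambda>x. eval2 B (fst x) (snd x))" for B
    by (intro continuous_intros)
  obtain r1 where r1: "r1 > 0" "\<And>z. z \<in> ball z0 r1 \<Longrightarrow> eval2 M s0 z \<noteq> 0"
  proof -
    have "open {z. eval2 M s0 z \<noteq> 0}" by (intro open_Collect_neq continuous_intros)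
    moreover have "z0 \<in> {z. eval2 M s0 z \<noteq> 0}" using \<mu>0 \<open>\<mu>0 \<noteq> 0\<close> by (simp add: M_def)
    ultimately obtain e where "e > 0" "ball z0 e \<subseteq> {z. eval2 M s0 z \<noteq> 0}" by (rule openE)
    then show ?thesis using that[of e] by blast
  qed
  obtain r2 where r2: "r2 > 0" "\<And>z. eval2 P s0 z = 0 \<Longrightarrow> z \<noteq> z0 \<Longrightarrow> r2 \<le> dist z0 z"
    using finite_set_avoid[OF finP[of s0], of z0] by auto
  define r where "r = min (min r1 r2) (min \<eta> \<rho>) / 3"
  have r: "r > 0" "2 * r < r1" "r < r2" "r < \<eta>" "r < \<rho>" using r1 r2 \<eta> \<rho> by (auto simp: r_def)
  obtain \<delta>1 where \<delta>1: "\<delta>1 > 0" "\<And>s z. s \<in> ball s0 \<delta>1 \<Longrightarrow> z \<in> cball z0 (2 * r) \<Longrightarrow> eval2 M s z \<noteq> 0"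
  proof (rule near_parameter[of "cball z0 (2 * r)" "{x. eval2 M (fst x) (snd x) \<noteq> 0}" s0])
    show "open {x. eval2 M (fst x) (snd x) \<noteq> 0}" by (intro open_Collect_neq contM continuous_intros)
  qed (use r1 r that in auto)
  have nzS: "eval2 P s0 z \<noteq> 0" if "z \<in> sphere z0 r" for z
    using r2(2)[of z] r that by auto
  obtain m where m: "m > 0" "\<And>z. z \<in> sphere z0 r \<Longrightarrow> m < norm (eval2 P s0 z)"
  proof -
    have "continuous_on (sphere z0 r) (\<lambda>z. norm (eval2 P s0 z))" by (intro continuous_intros)
    moreover have "sphere z0 r \<noteq> {}" using r by simp
    ultimately obtain y where y: "y \<in> sphere z0 r" "\<forall>z\<in>sphere z0 r. norm (eval2 P s0 y) \<le> norm (eval2 P s0 z)"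
      using continuous_attains_inf[OF compact_sphere] by metis
    have pos: "norm (eval2 P s0 y) > 0" using nzS[OF y(1)] by simp
    show ?thesis
    proof (rule that[of "norm (eval2 P s0 y) / 2"])
      fix z assume "z \<in> sphere z0 r"
      then have "norm (eval2 P s0 y) \<le> norm (eval2 P s0 z)" using y(2) by blast
      then show "norm (eval2 P s0 y) / 2 < norm (eval2 P s0 z)" using pos by linarith
    qed (use pos in simp)
  qed
  obtain \<delta>2 where \<delta>2: "\<delta>2 > 0" "\<And>s z. s \<in> ball s0 \<delta>2 \<Longrightarrow> z \<in> sphere z0 r \<Longrightarrow> m < norm (eval2 P s z)"
  proof (rule near_parameter[of "sphere z0 r" "{x. m < norm (eval2 P (fst x) (snd x))}" s0])
    show "open {x. m < norm (eval2 P (fst x) (snd x))}" by (intro open_Collect_less contM continuous_intros)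
  qed (use m that in auto)
  obtain \<delta>3 where \<delta>3: "\<delta>3 > 0" "\<And>s. s \<in> ball s0 \<delta>3 \<Longrightarrow> norm (eval2 P s z0) < m"
  proof (rule near_parameter[of "{z0}" "{x. norm (eval2 P (fst x) (snd x)) < m}" s0])
    show "open {x. norm (eval2 P (fst x) (snd x)) < m}" by (intro open_Collect_less contM continuous_intros)
  qed (use m that fp P in auto)
  define \<delta> where "\<delta> = min (min \<delta>1 \<delta>2) (min \<delta>3 \<eta>)"
  have \<delta>: "\<delta> > 0" using \<delta>1 \<delta>2 \<delta>3 \<eta> by (auto simp: \<delta>_def)
  have near: "s \<in> ball s0 \<delta>1" "s \<in> ball s0 \<delta>2" "s \<in> ball s0 \<delta>3" "s \<in> ball s0 \<eta>" if "s \<in> ball s0 \<delta>" for s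
    using that by (auto simp: \<delta>_def)
  \<comment> \<open>Without a zero, the maximum principle for \<open>1/P\<close> contradicts that \<open>|P|\<close> is smaller at \<open>z\<^sub>0\<close> than on the circle.\<close>
  have zero_ex: "\<exists>z\<in>ball z0 r. eval2 P s z = 0" if s: "s \<in> ball s0 \<delta>" for s
  proof (rule ccontr)
    assume neg: "\<not> (\<exists>z\<in>ball z0 r. eval2 P s z = 0)"
    have sph: "m < norm (eval2 P s z)" if "z \<in> sphere z0 r" for z using \<delta>2(2) near(2)[OF s] that by blast
    have nz: "eval2 P s z \<noteq> 0" if "z \<in> cball z0 r" for z
    proof (cases "z \<in> ball z0 r")
      case False
      then have "z \<in> sphere z0 r" using that by auto
      then show ?thesis using sph m(1) by force
    qed (use neg in blast)
    have "norm (inverse (eval2 P s z0)) \<le> inverse m"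
    proof (rule maximum_modulus_frontier[of "\<lambda>z. inverse (eval2 P s z)" "cball z0 r"])
      show "(\<lambda>z. inverse (eval2 P s z)) holomorphic_on interior (cball z0 r)"
        by (intro holomorphic_intros holomorphic_eval2) (use nz in auto)
      show "continuous_on (closure (cball z0 r)) (\<lambda>z. inverse (eval2 P s z))"
        by (intro continuous_intros) (use nz in auto)
      fix z assume "z \<in> frontier (cball z0 r)"
      then have "m < norm (eval2 P s z)" using sph by (simp add: frontier_cball)
      then show "norm (inverse (eval2 P s z)) \<le> inverse m"
        unfolding norm_inverse using m(1) by (intro le_imp_inverse_le) auto
    qed (use r in auto)
    then have "m \<le> norm (eval2 P s z0)"
      unfolding norm_inverse using m(1) nz[of z0] r by (subst (asm) inverse_le_iff_le) auto
    then show False using \<delta>3(2)[OF near(3)[OF s]] by simp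
  qed
  define W where "W = (\<lambda>s. {z \<in> ball z0 r. eval2 P s z = 0})"
  define H where "H = (\<lambda>s. \<Sum>z\<in>W s. (1 - \<mu>0 / eval2 M s z) * of_int (zorder (eval2 P s) z))"
  let ?I = "\<lambda>s. contour_integral (circlepath z0 r) (\<lambda>z. eval2 (pderiv P * (M - [:[:\<mu>0:]:])) s z / eval2 (M * P) s z)"
  have integral_H: "?I s
      = 2 * pi * \<i> * H s" if s: "s \<in> ball s0 \<delta>" for s
  proof -
    define r' where "r' = 2 * r"
    have r': "r' > r" "\<And>z. z \<in> ball z0 r' \<Longrightarrow> eval2 M s z \<noteq> 0"
      using r(1) \<delta>1(2)[OF near(1)[OF s]] by (auto simp: r'_def)
    let ?S = "ball z0 r'"
    let ?h = "\<lambda>z. 1 - \<mu>0 / eval2 M s z"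
    let ?Z = "{w \<in> ?S. eval2 P s w = 0 \<or> w \<in> {}}"
    have nzs: "eval2 P s z \<noteq> 0" if "z \<in> sphere z0 r" for z
      using \<delta>2(2)[OF near(2)[OF s] that] m(1) by auto
    have "contour_integral (circlepath z0 r) (\<lambda>x. deriv (eval2 P s) x * ?h x / eval2 P s x) =
       2 * pi * \<i> * (\<Sum>p\<in>?Z. winding_number (circlepath z0 r) p * ?h p * zorder (eval2 P s) p)"
    proof (rule argument_principle)
      show "eval2 P s holomorphic_on ?S - {}" by (rule holomorphic_eval2)
      show "?h holomorphic_on ?S" by (intro holomorphic_intros holomorphic_eval2) (use r' in auto)
      show "path_image (circlepath z0 r) \<subseteq> ?S - ?Z"
        using nzs r r' by auto
      show "\<forall>z. z \<notin> ?S \<longrightarrow> winding_number (circlepath z0 r) z = 0"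
        using r r' by (intro allI impI winding_number_zero_outside[of _ "cball z0 r"]) auto
      show "finite ?Z"
        by (rule finite_subset[OF _ finP[of s]]) auto
    qed auto
    also have "(\<Sum>p\<in>?Z. winding_number (circlepath z0 r) p * ?h p * zorder (eval2 P s) p)
       = H s"
      unfolding H_def
    proof (rule sum.mono_neutral_cong_right)
      show "finite ?Z"
        by (rule finite_subset[OF _ finP[of s]]) auto
      show "W s \<subseteq> ?Z" using r' by (auto simp: W_def)
      show "\<forall>p\<in>?Z - W s. winding_number (circlepath z0 r) p * ?h p * zorder (eval2 P s) p = 0"
      proof
        fix p assume p: "p \<in> ?Z - W s"
        then have "p \<notin> cball z0 r" using nzs by (force simp: W_def)
        then have "winding_number (circlepath z0 r) p = 0"
          using r by (intro winding_number_zero_outside[of _ "cball z0 r"]) auto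
        then show "winding_number (circlepath z0 r) p * ?h p * zorder (eval2 P s) p = 0" by simp
      qed
      show "winding_number (circlepath z0 r) p * ?h p * zorder (eval2 P s) p = ?h p * zorder (eval2 P s) p" if "p \<in> W s" for p
        using winding_number_circlepath[of p z0 r] that by (simp add: W_def dist_norm norm_minus_commute)
    qed
    also have "contour_integral (circlepath z0 r) (\<lambda>x. deriv (eval2 P s) x * ?h x / eval2 P s x)
       = ?I s"
    proof (rule contour_integral_cong[OF refl])
      fix x assume "x \<in> path_image (circlepath z0 r)"
      then have "x \<in> sphere z0 r" using r by simp
      then have "eval2 M s x \<noteq> 0" "eval2 P s x \<noteq> 0" using nzs r' r by auto
      then show "deriv (eval2 P s) x * ?h x / eval2 P s x = eval2 (pderiv P * (M - [:[:\<mu>0:]:])) s x / eval2 (M * P) s x"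
        by (simp add: deriv_eval2 field_simps)
    qed
    finally show ?thesis .
  qed
  have holH: "H holomorphic_on ball s0 \<delta>"
  proof -
    have "(\<lambda>s. ?I s) holomorphic_on ball s0 \<delta>"
    proof (rule holomorphic_contour_integral_eval2[OF _ r(1)])
      fix s z assume s: "s \<in> ball s0 \<delta>" and z: "z \<in> sphere z0 r"
      then show "eval2 (M * P) s z \<noteq> 0"
        using \<delta>2(2)[OF near(2)[OF s] z] m(1) \<delta>1(2)[OF near(1)[OF s], of z] by auto
    qed
    then have "(\<lambda>s. ?I s / (2 * pi * \<i>)) holomorphic_on ball s0 \<delta>"
      by (intro holomorphic_intros) auto
    then show ?thesis
    proof (rule holomorphic_transform)
      fix s assume s: "s \<in> ball s0 \<delta>"
      show "?I s / (2 * pi * \<i>) = H s"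
        unfolding integral_H[OF s] by simp
    qed
  qed
  have zo: "zorder (eval2 P s) z > 0" if "z \<in> W s" for s z
  proof -
    have "\<forall>\<^sub>F z in at z. eval2 P s z \<noteq> 0"
      using finite_set_avoid[OF finP[of s], of z] unfolding eventually_at by (fastforce simp: dist_commute)
    then have "\<exists>\<^sub>F z in at z. eval2 P s z \<noteq> 0" by (rule eventually_frequently[rotated]) simp
    then show ?thesis
      using zorder_pos_iff[OF holomorphic_eval2[of P s UNIV] open_UNIV UNIV_I] that by (simp add: W_def)
  qed
  have finW: "finite (W s)" for s by (rule finite_subset[OF _ finP[of s]]) (auto simp: W_def)
  have mult: "1 \<le> norm (eval2 M s z)" if "s \<in> ball s0 \<delta>" "z \<in> W s" for s z
    using nonattr[OF near(4)[OF that(1)], of z] that(2) r by (auto simp: W_def P M_def)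
  have small: "norm (\<mu>0 / eval2 M s z) \<le> 1" if "s \<in> ball s0 \<delta>" "z \<in> W s" for s z
    using mult[OF that] \<mu>0(2) by (simp add: norm_divide divide_le_eq_1)
  have Re_term: "0 \<le> Re ((1 - \<mu>0 / eval2 M s z) * of_int (zorder (eval2 P s) z))" if "s \<in> ball s0 \<delta>" "z \<in> W s" for s z
  proof -
    have "Re (\<mu>0 / eval2 M s z) \<le> 1" using small[OF that] complex_Re_le_cmod order_trans by blast
    then show ?thesis using zo[OF that(2)] by simp
  qed
  have ReH: "0 \<le> Re (H s)" if "s \<in> ball s0 \<delta>" for s
    unfolding H_def Re_sum using Re_term[OF that] by (intro sum_nonneg) auto
  have H0: "H s0 = 0"
  proof -
    have "z = z0" if "z \<in> W s0" for z
      using that r2(2)[of z] r by (force simp: W_def)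
    then show ?thesis unfolding H_def using \<mu>0 \<open>\<mu>0 \<noteq> 0\<close> by (intro sum.neutral) (auto simp: M_def)
  qed
  have Hzero: "H s = 0" if s: "s \<in> ball s0 \<delta>" for s
  proof (rule ccontr)
    assume "H s \<noteq> 0"
    then have "\<not> H constant_on ball s0 \<delta>" using s H0 \<delta> by (metis centre_in_ball constant_on_def)
    then have "open (H ` ball s0 \<delta>)"
      by (intro open_mapping_thm[OF holH]) auto
    moreover have "0 \<in> H ` ball s0 \<delta>" using H0 \<delta> by (metis centre_in_ball imageI)
    ultimately obtain e where e: "e > 0" "ball 0 e \<subseteq> H ` ball s0 \<delta>" using openE by blast
    have "- of_real (e/2) \<in> ball (0::complex) e" using e by simp
    then obtain s' where "s' \<in> ball s0 \<delta>" "H s' = - of_real (e/2)" using e(2) by (metis imageE subsetD)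
    then show False using ReH[of s'] e(1) by simp
  qed
  have "\<exists>z\<in>ball z0 \<rho>. eval2 A s z = z \<and> eval2 (pderiv A) s z = \<mu>0" if s: "s \<in> ball s0 \<delta>" for s
  proof -
    obtain z where z: "z \<in> W s" using zero_ex[OF s] by (auto simp: W_def)
    have sum0: "(\<Sum>z\<in>W s. Re ((1 - \<mu>0 / eval2 M s z) * of_int (zorder (eval2 P s) z))) = 0"
      using Hzero[OF s] unfolding H_def by (metis Re_sum zero_complex.sel(1))
    have "Re ((1 - \<mu>0 / eval2 M s z) * of_int (zorder (eval2 P s) z)) = 0"
      by (intro sum_nonneg_0[OF finW Re_term[OF s] sum0 z])
    then have re: "Re (\<mu>0 / eval2 M s z) = 1" using zo[OF z] by simp
    have "\<mu>0 / eval2 M s z = 1"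
    proof -
      have "(Re (\<mu>0 / eval2 M s z))\<^sup>2 + (Im (\<mu>0 / eval2 M s z))\<^sup>2 \<le> 1"
        unfolding cmod_power2[symmetric] using small[OF s z] by (intro power_le_one) auto
      then have "Im (\<mu>0 / eval2 M s z) = 0" unfolding re by simp
      then show ?thesis using re by (simp add: complex_eq_iff)
    qed
    then have "eval2 M s z = \<mu>0" by (auto simp: divide_eq_1_iff)
    then show ?thesis using z r by (intro bexI[of _ z]) (auto simp: W_def P M_def)
  qed
  then show ?thesis using that \<delta> by blast
qed

section \<open>Elimination\<close>

lemma resultant_zero_iff_common_root:
  fixes p q :: "complex poly"
  assumes "p \<noteq> 0"
  shows "resultant p q = 0 \<longleftrightarrow> (\<exists>z. poly p z = 0 \<and> poly q z = 0)"
proof -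
  have "degree (gcd p q) \<noteq> 0 \<longleftrightarrow> (\<exists>z. poly (gcd p q) z = 0)"
  proof
    assume "degree (gcd p q) \<noteq> 0"
    then show "\<exists>z. poly (gcd p q) z = 0"
      by (intro fundamental_theorem_of_algebra_alt) auto
  next
    assume "\<exists>z. poly (gcd p q) z = 0"
    then obtain z where "poly (gcd p q) z = 0" by blast
    moreover have "gcd p q \<noteq> 0" using assms by simp
    ultimately show "degree (gcd p q) \<noteq> 0" by (auto elim!: degree_eq_zeroE)
  qed
  moreover have "poly (gcd p q) z = 0 \<longleftrightarrow> poly p z = 0 \<and> poly q z = 0" for z
    unfolding poly_eq_0_iff_dvd by simp
  ultimately show ?thesis by (simp add: resultant_0_gcd)
qed

text \<open>
  The resultant with respect to \<open>z\<close> is a polynomial in the parameter. Where the leading coefficients do not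
  vanish, its zeros are exactly the parameters with a common root.
\<close>

lemma common_root_for_all_parameters:
  assumes A: "\<And>s. s \<noteq> 0 \<Longrightarrow> poly (lead_coeff A) s \<noteq> 0" and B: "\<And>s. s \<noteq> 0 \<Longrightarrow> poly (lead_coeff B) s \<noteq> 0"
    and I: "infinite I" "\<And>s. s \<in> I \<Longrightarrow> s \<noteq> 0 \<and> (\<exists>z. eval2 A s z = 0 \<and> eval2 B s z = 0)"
    and s: "s \<noteq> 0"
  shows "\<exists>z. eval2 A s z = 0 \<and> eval2 B s z = 0"
proof -
  have iff: "poly (resultant A B) s = 0 \<longleftrightarrow> (\<exists>z. eval2 A s z = 0 \<and> eval2 B s z = 0)" if "s \<noteq> 0" for s
  proof -
    have hom: "comm_ring_hom (\<lambda>a. poly a s)" by unfold_locales auto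
    have dA: "degree (map_poly (\<lambda>a. poly a s) A) = degree A"
      and dB: "degree (map_poly (\<lambda>a. poly a s) B) = degree B"
      using A[OF that] B[OF that] by (auto intro!: map_poly_degree_eq)
    have "map_poly (\<lambda>a. poly a s) A \<noteq> 0"
    proof
      assume "map_poly (\<lambda>a. poly a s) A = 0"
      then have "coeff (map_poly (\<lambda>a. poly a s) A) (degree A) = 0" by simp
      then show False using A[OF that] by (simp add: coeff_map_poly)
    qed
    then show ?thesis
      unfolding eval2_map_poly comm_ring_hom.resultant_map_poly[OF hom dA dB, symmetric]
      by (rule resultant_zero_iff_common_root)
  qed
  have "I \<subseteq> {s. poly (resultant A B) s = 0}" using I(2) iff by blast
  then have "resultant A B = 0" using I(1) poly_roots_finite finite_subset by blast
  then show ?thesis using iff[OF s] by simp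
qed

section \<open>The family of cubic Siegel polynomials\<close>

definition siegel_multiplier :: "real \<Rightarrow> complex" where
  "siegel_multiplier \<theta> = exp (2 * complex_of_real pi * \<i> * complex_of_real \<theta>)"

text \<open>
  The family is polynomial in the parameter \<open>s = 1/c\<close>. The coefficients are listed by powers of \<open>z\<close>, each
  as a polynomial in \<open>s\<close>.
\<close>

definition siegel_poly :: "real \<Rightarrow> complex poly poly" where
  "siegel_poly \<theta> = (let l = siegel_multiplier \<theta> in [:0, [:l:], [:- l/2, - l/2:], [:0, l/3:]:])"

primrec siegel_iterate :: "real \<Rightarrow> nat \<Rightarrow> complex poly poly" where
  "siegel_iterate \<theta> 0 = [:0, 1:]"
| "siegel_iterate \<theta> (Suc k) = pcompose (siegel_poly \<theta>) (siegel_iterate \<theta> k)"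

lemma norm_siegel_multiplier [simp]: "norm (siegel_multiplier \<theta>) = 1"
  by (simp add: siegel_multiplier_def)

lemma siegel_multiplier_nonzero [simp]: "siegel_multiplier \<theta> \<noteq> 0"
  by (simp add: siegel_multiplier_def)

lemma eval2_siegel_poly: "eval2 (siegel_poly \<theta>) s z = siegel_cubic \<theta> (inverse s) z"
  unfolding siegel_poly_def siegel_cubic_def Let_def siegel_multiplier_def[symmetric]
  by (simp add: field_simps power2_eq_square)

lemma eval2_siegel_iterate: "eval2 (siegel_iterate \<theta> k) s z = (siegel_cubic \<theta> (inverse s) ^^ k) z"
  by (induction k) (simp_all add: eval2_pcompose eval2_siegel_poly)

lemma siegel_multiplier_not_root_of_unity:
  assumes "\<theta> \<notin> \<rat>" "k > 0"
  shows "siegel_multiplier \<theta> ^ k \<noteq> 1"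
proof
  assume "siegel_multiplier \<theta> ^ k = 1"
  then have "exp (of_nat k * (2 * complex_of_real pi * \<i> * complex_of_real \<theta>)) = 1"
    by (simp add: siegel_multiplier_def exp_of_nat_mult)
  then obtain n :: int where "Im (of_nat k * (2 * complex_of_real pi * \<i> * complex_of_real \<theta>)) = of_int (2 * n) * pi"
    unfolding exp_eq_1 by blast
  then have "real k * \<theta> = of_int n" by simp
  then have "\<theta> = of_int n / of_nat k" using assms(2) by (simp add: field_simps)
  then show False using assms(1) by (metis Rats_divide Rats_of_int Rats_of_nat)
qed

text \<open>
  The leading coefficient is a power of \<open>s\<close> times a constant, so the degree in \<open>z\<close> is the same for all \<open>s \<noteq> 0\<close>.
\<close>

lemma siegel_iterate_degree:
  "degree (siegel_iterate \<theta> k) = 3 ^ k" "s \<noteq> 0 \<Longrightarrow> poly (lead_coeff (siegel_iterate \<theta> k)) s \<noteq> 0"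
proof (induction k)
  case (Suc k)
  have d3: "degree (siegel_poly \<theta>) = 3" by (simp add: siegel_poly_def Let_def)
  have l3: "lead_coeff (siegel_poly \<theta>) = [:0, siegel_multiplier \<theta> / 3:]"
    by (simp add: siegel_poly_def Let_def)
  show 1: "degree (siegel_iterate \<theta> (Suc k)) = 3 ^ Suc k"
    using Suc(1) d3 by (simp add: degree_pcompose)
  show "poly (lead_coeff (siegel_iterate \<theta> (Suc k))) s \<noteq> 0" if s: "s \<noteq> 0"
  proof -
    have "lead_coeff (siegel_iterate \<theta> (Suc k)) = lead_coeff (siegel_poly \<theta>) * lead_coeff (siegel_iterate \<theta> k) ^ 3"
      using lead_coeff_comp[of "siegel_iterate \<theta> k" "siegel_poly \<theta>"] Suc(1) d3 by simp
    then show ?thesis using Suc(2)[OF s] s l3 by simp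
  qed
qed simp_all

lemma siegel_iterate_0: "poly (siegel_iterate \<theta> k) 0 = 0"
  by (induction k) (simp_all add: poly_pcompose siegel_poly_def Let_def)

lemma siegel_iterate_multiplier_0: "eval2 (pderiv (siegel_iterate \<theta> k)) s 0 = siegel_multiplier \<theta> ^ k"
proof (induction k)
  case (Suc k)
  have "eval2 (siegel_iterate \<theta> k) s 0 = 0" using siegel_iterate_0[of \<theta> k] by (simp add: eval2_def)
  then show ?case using Suc
    by (simp add: pderiv_pcompose eval2_pcompose) (simp add: siegel_poly_def Let_def pderiv_pCons)
qed (simp add: pderiv_pCons)

text \<open>
  The fixed point 0, which has the same multiplier for all parameters, must be split off first: \<open>A\<close> is the
  iterate minus \<open>z\<close>, divided by \<open>z\<close>. Since \<open>\<lambda>\<close> is not a root of unity, 0 is not a root of \<open>A\<close>, so a common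
  root of \<open>A\<close> and of the multiplier equation \<open>B\<close> is nonzero.
\<close>

lemma persistent_cycle_for_all_parameters:
  assumes irr: "\<theta> \<notin> \<rat>" and k: "k > 0"
    and I: "infinite I" "\<And>s. s \<in> I \<Longrightarrow> s \<noteq> 0 \<and> (\<exists>z. z \<noteq> 0 \<and> eval2 (siegel_iterate \<theta> k) s z = z \<and>
         eval2 (pderiv (siegel_iterate \<theta> k)) s z = \<mu>0)"
    and s: "s \<noteq> 0"
  shows "\<exists>z. z \<noteq> 0 \<and> eval2 (siegel_iterate \<theta> k) s z = z \<and> eval2 (pderiv (siegel_iterate \<theta> k)) s z = \<mu>0"
proof -
  let ?P = "siegel_iterate \<theta> k"
  have deg: "degree ?P = 3 ^ k" "3 \<le> (3::nat) ^ k"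
    using siegel_iterate_degree k self_le_power[of "3::nat" k] by auto
  obtain a A where aA: "?P - [:0, 1:] = pCons a A" by (metis pCons_cases)
  have "a = 0" using siegel_iterate_0[of \<theta> k] arg_cong[OF aA, of "\<lambda>p. poly p 0"] by simp
  then have A: "?P - [:0, 1:] = pCons 0 A" using aA by simp
  have evA: "z * eval2 A s z = eval2 ?P s z - z" for s z
    using arg_cong[OF A, of "\<lambda>p. eval2 p s z"] by simp
  have evA': "eval2 A s 0 = eval2 (pderiv ?P) s 0 - 1" for s
    using arg_cong[OF A, of "\<lambda>p. eval2 (pderiv p) s 0"] by (simp add: pderiv_diff pderiv_pCons)
  have lt: "degree [:0, 1 :: complex poly:] < degree ?P" using deg by simp
  have dP: "degree (?P - [:0,1:]) = degree ?P" "lead_coeff (?P - [:0,1:]) = lead_coeff ?P"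
  proof -
    show d: "degree (?P - [:0,1:]) = degree ?P"
      using degree_add_eq_left[of "- [:0,1:]" ?P] lt by (simp only: diff_conv_add_uminus degree_minus)
    show "lead_coeff (?P - [:0,1:]) = lead_coeff ?P"
      unfolding d coeff_diff using coeff_eq_0[OF lt] by simp
  qed
  then have "A \<noteq> 0" using A deg by auto
  then have lA: "lead_coeff A = lead_coeff ?P" using dP(2) unfolding A by simp
  define B where "B = pderiv ?P - [:[:\<mu>0:]:]"
  have evB: "eval2 B s z = eval2 (pderiv ?P) s z - \<mu>0" for s z by (simp add: B_def)
  have lB: "lead_coeff B = of_nat (3 ^ k) * lead_coeff ?P"
  proof -
    have d: "degree (pderiv ?P) = 3 ^ k - 1" "lead_coeff (pderiv ?P) = of_nat (3 ^ k) * lead_coeff ?P"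
      using deg by (simp_all add: degree_pderiv coeff_pderiv)
    have "B = - [:[:\<mu>0:]:] + pderiv ?P" by (simp add: B_def)
    then show ?thesis using lead_coeff_add_le[of "- [:[:\<mu>0:]:]" "pderiv ?P"] d deg by simp
  qed
  have nz0: "eval2 A s 0 \<noteq> 0" for s
    using evA'[of s] siegel_multiplier_not_root_of_unity[OF irr k] by (simp add: siegel_iterate_multiplier_0)
  have "\<exists>z. eval2 A s z = 0 \<and> eval2 B s z = 0"
  proof (rule common_root_for_all_parameters[OF _ _ I(1) _ s])
    show "poly (lead_coeff A) s \<noteq> 0" if "s \<noteq> 0" for s using siegel_iterate_degree(2)[OF that] lA by simp
    show "poly (lead_coeff B) s \<noteq> 0" if "s \<noteq> 0" for s using siegel_iterate_degree(2)[OF that] lB by simp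
    show "s \<noteq> 0 \<and> (\<exists>z. eval2 A s z = 0 \<and> eval2 B s z = 0)" if s: "s \<in> I" for s
    proof -
      obtain z where "z \<noteq> 0" "eval2 ?P s z = z" "eval2 (pderiv ?P) s z = \<mu>0" using I(2)[OF s] by blast
      then show ?thesis using I(2)[OF s] evA[of z s] evB[of s z] by auto
    qed
  qed
  then obtain z where z: "eval2 A s z = 0" "eval2 B s z = 0" by blast
  then have "z \<noteq> 0" using nz0 by auto
  then show ?thesis using z evA[of z s] evB[of s z] by auto
qed

lemma siegel_cubic_eq:
  "siegel_cubic \<theta> c z = siegel_multiplier \<theta> * z * (1 - 1/2 * (1 + 1/c) * z + 1/(3*c) * z\<^sup>2)"
  by (simp add: siegel_cubic_def siegel_multiplier_def)

lemma has_field_derivative_siegel_cubic: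
  assumes "c \<noteq> 0"
  shows "(siegel_cubic \<theta> c has_field_derivative siegel_multiplier \<theta> / c * (z - 1) * (z - c)) (at z)"
proof -
  define l t where "l = siegel_multiplier \<theta>" and "t = inverse c"
  have tc: "t * c = 1" using assms by (simp add: t_def)
  have "(eval2 (siegel_poly \<theta>) t has_field_derivative eval2 (pderiv (siegel_poly \<theta>)) t z) (at z)"
    by (rule has_field_derivative_eval2)
  moreover have "eval2 (siegel_poly \<theta>) t = siegel_cubic \<theta> c"
    by (rule ext) (simp add: eval2_siegel_poly t_def)
  moreover have "eval2 (pderiv (siegel_poly \<theta>)) t z = l * (1 - (1 + t) * z + t * z * z)"
    by (simp add: siegel_poly_def Let_def pderiv_pCons l_def algebra_simps)
  moreover have "1 - (1 + t) * z + t * z * z = t * (z - 1) * (z - c)"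
  proof -
    have "t * (z - 1) * (z - c) = t * z * z - t * z - (t * c) * z + t * c" by (simp add: algebra_simps)
    then show ?thesis unfolding tc by (simp add: algebra_simps)
  qed
  moreover have "siegel_multiplier \<theta> / c = l * t" by (simp add: l_def t_def divide_inverse)
  ultimately show ?thesis by (simp only: mult.assoc)
qed

lemma deriv_siegel_cubic:
  "c \<noteq> 0 \<Longrightarrow> deriv (siegel_cubic \<theta> c) z = siegel_multiplier \<theta> / c * (z - 1) * (z - c)"
  by (rule DERIV_imp_deriv[OF has_field_derivative_siegel_cubic])

text \<open>
  For \<open>|z| \<ge> 6(1 + |c|)\<close> the quadratic term of \<open>P\<^sub>c(z)/(\<lambda>z)\<close> is at least four times as large as the linear
  one, and their difference exceeds 3.
\<close>

lemma siegel_expanding: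
  assumes c: "c \<noteq> 0"
  shows "expanding_at_infinity (siegel_cubic \<theta> c) (6 * (1 + norm c))"
proof
  show "siegel_cubic \<theta> c holomorphic_on UNIV"
    using has_field_derivative_siegel_cubic[OF c] by (metis holomorphic_onI field_differentiable_def field_differentiable_at_within)
  show "0 < 6 * (1 + norm c)" by (simp add: add_pos_nonneg)
  show "siegel_cubic \<theta> c 0 = 0" by (simp add: siegel_cubic_def)
  fix z :: complex assume z: "6 * (1 + norm c) \<le> norm z"
  define x where "x = norm z"
  define s where "s = 1 / norm c"
  have s: "s > 0" "norm c = 1 / s" using c by (auto simp: s_def)
  have x: "6 * (1 + 1 / s) \<le> x" using z s by (simp add: x_def)
  have x6: "6 \<le> x"
  proof -
    have "6 * 1 \<le> 6 * (1 + 1 / s)" using s by (intro mult_left_mono) auto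
    then have "6 \<le> 6 * (1 + 1 / s)" by simp
    then show ?thesis using x by (rule order_trans)
  qed
  have sx: "6 * (s + 1) \<le> s * x"
  proof -
    have "s * (6 * (1 + 1 / s)) \<le> s * x" using x s by (intro mult_left_mono) auto
    moreover have "s * (6 * (1 + 1 / s)) = 6 * (s + 1)" using s by (simp add: distrib_left)
    ultimately show ?thesis by simp
  qed
  have "6 * (s + 1) * x \<le> s * x * x" using sx x6 by (intro mult_right_mono) auto
  then have 1: "2 * ((1 + s) * x) \<le> s * x\<^sup>2 / 3" by (simp add: power2_eq_square algebra_simps)
  have "1 * x \<le> (1 + s) * x" using x6 s by (intro mult_right_mono) auto
  then have 2: "6 \<le> (1 + s) * x" using x6 by linarith
  have "norm (1 / (3*c) * z\<^sup>2) - norm (1/2 * (1 + 1/c) * z) - norm (1::complex)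
      \<le> norm (1 / (3*c) * z\<^sup>2 - 1/2 * (1 + 1/c) * z + 1)"
    using norm_diff_ineq[of "1 / (3*c) * z\<^sup>2 - 1/2 * (1 + 1/c) * z" 1]
      norm_triangle_ineq2[of "1 / (3*c) * z\<^sup>2" "1/2 * (1 + 1/c) * z"] by linarith
  moreover have "norm (1 / (3*c) * z\<^sup>2) = s * x\<^sup>2 / 3"
    by (simp add: norm_mult norm_divide norm_power s_def x_def)
  moreover have "norm (1/2 * (1 + 1/c) * z) \<le> (1 + s) * x / 2"
  proof -
    have "norm (1 + 1/c) \<le> 1 + s" using norm_triangle_ineq[of 1 "1/c"] by (simp add: s_def norm_divide)
    then have "norm (1 + 1/c) * x \<le> (1 + s) * x" by (rule mult_right_mono) (simp add: x_def)
    then show ?thesis by (simp add: norm_mult x_def)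
  qed
  ultimately have "2 \<le> norm (1 / (3*c) * z\<^sup>2 - 1/2 * (1 + 1/c) * z + 1)"
    using 1 2 by simp
  also have "\<dots> = norm (1 - 1/2 * (1 + 1/c) * z + 1/(3*c) * z\<^sup>2)" by (simp add: algebra_simps)
  finally have "2 * norm z \<le> norm (1 - 1/2 * (1 + 1/c) * z + 1/(3*c) * z\<^sup>2) * norm z"
    by (rule mult_right_mono) simp
  then show "2 * norm z \<le> norm (siegel_cubic \<theta> c z)"
    by (simp add: siegel_cubic_eq norm_mult mult.commute)
qed

lemma siegel_cubic_diff_critical:
  assumes "c \<noteq> 0"
  shows "siegel_cubic \<theta> c z - siegel_cubic \<theta> c 1 = siegel_multiplier \<theta> / (6 * c) * (z - 1)\<^sup>2 * (2 * z - (3 * c - 1))"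
    and "siegel_cubic \<theta> c z - siegel_cubic \<theta> c c = siegel_multiplier \<theta> / (6 * c) * (z - c)\<^sup>2 * (2 * z - (3 - c))"
proof -
  define t where "t = 1 / c"
  define l where "l = siegel_multiplier \<theta>"
  have tc: "t * c = 1" using assms by (simp add: t_def)
  have f: "siegel_cubic \<theta> c u = l / 6 * (6 * u + t * (2 * u ^ 3 - 3 * u\<^sup>2) - 3 * u\<^sup>2)" for u
  proof -
    have "siegel_cubic \<theta> c u = eval2 (siegel_poly \<theta>) t u" by (simp add: eval2_siegel_poly t_def divide_inverse)
    then show ?thesis
      by (simp add: siegel_poly_def Let_def l_def power2_eq_square power3_eq_cube algebra_simps)
  qed
  have k: "siegel_multiplier \<theta> / (6 * c) = l / 6 * t" by (simp add: l_def t_def)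
  have p1: "(6 * z + t * (2 * z ^ 3 - 3 * z ^ 2) - 3 * z ^ 2) - (6 * 1 + t * (2 * 1 ^ 3 - 3 * 1 ^ 2) - 3 * 1 ^ 2)
     = t * (z - 1)\<^sup>2 * (2 * z - (3 * c - 1))"
  proof -
    have "t * (z - 1)\<^sup>2 * (2 * z - (3 * c - 1)) = t * (z - 1)\<^sup>2 * (2 * z + 1) - 3 * (t * c) * (z - 1)\<^sup>2"
      by (simp add: algebra_simps)
    then show ?thesis unfolding tc by (simp add: power2_eq_square power3_eq_cube algebra_simps)
  qed
  have p2: "(6 * z + t * (2 * z ^ 3 - 3 * z ^ 2) - 3 * z ^ 2) - (6 * c + t * (2 * c ^ 3 - 3 * c ^ 2) - 3 * c ^ 2)
     = t * (z - c)\<^sup>2 * (2 * z - (3 - c))"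
  proof -
    have t2: "t * c\<^sup>2 = c" and t3: "t * c ^ 3 = c\<^sup>2"
      using tc by (simp_all add: power2_eq_square power3_eq_cube mult.assoc[symmetric])
    have "t * (z - c)\<^sup>2 * (2 * z - (3 - c)) = t * (2 * z ^ 3 - 3 * z\<^sup>2) - 3 * (t * c) * z\<^sup>2
        + 6 * (t * c) * z - 3 * (t * c\<^sup>2) + t * c ^ 3"
      by (simp add: power2_eq_square power3_eq_cube algebra_simps)
    moreover have "t * (2 * c ^ 3 - 3 * c\<^sup>2) = 2 * (t * c ^ 3) - 3 * (t * c\<^sup>2)"
      by (simp add: algebra_simps)
    ultimately show ?thesis unfolding tc t2 t3 by simp
  qed
  show "siegel_cubic \<theta> c z - siegel_cubic \<theta> c 1 = siegel_multiplier \<theta> / (6 * c) * (z - 1)\<^sup>2 * (2 * z - (3 * c - 1))"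
    unfolding f k right_diff_distrib[symmetric] p1 by (simp only: mult.assoc)
  show "siegel_cubic \<theta> c z - siegel_cubic \<theta> c c = siegel_multiplier \<theta> / (6 * c) * (z - c)\<^sup>2 * (2 * z - (3 - c))"
    unfolding f k right_diff_distrib[symmetric] p2 by (simp only: mult.assoc)
qed

lemma siegel_fibres:
  assumes "c \<noteq> 0"
  shows "siegel_cubic \<theta> c z = siegel_cubic \<theta> c 1 \<longleftrightarrow> z = 1 \<or> z = (3 * c - 1) / 2"
    and "siegel_cubic \<theta> c z = siegel_cubic \<theta> c c \<longleftrightarrow> z = c \<or> z = (3 - c) / 2"
proof -
  have half: "2 * z - w = 0 \<longleftrightarrow> z = w / 2" for w :: complex by (auto simp: field_simps)
  show "siegel_cubic \<theta> c z = siegel_cubic \<theta> c 1 \<longleftrightarrow> z = 1 \<or> z = (3 * c - 1) / 2"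
    unfolding eq_iff_diff_eq_0[of "siegel_cubic \<theta> c z"] siegel_cubic_diff_critical[OF assms]
      mult_eq_0_iff half using assms by simp
  show "siegel_cubic \<theta> c z = siegel_cubic \<theta> c c \<longleftrightarrow> z = c \<or> z = (3 - c) / 2"
    unfolding eq_iff_diff_eq_0[of "siegel_cubic \<theta> c z"] siegel_cubic_diff_critical[OF assms]
      mult_eq_0_iff half using assms by simp
qed

text \<open>
  The remaining preimages of the two critical values are \<open>(3c - 1)/2\<close> and \<open>(3 - c)/2\<close>; they coincide with the
  critical points only for \<open>c = 1\<close>.
\<close>

lemma connected_julia_siegel_iff:
  assumes c: "c \<noteq> 0"
  shows "connected (julia (siegel_cubic \<theta> c)) \<longleftrightarrow>
     1 \<in> filled_julia (siegel_cubic \<theta> c) \<and> c \<in> filled_julia (siegel_cubic \<theta> c)"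
proof -
  let ?f = "siegel_cubic \<theta> c"
  interpret expanding_at_infinity "?f" "6 * (1 + norm c)" by (rule siegel_expanding[OF c])
  have crit: "deriv (?f) 1 = 0" "deriv (?f) c = 0"
    using deriv_siegel_cubic[OF c] by auto
  show ?thesis
  proof
    assume "connected (julia (?f))"
    then show "1 \<in> filled_julia (?f) \<and> c \<in> filled_julia (?f)"
      using connected_julia_imp_critical_bounded crit by blast
  next
    assume K: "1 \<in> filled_julia (?f) \<and> c \<in> filled_julia (?f)"
    show "connected (julia (?f))"
    proof (rule connected_julia_if_connected_sublevels,
        rule critical_bounded_imp_connected_sublevel[where a = 1 and b = c and a' = "(3 * c - 1) / 2" and b' = "(3 - c) / 2"])
      show "?f ((3 * c - 1) / 2) = ?f 1" by (rule iffD2[OF siegel_fibres(1)[OF c]]) simp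
      show "1 = c \<Longrightarrow> (3 * c - 1) / 2 = 1" by auto
      show "?f 1 \<noteq> ?f c" if "1 \<noteq> c"
      proof
        assume "?f 1 = ?f c"
        then have "c = 1 \<or> c = (3 * c - 1) / 2" by (intro iffD1[OF siegel_fibres(1)[OF c, of \<theta> c]]) (rule sym)
        then show False using that by (auto simp: field_simps)
      qed
      show "?f z = ?f 1 \<Longrightarrow> z = 1 \<or> z = (3 * c - 1) / 2" for z
        by (rule iffD1[OF siegel_fibres(1)[OF c]])
      show "?f z = ?f c \<Longrightarrow> z = c \<or> z = (3 - c) / 2" for z
        by (rule iffD1[OF siegel_fibres(2)[OF c]])
    qed (fact crit conjunct1[OF K] conjunct2[OF K])+
  qed
qed

lemma siegel_indifferent_imp_critical_bounded:
  assumes c: "c \<noteq> 0" and k: "k > 0" "(siegel_cubic \<theta> c ^^ k) z = z" "norm (deriv (siegel_cubic \<theta> c ^^ k) z) = 1"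
    and z: "z \<noteq> 0"
  shows "1 \<in> filled_julia (siegel_cubic \<theta> c)" "c \<in> filled_julia (siegel_cubic \<theta> c)"
proof -
  let ?f = "siegel_cubic \<theta> c"
  interpret expanding_at_infinity "?f" "6 * (1 + norm c)" by (rule siegel_expanding[OF c])
  have d0: "norm (deriv (?f) 0) = 1"
    unfolding deriv_siegel_cubic[OF c] using c by (simp add: norm_divide norm_mult)
  have \<kappa>: "siegel_multiplier \<theta> / c \<noteq> 0" using c by simp
  show "c \<in> filled_julia (?f)"
    using indifferent_cycle_unique_if_critical_escapes[OF deriv_siegel_cubic[OF c] \<kappa> _ d0 k] z by blast
  have d: "deriv (?f) z = siegel_multiplier \<theta> / c * (z - c) * (z - 1)" for z
    unfolding deriv_siegel_cubic[OF c] by (simp add: mult.assoc mult.commute[of "z - 1"])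
  show "1 \<in> filled_julia (?f)"
    using indifferent_cycle_unique_if_critical_escapes[OF d \<kappa> _ d0 k] z by blast
qed

text \<open>
  Each of the two critical points escapes for some parameter: when \<open>c\<close> is very small or very large,
  the image of one of them already lies outside the escape radius.
\<close>

lemma critical_point_1_escapes: "1 \<notin> filled_julia (siegel_cubic \<theta> (- 1/100))"
proof -
  interpret expanding_at_infinity "siegel_cubic \<theta> (-1/100)" "6 * (1 + norm (-1/100 :: complex))"
    by (rule siegel_expanding) simp
  have "siegel_cubic \<theta> (-1/100) 1 = siegel_multiplier \<theta> * of_real (103/6)"
    by (simp add: siegel_cubic_eq)
  then have "norm (siegel_cubic \<theta> (-1/100) 1) = 103/6" by (simp only: norm_mult norm_of_real) simp
  then have "\<not> norm ((siegel_cubic \<theta> (-1/100) ^^ 1) 1) \<le> 6 * (1 + norm (-1/100 :: complex))"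
    by (simp add: norm_divide)
  then show ?thesis unfolding filled_julia_eq by blast
qed

lemma critical_point_c_escapes: "- 100 \<notin> filled_julia (siegel_cubic \<theta> (- 100))"
proof -
  interpret expanding_at_infinity "siegel_cubic \<theta> (-100)" "6 * (1 + norm (-100 :: complex))"
    by (rule siegel_expanding) simp
  have "siegel_cubic \<theta> (-100) (-100) = siegel_multiplier \<theta> * of_real (- 5150/3)"
    by (simp add: siegel_cubic_eq)
  then have "norm (siegel_cubic \<theta> (-100) (-100)) = 5150/3" by (simp only: norm_mult norm_of_real) simp
  then have "\<not> norm ((siegel_cubic \<theta> (-100) ^^ 1) (-100)) \<le> 6 * (1 + norm (-100 :: complex))"
    by simp
  then show ?thesis unfolding filled_julia_eq by blast
qed

section \<open>Attracting cycles persist inside the connectedness locus\<close>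

lemma (in expanding_at_infinity) attracting_cycle_attracts_critical:
  assumes k: "k > 0" "(f ^^ k) x = x" "norm (deriv (f ^^ k) x) < 1"
  obtains w j where "deriv f w = 0" "(\<lambda>n. (f ^^ (k * n + j)) w) \<longlonglongrightarrow> x"
proof -
  have "(f ^^ i) x \<in> sublevel (Suc 0)" for i
  proof -
    have orbit: "(f ^^ n) ((f ^^ i) x) \<in> (\<lambda>i. (f ^^ i) x) ` {..<k}" for n
    proof -
      have "(f ^^ n) ((f ^^ i) x) = (f ^^ (k * ((n + i) div k) + (n + i) mod k)) x"
        by (simp add: funpow_add)
      also have "\<dots> = (f ^^ ((n + i) mod k)) x" by (rule funpow_period(2)[OF k(2)])
      finally show ?thesis using k(1) by auto
    qed
    have "bounded (range (\<lambda>n. (f ^^ n) ((f ^^ i) x)))"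
      by (rule bounded_subset[OF finite_imp_bounded, of "(\<lambda>i. (f ^^ i) x) ` {..<k}"]) (use orbit in auto)
    then have "(f ^^ i) x \<in> filled_julia f" by (simp add: filled_julia_def)
    then show ?thesis using filled_julia_sublevel by blast
  qed
  moreover have "sublevel (Suc 0) \<subseteq> sublevel 0"
    using escape_mono[of "Suc 0" _ 0] by (auto intro: less_imp_le)
  ultimately show ?thesis
    using attracting_cycle_attracts_critical_point[OF entire proper_sublevel[of 0] _ bounded_sublevel _ k] that
    by metis
qed

lemma holomorphic_on_eval2:
  assumes "g holomorphic_on S" "h holomorphic_on S"
  shows "(\<lambda>s. eval2 A (g s) (h s)) holomorphic_on S"
proof (induction A)
  case (pCons a A)
  have "(\<lambda>s. poly a (g s)) holomorphic_on S"
    by (induction a) (auto intro!: holomorphic_intros assms)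
  then show ?case using pCons by (auto intro!: holomorphic_intros assms)
qed simp

text \<open>
  This is Vitali's theorem. By Montel's theorem, a subsequence that stayed away from the limit \<open>y\<close> at some point would have
  a further subsequence with a holomorphic limit; that limit agrees with \<open>y\<close> on \<open>T\<close>, hence everywhere.
\<close>

lemma pointwise_convergence_of_bounded_sequence:
  assumes S: "open S" "connected S" and G: "\<And>n. G n holomorphic_on S"
    and bd: "\<And>n s. s \<in> S \<Longrightarrow> norm (G n s) \<le> B"
    and T: "open T" "T \<noteq> {}" "T \<subseteq> S" and conv: "\<And>s. s \<in> T \<Longrightarrow> (\<lambda>n. G n s) \<longlonglongrightarrow> p s"
  obtains y where "y holomorphic_on S" "\<And>s. s \<in> S \<Longrightarrow> (\<lambda>n. G n s) \<longlonglongrightarrow> (y s :: complex)"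
proof -
  have sub: "\<exists>g r. g holomorphic_on S \<and> strict_mono (r :: nat \<Rightarrow> nat) \<and> (\<forall>s\<in>S. (\<lambda>n. G (q (r n)) s) \<longlonglongrightarrow> g s)" for q
  proof -
    obtain g r where "g holomorphic_on S" "strict_mono (r :: nat \<Rightarrow> nat)"
         "\<And>s. s \<in> S \<Longrightarrow> ((\<lambda>n. (\<lambda>n. G (q n)) (r n) s) \<longlongrightarrow> g s) sequentially"
    proof (rule Montel[OF S(1), of "range G" "\<lambda>n. G (q n)"])
      show "\<exists>B. \<forall>h\<in>range G. \<forall>z\<in>K. norm (h z) \<le> B" if "K \<subseteq> S" for K
        using bd that by blast
    qed (use G in auto)
    then show ?thesis by blast
  qed
  obtain y r where y: "y holomorphic_on S" "strict_mono (r :: nat \<Rightarrow> nat)" "\<And>s. s \<in> S \<Longrightarrow> (\<lambda>n. G (r n) s) \<longlonglongrightarrow> y s"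
    using sub[of "\<lambda>n. n"] by auto
  have yT: "y s = p s" if "s \<in> T" for s
  proof -
    have "s \<in> S" using that T(3) by blast
    then show ?thesis
      using LIMSEQ_unique[OF y(3) LIMSEQ_subseq_LIMSEQ[OF conv[OF that] y(2), unfolded o_def]] by simp
  qed
  show ?thesis
  proof (rule that[OF y(1)])
    fix s assume s: "s \<in> S"
    show "(\<lambda>n. G n s) \<longlonglongrightarrow> y s"
    proof (rule ccontr)
      assume "\<not> (\<lambda>n. G n s) \<longlonglongrightarrow> y s"
      then obtain e where e: "e > 0" "\<forall>N. \<exists>n\<ge>N. e \<le> dist (G n s) (y s)"
        unfolding lim_sequentially by (auto simp: not_less)
      then have "\<exists>\<^sub>\<infinity>n. e \<le> dist (G n s) (y s)" unfolding INFM_nat_le by blast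
      then have inf: "infinite {n. e \<le> dist (G n s) (y s)}" by (simp add: frequently_cofinite)
      define q where "q = enumerate {n. e \<le> dist (G n s) (y s)}"
      have q: "strict_mono q" "\<And>n. e \<le> dist (G (q n) s) (y s)"
        using strict_mono_enumerate[OF inf] enumerate_in_set[OF inf] by (auto simp: q_def)
      obtain y' r' where y': "y' holomorphic_on S" "strict_mono (r' :: nat \<Rightarrow> nat)" 
          "\<And>s. s \<in> S \<Longrightarrow> (\<lambda>n. G (q (r' n)) s) \<longlonglongrightarrow> y' s"
        using sub[of q] by blast
      have eqT: "y' s = y s" if "s \<in> T" for s
      proof -
        have "strict_mono (\<lambda>n. q (r' n))" using q(1) y'(2) by (simp add: strict_mono_def)
        then have "(\<lambda>n. G (q (r' n)) s) \<longlonglongrightarrow> p s"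
          using LIMSEQ_subseq_LIMSEQ[OF conv[OF that], of "\<lambda>n. q (r' n)"] by (simp add: o_def)
        moreover have "s \<in> S" using that T(3) by blast
        ultimately show ?thesis using LIMSEQ_unique[OF y'(3)] yT[OF that] by metis
      qed
      have "y' s = y s"
        by (rule analytic_continuation_open[OF T(1) S(1) T(2) S(2) T(3) y'(1) y(1) eqT s])
      then have "(\<lambda>n. dist (G (q (r' n)) s) (y s)) \<longlonglongrightarrow> 0"
        using iffD1[OF tendsto_dist_iff y'(3)[OF s]] by simp
      then have "e \<le> 0" by (rule LIMSEQ_le_const) (use q(2) in auto)
      then show False using e(1) by simp
    qed
  qed
qed

text \<open>
  For parameters near \<open>s\<^sub>1\<close> the map is a contraction of one fixed disc around \<open>z\<^sub>1\<close>, and the sequence \<open>G\<close> has entered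
  this disc after a number of steps that does not depend on the parameter.
\<close>

lemma attracting_fixed_point_persists:
  assumes fp: "eval2 A s1 z1 = z1" and attr: "norm (eval2 (pderiv A) s1 z1) < 1"
    and G: "\<And>n s. G (Suc n) s = eval2 A s (G n s)" and lim: "(\<lambda>n. G n s1) \<longlonglongrightarrow> z1"
    and cont: "\<And>n. isCont (G n) s1"
  obtains \<delta> p where "\<delta> > 0" "\<And>s. s \<in> ball s1 \<delta> \<Longrightarrow> (\<lambda>n. G n s) \<longlonglongrightarrow> p s"
    "\<And>s. s \<in> ball s1 \<delta> \<Longrightarrow> eval2 A s (p s) = p s"
proof -
  define \<kappa> where "\<kappa> = (norm (eval2 (pderiv A) s1 z1) + 1) / 2"
  have \<kappa>: "norm (eval2 (pderiv A) s1 z1) < \<kappa>" "0 < \<kappa>" "\<kappa> < 1" 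
    using attr by (auto simp: \<kappa>_def add_nonneg_pos)
  have contE: "continuous_on UNIV (\<lambda>x. eval2 B (fst x) (snd x))" for B
    by (intro continuous_intros)
  have "open {x. norm (eval2 (pderiv A) (fst x) (snd x)) < \<kappa>}"
    by (intro open_Collect_less contE continuous_intros)
  then obtain d where d: "d > 0" "ball (s1, z1) d \<subseteq> {x. norm (eval2 (pderiv A) (fst x) (snd x)) < \<kappa>}"
    using \<kappa>(1) openE[of _ "(s1, z1)"] by (metis (mono_tags, lifting) fst_conv mem_Collect_eq snd_conv)
  define r where "r = d / 2"
  have r: "r > 0" using d by (simp add: r_def)
  have small: "norm (eval2 (pderiv A) s z) \<le> \<kappa>" if "s \<in> ball s1 r" "z \<in> cball z1 (r/2)" for s z
  proof -
    have "dist (s1, z1) (s, z) \<le> dist s1 s + dist z1 z"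
      by (metis dist_Pair_Pair sqrt_sum_squares_le_sum zero_le_dist)
    also have "\<dots> < d" using that r by (simp add: r_def)
    finally have "(s, z) \<in> ball (s1, z1) d" by simp
    then show ?thesis using d(2) by fastforce
  qed
  have lip: "norm (eval2 A s u - eval2 A s v) \<le> \<kappa> * norm (u - v)"
    if "s \<in> ball s1 r" "u \<in> cball z1 (r/2)" "v \<in> cball z1 (r/2)" for s u v
    by (rule field_differentiable_bound[OF convex_cball[of z1 "r/2"] has_field_derivative_eval2 small[OF that(1)]])
       (use that in auto)
  have "isCont (\<lambda>s. eval2 A s z1) s1"
    using continuous_on_eval2[of UNIV "\<lambda>s. s" "\<lambda>_. z1" A] by (simp add: continuous_on_eq_continuous_at)
  moreover have "(1 - \<kappa>) * (r/2) > 0" using \<kappa> r by simp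
  ultimately obtain d1 where d1: "d1 > 0" "\<And>s. s \<in> ball s1 d1 \<Longrightarrow> dist (eval2 A s z1) z1 < (1 - \<kappa>) * (r/2)"
    unfolding continuous_at_eps_delta fp by (metis dist_commute mem_ball)
  have self: "eval2 A s z \<in> cball z1 (r/2)" if s: "s \<in> ball s1 r" "s \<in> ball s1 d1" and z: "z \<in> cball z1 (r/2)" for s z
  proof -
    have "norm (eval2 A s z - z1) \<le> norm (eval2 A s z - eval2 A s z1) + norm (eval2 A s z1 - z1)"
      using norm_triangle_ineq[of "eval2 A s z - eval2 A s z1" "eval2 A s z1 - z1"] by simp
    also have "\<dots> \<le> \<kappa> * norm (z - z1) + (1 - \<kappa>) * (r/2)"
      using lip[OF s(1) z, of z1] d1(2)[OF s(2)] r by (intro add_mono) (auto simp: dist_norm)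
    also have "\<dots> \<le> \<kappa> * (r/2) + (1 - \<kappa>) * (r/2)"
      using z \<kappa> by (intro add_mono mult_left_mono) (auto simp: dist_norm norm_minus_commute)
    also have "\<dots> = r / 2" by (simp add: algebra_simps)
    finally show ?thesis by (simp add: dist_norm norm_minus_commute)
  qed
  obtain N where N: "dist (G N s1) z1 < r / 2"
    using lim r unfolding lim_sequentially by (meson half_gt_zero order_refl)
  have "isCont (\<lambda>s. dist (G N s) z1) s1" using cont[of N] by (intro continuous_intros)
  moreover have "open {..< r / 2}" by simp
  moreover have "dist (G N s1) z1 \<in> {..< r / 2}" using N by simp
  ultimately obtain S where S: "open S" "s1 \<in> S" "\<forall>s\<in>S. dist (G N s) z1 \<in> {..< r / 2}"
    unfolding continuous_at_open by blast
  obtain d2 where d2: "d2 > 0" "\<And>s. s \<in> ball s1 d2 \<Longrightarrow> dist (G N s) z1 < r / 2"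
    using openE[OF S(1,2)] S(3) by (metis lessThan_iff subsetD)
  define \<delta> where "\<delta> = min r (min d1 d2)"
  have \<delta>: "\<delta> > 0" using r d1 d2 by (simp add: \<delta>_def)
  have "\<exists>p. (\<lambda>n. G n s) \<longlonglongrightarrow> p \<and> eval2 A s p = p" if s: "s \<in> ball s1 \<delta>" for s
  proof -
    have s': "s \<in> ball s1 r" "s \<in> ball s1 d1" "s \<in> ball s1 d2" using s by (auto simp: \<delta>_def)
    have "\<exists>!x\<in>cball z1 (r/2). eval2 A s x = x"
    proof (rule Banach_fix[of "cball z1 (r/2)" \<kappa>])
      show "complete (cball z1 (r/2))" by (simp add: compact_imp_complete)
      show "cball z1 (r/2) \<noteq> {}" using r by simp
      show "eval2 A s ` cball z1 (r/2) \<subseteq> cball z1 (r/2)" using self[OF s'(1,2)] by blast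
      show "dist (eval2 A s x) (eval2 A s y) \<le> \<kappa> * dist x y" if "x \<in> cball z1 (r/2)" "y \<in> cball z1 (r/2)" for x y
        using lip[OF s'(1) that] by (simp add: dist_norm)
    qed (use \<kappa> in auto)
    then obtain p where p: "p \<in> cball z1 (r/2)" "eval2 A s p = p" by blast
    have "G (N + m) s \<in> cball z1 (r/2) \<and> norm (G (N + m) s - p) \<le> \<kappa> ^ m * norm (G N s - p)" for m
    proof (induction m)
      case 0 then show ?case using d2(2)[OF s'(3)] by (simp add: dist_commute)
    next
      case (Suc m)
      have "norm (G (N + Suc m) s - p) \<le> \<kappa> * norm (G (N + m) s - p)"
        using lip[OF s'(1) _ p(1), of "G (N + m) s"] Suc p(2) by (simp add: G)
      also have "\<dots> \<le> \<kappa> * (\<kappa> ^ m * norm (G N s - p))" using Suc \<kappa> by (intro mult_left_mono) auto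
      finally show ?case using self[OF s'(1,2)] Suc by (simp add: G mult.assoc)
    qed
    then have *: "norm (G (N + m) s - p) \<le> \<kappa> ^ m * norm (G N s - p)" for m by blast
    have "(\<lambda>m. \<kappa> ^ m * norm (G N s - p)) \<longlonglongrightarrow> 0"
      using \<kappa> by (intro tendsto_mult_left_zero LIMSEQ_power_zero) simp
    then have "(\<lambda>m. G (N + m) s - p) \<longlonglongrightarrow> 0"
      by (rule Lim_null_comparison[rotated]) (use * in auto)
    then have "(\<lambda>m. G (m + N) s) \<longlonglongrightarrow> p" by (simp add: LIM_zero_iff add.commute)
    then have "(\<lambda>n. G n s) \<longlonglongrightarrow> p" by (rule LIMSEQ_offset)
    then show ?thesis using p(2) by blast
  qed
  then obtain p where "\<And>s. s \<in> ball s1 \<delta> \<Longrightarrow> (\<lambda>n. G n s) \<longlonglongrightarrow> p s \<and> eval2 A s (p s) = p s" by metis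
  then show ?thesis using that \<delta> by blast
qed

text \<open>
  Near a repelling fixed point distances to it grow, so only a sequence that hits it can converge to it.
\<close>

lemma converges_to_repelling_imp_eventually_equal:
  fixes F :: "complex \<Rightarrow> complex"
  assumes F: "(F has_field_derivative \<mu>) (at q)" "F q = q" "1 < norm \<mu>"
    and x: "\<And>n. x (Suc n) = F (x n)" and lim: "x \<longlonglongrightarrow> q"
  shows "\<exists>n. x n = q"
proof (rule ccontr)
  assume neg: "\<not> (\<exists>n. x n = q)"
  have "((\<lambda>z. norm ((F z - F q) / (z - q))) \<longlongrightarrow> norm \<mu>) (at q)"
    using F(1) by (intro tendsto_norm) (simp add: has_field_derivative_iff)
  then have "\<forall>\<^sub>F z in at q. 1 < norm ((F z - F q) / (z - q))"
    using F(3) by (rule order_tendstoD(1))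
  then obtain d where d: "d > 0" "\<And>z. z \<noteq> q \<Longrightarrow> dist z q < d \<Longrightarrow> 1 < norm ((F z - F q) / (z - q))"
    unfolding eventually_at by auto
  obtain N where N: "\<And>n. n \<ge> N \<Longrightarrow> dist (x n) q < d"
    using lim d(1) unfolding lim_sequentially by blast
  have step: "dist (x n) q < dist (x (Suc n)) q" if "n \<ge> N" for n
    using d(2)[OF _ N[OF that]] neg F(2) by (simp add: x dist_norm norm_divide field_simps)
  have "dist (x N) q \<le> dist (x (N + n)) q" for n
  proof (induction n)
    case (Suc n)
    then show ?case using step[of "N + n"] by simp
  qed simp
  moreover have "(\<lambda>n. dist (x (N + n)) q) \<longlonglongrightarrow> 0"
    using iffD1[OF tendsto_dist_iff LIMSEQ_ignore_initial_segment[OF lim, of N]] by (simp add: add.commute)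
  ultimately have "dist (x N) q \<le> 0" by (intro LIMSEQ_le_const) auto
  then show False using neg by simp
qed

section \<open>Indifferent cycles lie outside the interior of the connectedness locus\<close>

lemma siegel_iterate_eq_funpow: "eval2 (siegel_iterate \<theta> k) s = siegel_cubic \<theta> (inverse s) ^^ k"
  by (rule ext) (rule eval2_siegel_iterate)

lemma siegel_iterate_add:
  "eval2 (siegel_iterate \<theta> (k + n)) s z = eval2 (siegel_iterate \<theta> k) s (eval2 (siegel_iterate \<theta> n) s z)"
  by (simp add: eval2_siegel_iterate funpow_add)

lemma critical_orbit_not_preperiodic_for_all_parameters:
  assumes \<omega>: "\<omega> = (\<lambda>s. 1) \<or> \<omega> = inverse" and k: "k > 0"
  obtains s where "s \<noteq> 0" "eval2 (siegel_iterate \<theta> (k + n)) s (\<omega> s) \<noteq> eval2 (siegel_iterate \<theta> n) s (\<omega> s)"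
proof -
  let ?g = "\<lambda>n s. eval2 (siegel_iterate \<theta> n) s (\<omega> s)"
  obtain s where s: "s \<noteq> 0" "\<omega> s \<notin> filled_julia (siegel_cubic \<theta> (inverse s))"
  proof (rule disjE[OF \<omega>])
    assume "\<omega> = (\<lambda>s. 1)"
    then show ?thesis using that[of "-100"] critical_point_1_escapes[of \<theta>] by simp
  next
    assume "\<omega> = inverse"
    then show ?thesis using that[of "-1/100"] critical_point_c_escapes[of \<theta>] by simp
  qed
  have "?g (k + n) s \<noteq> ?g n s"
  proof
    let ?f = "siegel_cubic \<theta> (inverse s)"
    assume "?g (k + n) s = ?g n s"
    then have eq: "(?f ^^ k) ((?f ^^ n) (\<omega> s)) = (?f ^^ n) (\<omega> s)"
      by (simp add: eval2_siegel_iterate funpow_add)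
    have "(?f ^^ m) (\<omega> s) \<in> (\<lambda>i. (?f ^^ i) (\<omega> s)) ` {..<n + k}" for m
    proof (cases "m < n")
      case False
      have "(?f ^^ m) (\<omega> s) = (?f ^^ ((m - n) + n)) (\<omega> s)" using False by simp
      also have "\<dots> = (?f ^^ (m - n)) ((?f ^^ n) (\<omega> s))" by (simp only: funpow_add comp_apply)
      also have "\<dots> = (?f ^^ (k * ((m - n) div k) + (m - n) mod k)) ((?f ^^ n) (\<omega> s))" by simp
      also have "\<dots> = (?f ^^ ((m - n) mod k)) ((?f ^^ n) (\<omega> s))" by (rule funpow_period(2)[OF eq])
      also have "\<dots> = (?f ^^ ((m - n) mod k + n)) (\<omega> s)" by (simp only: funpow_add comp_apply)
      finally show ?thesis using k by auto
    qed auto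
    then have "bounded (range (\<lambda>m. (?f ^^ m) (\<omega> s)))"
      by (intro bounded_subset[OF finite_imp_bounded, of "(\<lambda>i. (?f ^^ i) (\<omega> s)) ` {..<n + k}"]) auto
    then show False using s(2) by (simp add: filled_julia_def)
  qed
  then show ?thesis using that s(1) by blast
qed

lemma fsigma_ball: "fsigma (ball (a :: 'a :: metric_space) r)"
proof -
  have "ball a r = (\<Union>n. cball a (r - inverse (real (Suc n))))"
  proof (intro equalityI subsetI)
    fix x assume "x \<in> ball a r"
    then have "0 < r - dist a x" by simp
    then obtain n where "inverse (real (Suc n)) < r - dist a x" using reals_Archimedean by blast
    then show "x \<in> (\<Union>n. cball a (r - inverse (real (Suc n))))" by (intro UN_I[of n]) auto
  next
    fix x assume "x \<in> (\<Union>n. cball a (r - inverse (real (Suc n))))"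
    then obtain n where "dist a x \<le> r - inverse (real (Suc n))" by auto
    moreover have "0 < inverse (real (Suc n))" by simp
    ultimately have "dist a x < r" by linarith
    then show "x \<in> ball a r" by simp
  qed
  then show ?thesis by (metis closed_cball fsigma.intros)
qed

text \<open>
  The critical orbit \<open>G\<close> that is attracted at \<open>s\<^sub>1\<close> converges on the whole disc to a holomorphic function \<open>y\<close> of the
  parameter, whose values are again fixed points of the iterate. If \<open>y\<close> were repelling on some open set, then at
  each parameter of this set \<open>G\<close> would eventually equal \<open>y\<close>; as there are uncountably many such parameters, one
  index serves all of them by the identity theorem, and the critical point is preperiodic for all parameters. So
  the multiplier of \<open>y\<close> has modulus at most 1, and less than 1 by the maximum principle.
\<close>

lemma siegel_attracting_cycle_persists:
  assumes B: "0 \<notin> ball s0 \<rho>" and s1: "s1 \<in> ball s0 \<rho>" and k: "k > 0"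
    and bd: "\<And>s n. s \<in> ball s0 \<rho> \<Longrightarrow> norm (eval2 (siegel_iterate \<theta> n) s 1) \<le> C"
      "\<And>s n. s \<in> ball s0 \<rho> \<Longrightarrow> norm (eval2 (siegel_iterate \<theta> n) s (inverse s)) \<le> C"
    and z1: "eval2 (siegel_iterate \<theta> k) s1 z1 = z1" "norm (eval2 (pderiv (siegel_iterate \<theta> k)) s1 z1) < 1"
  obtains y where "y holomorphic_on ball s0 \<rho>" "\<And>s. s \<in> ball s0 \<rho> \<Longrightarrow> norm (y s) \<le> C" "y s1 = z1"
    "\<And>s. s \<in> ball s0 \<rho> \<Longrightarrow> eval2 (siegel_iterate \<theta> k) s (y s) = y s"
    "\<And>s. s \<in> ball s0 \<rho> \<Longrightarrow> norm (eval2 (pderiv (siegel_iterate \<theta> k)) s (y s)) < 1"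
proof -
  let ?B = "ball s0 \<rho>" and ?A = "siegel_iterate \<theta> k"
  have s1nz: "s1 \<noteq> 0" using B s1 by blast
  obtain \<omega> j where \<omega>: "\<omega> = (\<lambda>s. 1) \<or> \<omega> = inverse" 
    and lim: "(\<lambda>n. eval2 (siegel_iterate \<theta> (k * n + j)) s1 (\<omega> s1)) \<longlonglongrightarrow> z1"
  proof -
    have c: "inverse s1 \<noteq> 0" using s1nz by simp
    interpret expanding_at_infinity "siegel_cubic \<theta> (inverse s1)" "6 * (1 + norm (inverse s1))"
      by (rule siegel_expanding[OF c])
    have "norm (deriv (siegel_cubic \<theta> (inverse s1) ^^ k) z1) < 1"
      using z1(2) deriv_eval2[of ?A s1 z1] unfolding siegel_iterate_eq_funpow by simp
    then obtain w j where w: "deriv (siegel_cubic \<theta> (inverse s1)) w = 0"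
        "(\<lambda>n. (siegel_cubic \<theta> (inverse s1) ^^ (k * n + j)) w) \<longlonglongrightarrow> z1"
      using attracting_cycle_attracts_critical[OF k, of z1] z1(1) unfolding eval2_siegel_iterate by metis
    have "w = 1 \<or> w = inverse s1" using w(1) s1nz unfolding deriv_siegel_cubic[OF c] by simp
    then show ?thesis
    proof
      assume "w = 1"
      then show ?thesis using that[of "\<lambda>s. 1" j] w(2) by (simp add: eval2_siegel_iterate)
    next
      assume "w = inverse s1"
      then show ?thesis using that[of inverse j] w(2) by (simp add: eval2_siegel_iterate)
    qed
  qed
  define G where "G = (\<lambda>n s. eval2 (siegel_iterate \<theta> (k * n + j)) s (\<omega> s))"
  have hol\<omega>: "\<omega> holomorphic_on S" if "0 \<notin> S" for S
    using \<omega> that by (auto intro!: holomorphic_intros)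
  have hol: "(\<lambda>s. eval2 (siegel_iterate \<theta> n) s (\<omega> s)) holomorphic_on S" if "0 \<notin> S" for n S
    using holomorphic_on_eval2[OF holomorphic_on_ident hol\<omega>[OF that]] .
  have holG: "G n holomorphic_on S" if "0 \<notin> S" for n S unfolding G_def by (rule hol[OF that])
  have GS: "G (Suc n) s = eval2 ?A s (G n s)" for n s
    by (simp add: G_def siegel_iterate_add[symmetric] add.assoc)
  have Gb: "norm (G n s) \<le> C" if "s \<in> ?B" for n s using \<omega> bd[OF that] by (auto simp: G_def)
  obtain \<delta> p where \<delta>: "\<delta> > 0" "\<And>s. s \<in> ball s1 \<delta> \<Longrightarrow> (\<lambda>n. G n s) \<longlonglongrightarrow> p s"
    "\<And>s. s \<in> ball s1 \<delta> \<Longrightarrow> eval2 ?A s (p s) = p s"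
  proof (rule attracting_fixed_point_persists[where A = ?A and G = G and ?s1.0 = s1 and ?z1.0 = z1, OF z1 GS])
    show "(\<lambda>n. G n s1) \<longlonglongrightarrow> z1" using lim by (simp add: G_def)
    show "isCont (G n) s1" for n
      by (rule field_differentiable_imp_continuous_at[OF holomorphic_on_imp_differentiable_at[OF holG[of "- {0}" n]]])
         (use s1nz in auto)
  qed (rule that)
  have "open (ball s1 \<delta> \<inter> ?B)" "s1 \<in> ball s1 \<delta> \<inter> ?B" using \<delta>(1) s1 by auto
  then obtain T where T: "open T" "T \<noteq> {}" "T \<subseteq> ?B" "T \<subseteq> ball s1 \<delta>" "s1 \<in> T" by blast
  have convT: "(\<lambda>n. G n s) \<longlonglongrightarrow> p s" if "s \<in> T" for s using that T(4) \<delta>(2) by blast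
  obtain y where y: "y holomorphic_on ?B" "\<And>s. s \<in> ?B \<Longrightarrow> (\<lambda>n. G n s) \<longlonglongrightarrow> y s"
  proof -
    show thesis
      by (rule pointwise_convergence_of_bounded_sequence[OF open_ball connected_ball holG[OF B] Gb T(1,2,3) convT])
         (assumption | rule that)+
  qed
  have yp: "y s = p s" if "s \<in> T" for s
    using LIMSEQ_unique[OF y(2)[OF subsetD[OF T(3) that]] convT[OF that]] .
  have fixed: "eval2 ?A s (y s) = y s" if s: "s \<in> ?B" for s
  proof (rule analytic_continuation_open[OF T(1) open_ball T(2) connected_ball T(3) _ y(1) _ s])
    show "(\<lambda>s. eval2 ?A s (y s)) holomorphic_on ?B" by (rule holomorphic_on_eval2[OF holomorphic_on_ident y(1)])
    show "eval2 ?A s (y s) = y s" if "s \<in> T" for s using \<delta>(3) T(4) yp[OF that] that by auto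
  qed
  have y1: "y s1 = z1"
    using LIMSEQ_unique[OF y(2)[OF s1]] lim by (simp add: G_def)
  define \<nu> where "\<nu> = (\<lambda>s. eval2 (pderiv ?A) s (y s))"
  have hol\<nu>: "\<nu> holomorphic_on ?B" unfolding \<nu>_def by (rule holomorphic_on_eval2[OF holomorphic_on_ident y(1)])
  have le1: "norm (\<nu> s) \<le> 1" if s2: "s \<in> ?B" for s
  proof (rule ccontr)
    assume "\<not> norm (\<nu> s) \<le> 1"
    have "continuous_on ?B (\<lambda>s. norm (\<nu> s))" 
      by (intro continuous_intros holomorphic_on_imp_continuous_on[OF hol\<nu>])
    then have "open (?B \<inter> (\<lambda>s. norm (\<nu> s)) -` {1<..})" by (intro continuous_open_preimage) auto
    moreover have "s \<in> ?B \<inter> (\<lambda>s. norm (\<nu> s)) -` {1<..}" using s2 \<open>\<not> norm (\<nu> s) \<le> 1\<close> by auto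
    ultimately obtain e where e: "e > 0" "ball s e \<subseteq> ?B \<inter> (\<lambda>s. norm (\<nu> s)) -` {1<..}" by (rule openE)
    have "ball s e \<subseteq> (\<Union>n. {u \<in> ?B. G n u = y u})"
    proof
      fix u assume "u \<in> ball s e"
      then have u: "u \<in> ?B" "1 < norm (\<nu> u)" using e(2) by auto
      have "\<exists>n. G n u = y u"
        by (rule converges_to_repelling_imp_eventually_equal[OF has_field_derivative_eval2[of ?A u "y u"] fixed[OF u(1)] _ GS y(2)[OF u(1)]])
           (use u(2) in \<open>simp add: \<nu>_def\<close>)
      then show "u \<in> (\<Union>n. {u \<in> ?B. G n u = y u})" using u(1) by auto
    qed
    then have "uncountable (\<Union>n. {u \<in> ?B. G n u = y u})"
      using uncountable_ball[OF e(1)] countable_subset by blast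
    then obtain N where N: "uncountable {u \<in> ?B. G N u = y u}" by blast
    have GN: "G N u = y u" if "u \<in> ?B" for u
      using holomorphic_countable_equal[OF holG[OF B] y(1) open_ball connected_ball fsigma_ball N] that by blast
    let ?g = "\<lambda>n u. eval2 (siegel_iterate \<theta> n) u (\<omega> u)"
    have eq: "?g (k + (k * N + j)) u = ?g (k * N + j) u" if "u \<in> ?B" for u
      using fixed[OF that] GN[OF that] by (simp add: G_def siegel_iterate_add)
    have con: "connected (- {0 :: complex})" by (simp add: connected_punctured_universe)
    have "?g (k + (k * N + j)) u = ?g (k * N + j) u" if "u \<noteq> 0" for u
    proof (rule analytic_continuation_open[of ?B "- {0}" "?g (k + (k * N + j))" "?g (k * N + j)"])
      show "(\<lambda>u. ?g (k + (k * N + j)) u) holomorphic_on - {0}" by (rule hol) simp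
      show "(\<lambda>u. ?g (k * N + j) u) holomorphic_on - {0}" by (rule hol) simp
      show "?B \<subseteq> - {0}" using B by blast
      show "?B \<noteq> {}" using s1 by blast
    qed (use eq con that in auto)
    then show False using critical_orbit_not_preperiodic_for_all_parameters[OF \<omega> k, of \<theta> "k * N + j"] by metis
  qed
  have lt1: "norm (\<nu> s) < 1" if s: "s \<in> ?B" for s
  proof (rule ccontr)
    assume "\<not> norm (\<nu> s) < 1"
    then have n1: "norm (\<nu> s) = 1" using le1[OF s] by simp
    have "\<nu> constant_on ?B"
      by (rule maximum_modulus_principle[OF hol\<nu> open_ball connected_ball open_ball order_refl s])
         (use le1 n1 in auto)
    then have "\<nu> s = \<nu> s1" using s s1 by (auto simp: constant_on_def)
    then show False using n1 z1(2) y1 by (simp add: \<nu>_def)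
  qed
  show ?thesis
  proof (rule that[OF y(1) _ y1 fixed])
    show "norm (y s) \<le> C" if "s \<in> ?B" for s
      by (rule LIMSEQ_le_const2[OF tendsto_norm[OF y(2)[OF that]]]) (use Gb[OF that] in auto)
    show "norm (eval2 (pderiv ?A) s (y s)) < 1" if "s \<in> ?B" for s
      using lt1[OF that] by (simp add: \<nu>_def)
  qed
qed

text \<open>
  An attracting fixed point of the iterate at a parameter within distance \<open>\<eta>\<close> of \<open>s\<^sub>0\<close>, itself within \<open>\<eta>\<close> of \<open>z\<^sub>0\<close>,
  would continue to an attracting fixed point at \<open>s\<^sub>0\<close>. By the Cauchy estimate (Lipschitz constant \<open>L\<close>) it would be closer to
  \<open>z\<^sub>0\<close> than any other fixed point, hence equal to the indifferent \<open>z\<^sub>0\<close>. So all nearby fixed points are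
  nonattracting, their multiplier is constant, and elimination carries the indifferent cycle to the parameter
  \<open>c = -1/100\<close>, where the critical point 1 escapes.
\<close>

lemma indifferent_cycle_not_in_interior:
  assumes irr: "\<theta> \<notin> \<rat>" and B: "0 \<notin> ball s0 \<rho>" and \<rho>: "\<rho> > 0" and k: "k > 0"
    and bd: "\<And>s n. s \<in> ball s0 \<rho> \<Longrightarrow> norm (eval2 (siegel_iterate \<theta> n) s 1) \<le> C"
      "\<And>s n. s \<in> ball s0 \<rho> \<Longrightarrow> norm (eval2 (siegel_iterate \<theta> n) s (inverse s)) \<le> C"
    and z0: "z0 \<noteq> 0" "eval2 (siegel_iterate \<theta> k) s0 z0 = z0" "norm (eval2 (pderiv (siegel_iterate \<theta> k)) s0 z0) = 1"
  shows False
proof -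
  let ?B = "ball s0 \<rho>" and ?A = "siegel_iterate \<theta> k"
  have nonid: "\<exists>z. eval2 ?A s z \<noteq> z" for s
  proof (rule ccontr)
    assume "\<not> (\<exists>z. eval2 ?A s z \<noteq> z)"
    then have "eval2 ?A s = (\<lambda>z. z)" by auto
    then have "deriv (eval2 ?A s) 0 = 1" by simp
    then show False
      using siegel_multiplier_not_root_of_unity[OF irr k] by (simp add: deriv_eval2 siegel_iterate_multiplier_0)
  qed
  have fin: "finite {z. eval2 ?A s0 z = z}"
  proof -
    have "\<exists>z. eval2 (?A - [:0, 1:]) s0 z \<noteq> 0" using nonid[of s0] by auto
    then have "map_poly (\<lambda>a. poly a s0) (?A - [:0, 1:]) \<noteq> 0" unfolding eval2_map_poly by auto
    then have "finite {z. eval2 (?A - [:0, 1:]) s0 z = 0}" unfolding eval2_map_poly by (rule poly_roots_finite)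
    then show ?thesis by simp
  qed
  obtain d where d: "d > 0" "\<And>z. eval2 ?A s0 z = z \<Longrightarrow> z \<noteq> z0 \<Longrightarrow> d \<le> dist z0 z"
    using finite_set_avoid[OF fin, of z0] by auto
  have C0: "C \<ge> 0" using bd(1)[of s0 0] \<rho> norm_ge_zero order_trans by (metis centre_in_ball)
  define L where "L = C / (\<rho> / 2)"
  have L0: "L \<ge> 0" using C0 \<rho> by (simp add: L_def)
  define \<eta> where "\<eta> = min (\<rho> / 2) (d / (2 * (L + 1)))"
  have \<eta>: "\<eta> > 0" "\<eta> \<le> \<rho> / 2" "(L + 1) * \<eta> < d"
  proof -
    show "\<eta> > 0" using \<rho> d(1) L0 by (auto simp: \<eta>_def)
    show "\<eta> \<le> \<rho> / 2" unfolding \<eta>_def by (rule min.cobounded1)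
    have "(L + 1) * \<eta> \<le> (L + 1) * (d / (2 * (L + 1)))" using L0 by (intro mult_left_mono) (auto simp: \<eta>_def)
    also have "\<dots> = d / 2" using L0 by (simp add: field_simps)
    finally show "(L + 1) * \<eta> < d" using d(1) by simp
  qed
  have nonattr: "1 \<le> norm (eval2 (pderiv ?A) s z)" if s: "s \<in> ball s0 \<eta>" and z: "z \<in> ball z0 \<eta>" "eval2 ?A s z = z" for s z
  proof (rule ccontr)
    assume "\<not> 1 \<le> norm (eval2 (pderiv ?A) s z)"
    then have attr: "norm (eval2 (pderiv ?A) s z) < 1" by simp
    have sB: "s \<in> ?B" using s \<eta> \<rho> by auto
    obtain y where y: "y holomorphic_on ?B" "\<And>s. s \<in> ?B \<Longrightarrow> norm (y s) \<le> C" "y s = z"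
      "\<And>s. s \<in> ?B \<Longrightarrow> eval2 ?A s (y s) = y s" "\<And>s. s \<in> ?B \<Longrightarrow> norm (eval2 (pderiv ?A) s (y s)) < 1"
      using siegel_attracting_cycle_persists[OF B sB k bd z(2) attr] by metis
    have dy: "norm (deriv y u) \<le> L" if u: "u \<in> ball s0 (\<rho>/2)" for u
    proof -
      have sub: "cball u (\<rho>/2) \<subseteq> ?B"
      proof
        fix v assume "v \<in> cball u (\<rho>/2)"
        then show "v \<in> ?B" using u dist_triangle[of s0 v u] by simp
      qed
      have "norm ((deriv ^^ 1) y u) \<le> fact 1 * C / (\<rho>/2) ^ 1"
      proof (rule Cauchy_inequality)
        show "y holomorphic_on ball u (\<rho>/2)" by (rule holomorphic_on_subset[OF y(1) order_trans[OF ball_subset_cball sub]])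
        show "continuous_on (cball u (\<rho>/2)) y" by (rule continuous_on_subset[OF holomorphic_on_imp_continuous_on[OF y(1)] sub])
        fix v assume "norm (u - v) = \<rho>/2"
        then show "norm (y v) \<le> C" using sub y(2) by (auto simp: dist_norm)
      qed (use \<rho> in simp)
      then show ?thesis by (simp add: L_def)
    qed
    have "norm (y s - y s0) \<le> L * norm (s - s0)"
    proof (rule field_differentiable_bound[of "ball s0 (\<rho>/2)"])
      show "(y has_field_derivative deriv y u) (at u within ball s0 (\<rho>/2))" if "u \<in> ball s0 (\<rho>/2)" for u
        by (rule has_field_derivative_at_within[OF holomorphic_derivI[OF y(1) open_ball]]) (use that \<rho> in simp)
      show "s \<in> ball s0 (\<rho>/2)" using s \<eta>(2) by simp
      show "s0 \<in> ball s0 (\<rho>/2)" using \<rho> by simp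
    qed (simp_all add: dy[simplified])
    also have "\<dots> \<le> L * \<eta>" using s L0 by (intro mult_left_mono) (auto simp: dist_norm norm_minus_commute)
    finally have "dist z (y s0) \<le> L * \<eta>" using y(3) by (simp add: dist_norm)
    then have "dist z0 (y s0) < d"
      using z(1) \<eta>(3) dist_triangle[of z0 "y s0" z] by (simp add: algebra_simps)
    moreover have s0B: "s0 \<in> ?B" using \<rho> by simp
    ultimately have "y s0 = z0" using d(2)[OF y(4)[OF s0B]] by force
    then show False using y(5)[OF s0B] z0(3) by simp
  qed
  define \<mu>0 where "\<mu>0 = eval2 (pderiv ?A) s0 z0"
  have \<mu>0: "norm \<mu>0 = 1" using z0(3) by (simp add: \<mu>0_def)
  obtain \<delta> where \<delta>: "\<delta> > 0" "\<And>s. s \<in> ball s0 \<delta> \<Longrightarrow> \<exists>z\<in>ball z0 (norm z0). eval2 ?A s z = z \<and> eval2 (pderiv ?A) s z = \<mu>0"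
  proof (rule nonrepelling_or_persistent[OF z0(2) \<mu>0_def[symmetric] \<mu>0 nonid \<eta>(1)])
    show "1 \<le> norm (eval2 (pderiv ?A) s z)" if "s \<in> ball s0 \<eta>" "z \<in> ball z0 \<eta>" "eval2 ?A s z = z" for s z
      using nonattr[OF that] .
    show "0 < norm z0" using z0(1) by simp
  qed (rule that)
  define \<epsilon> where "\<epsilon> = min \<delta> \<rho>"
  have "infinite (ball s0 \<epsilon>)" using \<delta>(1) \<rho> uncountable_ball[of \<epsilon> s0] countable_finite by (auto simp: \<epsilon>_def)
  moreover have "s \<noteq> 0 \<and> (\<exists>z. z \<noteq> 0 \<and> eval2 ?A s z = z \<and> eval2 (pderiv ?A) s z = \<mu>0)" if s: "s \<in> ball s0 \<epsilon>" for s
  proof -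
    have "s \<in> ball s0 \<delta>" "s \<in> ?B" using s by (auto simp: \<epsilon>_def)
    then obtain z where "z \<in> ball z0 (norm z0)" "eval2 ?A s z = z" "eval2 (pderiv ?A) s z = \<mu>0" using \<delta>(2) by blast
    then show ?thesis using \<open>s \<in> ?B\<close> B by (intro conjI exI[of _ z]) auto
  qed
  ultimately obtain z where z: "z \<noteq> 0" "eval2 ?A (-100) z = z" "eval2 (pderiv ?A) (-100) z = \<mu>0"
    using persistent_cycle_for_all_parameters[OF irr k, of "ball s0 \<epsilon>" \<mu>0 "-100"] by auto
  have c: "inverse (-100 :: complex) \<noteq> 0" by simp
  have "1 \<in> filled_julia (siegel_cubic \<theta> (inverse (-100)))"
  proof (rule siegel_indifferent_imp_critical_bounded(1)[OF c k])
    show "(siegel_cubic \<theta> (inverse (- 100)) ^^ k) z = z" using z(2) by (simp only: eval2_siegel_iterate)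
    show "norm (deriv (siegel_cubic \<theta> (inverse (- 100)) ^^ k) z) = 1"
      using deriv_eval2[of ?A "-100" z] z(3) \<mu>0 by (simp only: siegel_iterate_eq_funpow)
  qed (rule z(1))
  then show False using critical_point_1_escapes[of \<theta>] by simp
qed

theorem theorem3p2:
  fixes \<theta> :: real and c0 :: complex
  assumes "0 < \<theta>" and "\<theta> < 1" and "brjuno \<theta>"
    and "c0 \<noteq> 0"
    and "\<exists>X. indifferent_periodic_orbit (siegel_cubic \<theta> c0) X \<and> X \<noteq> {0}"
  shows "c0 \<in> top_of_set (- {0}) frontier_of M3 \<theta>"
proof -
  let ?f = "siegel_cubic \<theta> c0"
  have irr: "\<theta> \<notin> \<rat>" using assms(3) by (simp add: brjuno_def)
  obtain z where z: "periodic_point ?f z" "range (\<lambda>n. (?f ^^ n) z) \<noteq> {0}" "norm (multiplier ?f z) = 1"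
    using assms(5) unfolding indifferent_periodic_orbit_def by blast
  define k where "k = period ?f z"
  have k: "k > 0" "(?f ^^ k) z = z"
  proof -
    obtain n where "n > 0 \<and> (?f ^^ n) z = z" using z(1) by (auto simp: periodic_point_def)
    then have "k > 0 \<and> (?f ^^ k) z = z" unfolding k_def period_def by (rule LeastI)
    then show "k > 0" "(?f ^^ k) z = z" by auto
  qed
  have mult: "norm (deriv (?f ^^ k) z) = 1" using z(3) by (simp add: multiplier_def k_def)
  interpret expanding_at_infinity ?f "6 * (1 + norm c0)" by (rule siegel_expanding[OF assms(4)])
  have z0: "z \<noteq> 0"
  proof
    assume "z = 0"
    then show False using z(2) funpow_fix0 by auto
  qed
  have mem: "c0 \<in> M3 \<theta>"
    using siegel_indifferent_imp_critical_bounded[OF assms(4) k mult z0] connected_julia_siegel_iff[OF assms(4)] assms(4)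
    by (simp add: M3_def)
  have not_interior: False if T: "open T" "c0 \<in> T" "T \<subseteq> M3 \<theta>" for T
  proof -
    define s0 where "s0 = inverse c0"
    have s0: "s0 \<noteq> 0" "inverse s0 = c0" using assms(4) by (auto simp: s0_def)
    have "continuous_on (- {0 :: complex}) inverse" by (intro continuous_intros) auto
    then have "open ((- {0}) \<inter> inverse -` (T \<inter> ball c0 1))"
      using T(1) by (intro continuous_open_preimage) auto
    moreover have "s0 \<in> (- {0}) \<inter> inverse -` (T \<inter> ball c0 1)" using s0 T(2) by auto
    ultimately obtain \<rho> where \<rho>: "\<rho> > 0" "ball s0 \<rho> \<subseteq> (- {0}) \<inter> inverse -` (T \<inter> ball c0 1)" by (rule openE)
    show False
    proof (rule indifferent_cycle_not_in_interior[OF irr _ \<rho>(1) k(1) _ _ z0])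
      show "0 \<notin> ball s0 \<rho>" using \<rho>(2) by auto
      show "eval2 (siegel_iterate \<theta> k) s0 z = z" using k(2) s0(2) by (simp add: eval2_siegel_iterate)
      show "norm (eval2 (pderiv (siegel_iterate \<theta> k)) s0 z) = 1"
        unfolding deriv_eval2[symmetric] siegel_iterate_eq_funpow s0(2) by (rule mult)
      fix s n assume s: "s \<in> ball s0 \<rho>"
      then have c: "inverse s \<noteq> 0" "inverse s \<in> T" "inverse s \<in> ball c0 1" using \<rho>(2) by auto
      let ?g = "siegel_cubic \<theta> (inverse s)"
      interpret s: expanding_at_infinity "?g" "6 * (1 + norm (inverse s))"
        by (rule siegel_expanding[OF c(1)])
      have "connected (julia (?g))" using T(3) c(2) by (auto simp: M3_def)
      then have K: "1 \<in> filled_julia (?g)" "inverse s \<in> filled_julia (?g)"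
        using connected_julia_siegel_iff[OF c(1), of \<theta>] by auto
      have "norm (inverse s) \<le> norm c0 + 1"
        using c(3) norm_triangle_ineq2[of "inverse s" c0] by (simp add: dist_norm norm_minus_commute)
      then have le: "6 * (1 + norm (inverse s)) \<le> 6 * (2 + norm c0)" by simp
      have "norm ((?g ^^ n) 1) \<le> 6 * (1 + norm (inverse s))"
        using K(1) unfolding s.filled_julia_eq by blast
      then show "norm (eval2 (siegel_iterate \<theta> n) s 1) \<le> 6 * (2 + norm c0)"
        unfolding eval2_siegel_iterate using le by (rule order_trans)
      have "norm ((?g ^^ n) (inverse s)) \<le> 6 * (1 + norm (inverse s))"
        using K(2) unfolding s.filled_julia_eq by blast
      then show "norm (eval2 (siegel_iterate \<theta> n) s (inverse s)) \<le> 6 * (2 + norm c0)"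
        unfolding eval2_siegel_iterate using le by (rule order_trans)
    qed
  qed
  have sub: "M3 \<theta> \<subseteq> topspace (top_of_set (- {0}))" by (auto simp: M3_def)
  have "c0 \<in> top_of_set (- {0}) closure_of M3 \<theta>"
    by (rule subsetD[OF closure_of_subset[OF sub] mem])
  moreover have "c0 \<notin> top_of_set (- {0}) interior_of M3 \<theta>"
  proof
    assume "c0 \<in> top_of_set (- {0}) interior_of M3 \<theta>"
    then obtain T where T: "openin (top_of_set (- {0})) T" "c0 \<in> T" "T \<subseteq> M3 \<theta>"
      by (auto simp: interior_of_def)
    have "open T" using T(1) openin_open_eq[of "- {0}" T] by (simp add: open_Compl)
    then show False using not_interior T(2,3) by blast
  qed
  ultimately show ?thesis by (simp add: frontier_of_def)
qed

end
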